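(* Let $r>0$, let $X$ be a complete Hausdorff locally convex space and $(T(t))_{t\geq 0}$ a strongly continuous quasi-equicontinuous semigroup on $X$ with generator $A$ such that $0\in\rho(A)$. Let $U$ be a Hausdorff locally convex space and $B\in\mathcal{L}(U;X_{-1})$. Consider the following assertions. (a) $(T(t))_{t\geq 0}$ satisfies $\mathrm{C}$-maximal regularity for $(A_{-1}^{-1}B,r)$. (b) For all $f\in \mathrm{C}([0,r];U)$: $(T\ast A_{-1}^{-1}Bf)(t)\in D(A)$ for all $t\in [0,r]$ and $A(T\ast A_{-1}^{-1}Bf)$ is right-continuous on $[0,r]$. (c) $B$ is $\mathrm{C}$-admissible for $r$. (d) $(T(t)A_{-1}^{-1}B)_{t\in [0,r]}$ is of bounded semivariation. Then (a)$\Rightarrow$(b) and (d)$\Rightarrow$(b)$\Rightarrow$(c). If $X$ is a $3\mathrm{C}_{U,A,r}^{A_{-1}^{-1}B}$-space, then (c)$\Rightarrow$(d). If (i) $U$ is an invariant subspace of $X$ with respect to $(T(t))_{t\geq 0}$ and $A_{-1}^{-1}B$ is commuting with $(T(t))_{t\geq 0}$, or (ii) $X$ is a generalised Schwartz space, then (d)$\Rightarrow$(a).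
   Context: All spaces are over $\mathbb{K}=\mathbb{R}$ or $\mathbb{C}$. For a Hausdorff locally convex space $X$, $\Gamma_X$ denotes a fundamental system of seminorms (a family of continuous seminorms such that every continuous seminorm $q$ on $X$ satisfies $q\le Cp$ for some $p\in\Gamma_X$, $C\ge 0$). $\mathcal{L}(X;Y)$ is the space of continuous linear maps, $\mathcal{L}(X)=\mathcal{L}(X;X)$. $\mathrm{C}([0,r];X)$ is the space of continuous functions $[0,r]\to X$ with the seminorms $\|f\|_p=\sup_{s\in[0,r]}p(f(s))$, $p\in\Gamma_X$. A family $(T(t))_{t\ge0}$ in $\mathcal{L}(X)$ is a semigroup if $T(0)=\mathrm{id}$ and $T(t+s)=T(t)T(s)$; strongly continuous if $t\mapsto T(t)x$ is continuous on $[0,\infty)$ for all $x\in X$; quasi-equicontinuous if there is $\omega\in\mathbb{R}$ such that for all $q\in\Gamma_X$ there are $p\in\Gamma_X$, $C\ge0$ with $q(e^{-\omega t}T(t)x)\le Cp(x)$ for all $t\ge0$, $x\in X$. Its generator is $Ax=\lim_{t\to0+}\frac{T(t)x-x}{t}$ with domain $D(A)$ the set of $x\in X$ for which this limit exists. $\rho(A)$ is the set of $\lambda\in\mathbb{C}$ such that $\lambda-A\colon D(A)\to X$ is bijective with $(\lambda-A)^{-1}\in\mathcal{L}(X)$. Extrapolation space (for $0\in\rho(A)$): $(X_{-1},\tau_{-1})$ is the completion of $X$ with respect to the seminorms $x\mapsto p(A^{-1}x)$, $p\in\Gamma_X$. Each $T(t)$ extends uniquely to a continuous linear $T_{-1}(t)$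 on $X_{-1}$, and $(T_{-1}(t))_{t\ge0}$ is a strongly continuous quasi-equicontinuous semigroup on $X_{-1}$ with generator $A_{-1}$, $D(A_{-1})=X$; $A_{-1}\colon X\to X_{-1}$ is a topological isomorphism extending $A$ and $T_{-1}(t)=A_{-1}T(t)A_{-1}^{-1}$ (known facts). For a strongly continuous locally equicontinuous semigroup $S$ on a sequentially complete space $Y$ and $g\in\mathrm{C}([0,r];Y)$, $(S\ast g)(t)=\int_0^tS(t-s)g(s)\,\mathrm{d}s$ (Riemann integral in $Y$). $B\in\mathcal{L}(U;X_{-1})$ is $\mathrm{C}$-admissible for $r$ if $(T_{-1}\ast Bf)(r)=\int_0^rT_{-1}(r-s)Bf(s)\,\mathrm{d}s$ (Riemann integral in $X_{-1}$) belongs to $X$ for all $f\in\mathrm{C}([0,r];U)$. For $D\in\mathcal{L}(U;X)$, $(T(t))_{t\ge0}$ satisfies $\mathrm{C}$-maximal regularity for $(D,r)$ if for all $f\in\mathrm{C}([0,r];U)$ one has $(T\ast Df)(t)\in D(A)$ for all $t\in[0,r]$ and $A(T\ast Df)\in\mathrm{C}([0,r];X)$. For $\alpha\colon[a,b]\to\mathcal{L}(U;X)$, $q\in\Gamma_X$, $p\in\Gamma_U$, let $SV_{q,p}(\alpha)$ be the supremum of $q\bigl(\sum_{i=1}^n(\alpha(d_i)-\alpha(d_{i-1}))x_i\bigr)$ over all partitions $a=d_0<\dots<d_n=b$ and all $x_i\in U$ with $p(x_i)\le1$; $\alpha$ is of bounded semivariation if for every $q\in\Gamma_X$ there is $p\in\Gamma_U$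 with $SV_{q,p}(\alpha)<\infty$. A family $(S(t))_{t\in[0,r]}$ in $\mathcal{L}(U;X)$ is of bounded semivariation if $t\mapsto S(t)$ is. $3\mathrm{C}_{U,A,r}^{D}$-space, $D\in\mathcal{L}(U;X)$: suppose $\Psi_r^D(f):=(T\ast Df)(r)\in D(A)$ for all $f\in\mathrm{C}([0,r];U)$. Then $X$ is called a $3\mathrm{C}_{U,A,r}^{D}$-space if the (closed) linear map $A\Psi_r^D\colon\mathrm{C}([0,r];U)\to X$ is continuous. $U$ is an invariant subspace of $X$ if it is a topological linear subspace of $X$ with $T(t)x\in U$ for all $t\ge0$, $x\in U$; then $D\in\mathcal{L}(U;X)$ is commuting with the semigroup if $T(t)Dx=DT(t)x$ for all $t\ge0$, $x\in U$. $X$ is a generalised Schwartz space if every bounded subset of $X$ is precompact. *)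

theory Defs
  imports "HOL-Analysis.Analysis"
begin

section \<open>Locally convex spaces\<close>

text \<open>
  The scalar field is a type of class \<^class>\<open>real_normed_field\<close>. Its norm is multiplicative, so by
  the Gelfand--Mazur theorem the instances are, up to isometric isomorphism, exactly the real and
  the complex numbers.

  The class \<^class>\<open>uniform_topological_group_add\<close> provides the canonical translation-invariant
  uniformity of the additive group, so that \<^const>\<open>complete\<close> and \<^const>\<open>totally_bounded\<close> have their
  usual meaning for topological vector spaces. The Hausdorff property is \<^class>\<open>t2_space\<close>.
\<close>

locale locally_convex_space = vector_space scale
  for scale :: "'k::real_normed_field \<Rightarrow>
    'x::{real_vector, uniform_topological_group_add, t2_space} \<Rightarrow> 'x" +
  assumes scale_of_real: "scale (of_real a) x = a *\<^sub>R x"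
    and continuous_scale: "continuous_on UNIV (\<lambda>(c, x). scale c x)"
    and locally_convex:
      "\<And>W :: 'x set. open W \<Longrightarrow> 0 \<in> W \<Longrightarrow> \<exists>V. open V \<and> convex V \<and> 0 \<in> V \<and> V \<subseteq> W"

definition seminorm :: "('k::real_normed_field \<Rightarrow> 'x::ab_group_add \<Rightarrow> 'x) \<Rightarrow> ('x \<Rightarrow> real) \<Rightarrow> bool"
  where "seminorm scaleX p \<longleftrightarrow>
    (\<forall>x y. p (x + y) \<le> p x + p y) \<and> (\<forall>c x. p (scaleX c x) = norm c * p x)"

definition fundamental_system ::
    "('k::real_normed_field \<Rightarrow> 'x::{ab_group_add, topological_space} \<Rightarrow> 'x) \<Rightarrow> ('x \<Rightarrow> real) set \<Rightarrow> bool"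
  where "fundamental_system scaleX \<Gamma> \<longleftrightarrow>
    (\<forall>p\<in>\<Gamma>. seminorm scaleX p \<and> continuous_on UNIV p) \<and>
    (\<forall>q. seminorm scaleX q \<and> continuous_on UNIV q \<longrightarrow> (\<exists>p\<in>\<Gamma>. \<exists>C\<ge>0. \<forall>x. q x \<le> C * p x))"

definition continuous_linear ::
    "('k::field \<Rightarrow> 'x::{ab_group_add, topological_space} \<Rightarrow> 'x) \<Rightarrow>
     ('k \<Rightarrow> 'y::{ab_group_add, topological_space} \<Rightarrow> 'y) \<Rightarrow> ('x \<Rightarrow> 'y) \<Rightarrow> bool"
  where "continuous_linear scaleX scaleY F \<longleftrightarrow>
    Vector_Spaces.linear scaleX scaleY F \<and> continuous_on UNIV F"

definition seminorm_topology :: "'a::minus set \<Rightarrow> ('a \<Rightarrow> real) set \<Rightarrow> 'a topology"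
  where "seminorm_topology S \<Gamma> =
    topology_generated_by {{g \<in> S. p (g - f) < e} | f p e. f \<in> S \<and> p \<in> \<Gamma> \<and> 0 < e}"

definition bounded_set :: "('x \<Rightarrow> real) set \<Rightarrow> 'x set \<Rightarrow> bool"
  where "bounded_set \<Gamma> S \<longleftrightarrow> (\<forall>p\<in>\<Gamma>. bdd_above (p ` S))"

definition generalised_schwartz :: "('x::uniform_space \<Rightarrow> real) set \<Rightarrow> bool"
  where "generalised_schwartz \<Gamma> \<longleftrightarrow> (\<forall>S. bounded_set \<Gamma> S \<longrightarrow> totally_bounded S)"


section \<open>Semigroups and generators\<close>

text \<open>A semigroup is a function on the reals of which only the values at \<open>t \<ge> 0\<close> matter.\<close>

definition operator_semigroup ::
    "('k::field \<Rightarrow> 'x::{ab_group_add, topological_space} \<Rightarrow> 'x) \<Rightarrow> (real \<Rightarrow> 'x \<Rightarrow> 'x) \<Rightarrow> bool"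
  where "operator_semigroup scaleX T \<longleftrightarrow>
    (\<forall>t\<ge>0. continuous_linear scaleX scaleX (T t)) \<and> T 0 = id \<and>
    (\<forall>t\<ge>0. \<forall>s\<ge>0. T (t + s) = T t \<circ> T s)"

definition strongly_continuous :: "(real \<Rightarrow> 'x \<Rightarrow> 'x::topological_space) \<Rightarrow> bool"
  where "strongly_continuous T \<longleftrightarrow> (\<forall>x. continuous_on {0..} (\<lambda>t. T t x))"

definition quasi_equicontinuous ::
    "('x \<Rightarrow> real) set \<Rightarrow> (real \<Rightarrow> 'x \<Rightarrow> 'x::real_vector) \<Rightarrow> bool"
  where "quasi_equicontinuous \<Gamma> T \<longleftrightarrow>
    (\<exists>\<omega>::real. \<forall>q\<in>\<Gamma>. \<exists>p\<in>\<Gamma>. \<exists>C\<ge>0. \<forall>t\<ge>0. \<forall>x. q (exp (- \<omega> * t) *\<^sub>R T t x) \<le> C * p x)"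

definition generator_domain ::
    "(real \<Rightarrow> 'x \<Rightarrow> 'x::{real_vector, topological_space}) \<Rightarrow> 'x set"
  where "generator_domain T = {x. \<exists>y. ((\<lambda>t. (T t x - x) /\<^sub>R t) \<longlongrightarrow> y) (at_right 0)}"

definition generator :: "(real \<Rightarrow> 'x \<Rightarrow> 'x::{real_vector, t2_space}) \<Rightarrow> 'x \<Rightarrow> 'x"
  where "generator T x = Lim (at_right 0) (\<lambda>t. (T t x - x) /\<^sub>R t)"

definition resolvent_set ::
    "('k::field \<Rightarrow> 'x::{ab_group_add, topological_space} \<Rightarrow> 'x) \<Rightarrow> 'x set \<Rightarrow> ('x \<Rightarrow> 'x) \<Rightarrow> 'k set"
  where "resolvent_set scaleX S A =
    {\<mu>. bij_betw (\<lambda>x. scaleX \<mu> x - A x) S UNIV \<and>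
         continuous_linear scaleX scaleX (the_inv_into S (\<lambda>x. scaleX \<mu> x - A x))}"


section \<open>Extrapolation space\<close>

text \<open>
  The completion \<open>X\<^sub>-\<^sub>1\<close> is a space of another type together with the canonical embedding
  \<open>j\<close> of \<open>X\<close>; the subset \<open>X\<close> of \<open>X\<^sub>-\<^sub>1\<close> is \<open>range j\<close>.
\<close>

definition extrapolation_space ::
    "('k::real_normed_field \<Rightarrow> 'x::{real_vector, t2_space} \<Rightarrow> 'x) \<Rightarrow>
     ('x \<Rightarrow> real) set \<Rightarrow> (real \<Rightarrow> 'x \<Rightarrow> 'x) \<Rightarrow>
     ('k \<Rightarrow> 'z::{real_vector, uniform_topological_group_add, t2_space} \<Rightarrow> 'z) \<Rightarrow>
     ('x \<Rightarrow> 'z) \<Rightarrow> bool"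
  where "extrapolation_space scaleX \<Gamma>\<^sub>X T scaleZ j \<longleftrightarrow>
    locally_convex_space scaleZ \<and> complete (UNIV :: 'z set) \<and>
    Vector_Spaces.linear scaleX scaleZ j \<and> closure (range j) = UNIV \<and>
    embedding_map
      (seminorm_topology UNIV
        ((\<lambda>p x. p (the_inv_into (generator_domain T) (generator T) x)) ` \<Gamma>\<^sub>X))
      euclidean j"

definition extrapolation_semigroup ::
    "('k::field \<Rightarrow> 'z::{ab_group_add, topological_space} \<Rightarrow> 'z) \<Rightarrow> ('x \<Rightarrow> 'z) \<Rightarrow>
     (real \<Rightarrow> 'x \<Rightarrow> 'x) \<Rightarrow> real \<Rightarrow> 'z \<Rightarrow> 'z"
  where "extrapolation_semigroup scaleZ j T t =
    (THE S. continuous_linear scaleZ scaleZ S \<and> (\<forall>x. S (j x) = j (T t x)))"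

text \<open>
  The map \<open>A\<^sub>-\<^sub>1\<close>-inverse from \<open>X\<^sub>-\<^sub>1\<close> to \<open>X\<close>, where \<open>A\<^sub>-\<^sub>1\<close> is the generator of the
  extrapolated semigroup, with domain \<open>range j\<close>.
\<close>

definition extrapolation_inverse ::
    "('k::field \<Rightarrow> 'z::{real_vector, t2_space} \<Rightarrow> 'z) \<Rightarrow> ('x \<Rightarrow> 'z) \<Rightarrow>
     (real \<Rightarrow> 'x \<Rightarrow> 'x) \<Rightarrow> 'z \<Rightarrow> 'x"
  where "extrapolation_inverse scaleZ j T z =
    (THE x. j x \<in> generator_domain (extrapolation_semigroup scaleZ j T) \<and>
            generator (extrapolation_semigroup scaleZ j T) (j x) = z)"


section \<open>Convolution, admissibility and maximal regularity\<close>

definition has_riemann_integral ::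
    "(real \<Rightarrow> 'x::{real_vector, topological_space}) \<Rightarrow> 'x \<Rightarrow> real \<Rightarrow> real \<Rightarrow> bool"
  where "has_riemann_integral f I a b \<longleftrightarrow>
    (\<forall>W. open W \<and> I \<in> W \<longrightarrow>
      (\<exists>\<delta>>0. \<forall>P. P tagged_division_of {a..b} \<and> (\<forall>(s, K)\<in>P. measure lborel K < \<delta>) \<longrightarrow>
        (\<Sum>(s, K)\<in>P. measure lborel K *\<^sub>R f s) \<in> W))"

definition riemann_integral ::
    "real \<Rightarrow> real \<Rightarrow> (real \<Rightarrow> 'x::{real_vector, topological_space}) \<Rightarrow> 'x"
  where "riemann_integral a b f = (THE I. has_riemann_integral f I a b)"

definition convolution ::
    "(real \<Rightarrow> 'x \<Rightarrow> 'x::{real_vector, topological_space}) \<Rightarrow> (real \<Rightarrow> 'x) \<Rightarrow> real \<Rightarrow> 'x"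
  where "convolution S g t = riemann_integral 0 t (\<lambda>s. S (t - s) (g s))"

text \<open>
  Elements of \<open>C([0,r];U)\<close> are represented by functions on the reals vanishing outside \<open>[0,r]\<close>,
  which are determined by their values on \<open>[0,r]\<close>.
\<close>

definition C_space :: "real \<Rightarrow> (real \<Rightarrow> 'u::{zero, topological_space}) set"
  where "C_space r = {f. continuous_on {0..r} f \<and> (\<forall>s. s \<notin> {0..r} \<longrightarrow> f s = 0)}"

definition C_topology ::
    "('u \<Rightarrow> real) set \<Rightarrow> real \<Rightarrow> (real \<Rightarrow> 'u::{ab_group_add, topological_space}) topology"
  where "C_topology \<Gamma> r =
    seminorm_topology (C_space r) ((\<lambda>p f. SUP s\<in>{0..r}. p (f s)) ` \<Gamma>)"

definition C_admissible ::
    "('k::field \<Rightarrow> 'z::{real_vector, topological_space} \<Rightarrow> 'z) \<Rightarrow> ('x \<Rightarrow> 'z) \<Rightarrow>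
     (real \<Rightarrow> 'x \<Rightarrow> 'x) \<Rightarrow> ('u::{zero, topological_space} \<Rightarrow> 'z) \<Rightarrow> real \<Rightarrow> bool"
  where "C_admissible scaleZ j T B r \<longleftrightarrow>
    (\<forall>f \<in> C_space r. convolution (extrapolation_semigroup scaleZ j T) (B \<circ> f) r \<in> range j)"

definition C_maximal_regularity ::
    "(real \<Rightarrow> 'x \<Rightarrow> 'x::{real_vector, t2_space}) \<Rightarrow>
     ('u::{zero, topological_space} \<Rightarrow> 'x) \<Rightarrow> real \<Rightarrow> bool"
  where "C_maximal_regularity T D r \<longleftrightarrow>
    (\<forall>f \<in> C_space r.
      (\<forall>t\<in>{0..r}. convolution T (D \<circ> f) t \<in> generator_domain T) \<and>
      continuous_on {0..r} (\<lambda>t. generator T (convolution T (D \<circ> f) t)))"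

definition right_continuous_on :: "real \<Rightarrow> real \<Rightarrow> (real \<Rightarrow> 'x::topological_space) \<Rightarrow> bool"
  where "right_continuous_on a b g \<longleftrightarrow> (\<forall>t\<in>{a..<b}. (g \<longlongrightarrow> g t) (at_right t))"

definition semivariation ::
    "('x \<Rightarrow> real) \<Rightarrow> ('u \<Rightarrow> real) \<Rightarrow> real \<Rightarrow> real \<Rightarrow> (real \<Rightarrow> 'u \<Rightarrow> 'x::ab_group_add) \<Rightarrow> ereal"
  where "semivariation q p a b \<alpha> =
    Sup {ereal (q (\<Sum>i = 1..n. \<alpha> (d i) (x i) - \<alpha> (d (i - 1)) (x i))) | (n::nat) d x.
      d 0 = a \<and> d n = b \<and> strict_mono_on {0..n} d \<and> (\<forall>i\<in>{1..n}. p (x i) \<le> 1)}"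

definition bounded_semivariation ::
    "('x \<Rightarrow> real) set \<Rightarrow> ('u \<Rightarrow> real) set \<Rightarrow> real \<Rightarrow> real \<Rightarrow> (real \<Rightarrow> 'u \<Rightarrow> 'x::ab_group_add) \<Rightarrow> bool"
  where "bounded_semivariation \<Gamma>\<^sub>X \<Gamma>\<^sub>U a b \<alpha> \<longleftrightarrow>
    (\<forall>q\<in>\<Gamma>\<^sub>X. \<exists>p\<in>\<Gamma>\<^sub>U. semivariation q p a b \<alpha> < \<infinity>)"

definition three_C_space ::
    "('u::{ab_group_add, topological_space} \<Rightarrow> real) set \<Rightarrow>
     (real \<Rightarrow> 'x \<Rightarrow> 'x::{real_vector, t2_space}) \<Rightarrow> ('u \<Rightarrow> 'x) \<Rightarrow> real \<Rightarrow> bool"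
  where "three_C_space \<Gamma>\<^sub>U T D r \<longleftrightarrow>
    (\<forall>f \<in> C_space r. convolution T (D \<circ> f) r \<in> generator_domain T) \<and>
    continuous_map (C_topology \<Gamma>\<^sub>U r) euclidean (\<lambda>f. generator T (convolution T (D \<circ> f) r))"

text \<open>The space \<open>U\<close> is a subspace of \<open>X\<close>, with the subspace topology, via the inclusion \<open>i\<close>.\<close>

definition invariant_subspace ::
    "('k::field \<Rightarrow> 'u::{ab_group_add, topological_space} \<Rightarrow> 'u) \<Rightarrow>
     ('k \<Rightarrow> 'x::{ab_group_add, topological_space} \<Rightarrow> 'x) \<Rightarrow>
     (real \<Rightarrow> 'x \<Rightarrow> 'x) \<Rightarrow> ('u \<Rightarrow> 'x) \<Rightarrow> bool"
  where "invariant_subspace scaleU scaleX T i \<longleftrightarrow>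
    Vector_Spaces.linear scaleU scaleX i \<and> embedding_map euclidean euclidean i \<and>
    (\<forall>t\<ge>0. T t ` range i \<subseteq> range i)"

definition commuting :: "(real \<Rightarrow> 'x \<Rightarrow> 'x) \<Rightarrow> ('u \<Rightarrow> 'x) \<Rightarrow> ('u \<Rightarrow> 'x) \<Rightarrow> bool"
  where "commuting T i D \<longleftrightarrow> (\<forall>t\<ge>0. \<forall>u. T t (D u) = D (inv i (T t (i u))))"

end

(* The continuous inverse R of A turns closedness of A into continuity: A (T * Df) (t) is the limit, if
   it exists, of Riemann-Stieltjes sums of f (t - s) against the operator-valued function T(s) D, since
   R maps these sums to Riemann sums of the convolution up to a vanishing error. Bounded semivariation
   makes the sums Cauchy and bounds the limit by a seminorm of f; the identity
   F (t + h) = T(h) F (t) + (a term over an interval of length h) for F = A (T * Df) then gives right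
   continuity. Left continuity needs T(h) -> 1 uniformly on the values of F, which holds if they
   are precompact, or if T(h) can be moved onto the compact set of values of f.
   Conversely, step functions are approximated by continuous functions with ramps, for which the
   convolutions converge, and boundedness of f |-> A (T * Df) (r) survives the limit through the
   difference quotients (T(h) - 1) / h. The extrapolation space enters only through the topological
   isomorphism A_{-1}, which translates admissibility into (T * Df) (r) being in D(A). *)

theory Submission
  imports Defs
begin

section \<open>Seminorms generating a topology\<close>

text \<open>Every statement A v = w is proved in the form v = R w, so that it survives limits
  because R is continuous. The obstacle in (c) to (d) is that a semivariation sum w belongs to a
  step function, which lies outside C([0,r];U). Along the ramps the convolutions converge to R w,
  but their images under A are known only to be bounded. At fixed h the quotient (T(h) - 1) / h is
  continuous, so the bound passes to (T(h) - 1) R w / h. It does not depend on h or on the ramp, and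
  these quotients tend to w as h tends to 0. The obstacle in (d) to (a) is that F(t) - F(t - h)
  involves (T(h) - 1) F(t - h), whose base point moves with h; for right limits it stays fixed. In
  case (i) the vector (T(h) - 1) F(t) is itself the response at t to the input T(h) f - f, which is
  small in the sup norm. A single bound for F serves all times t up to r, because a grid of [0,t]
  becomes a partition of [0,r] by adding the point r with coefficient 0.\<close>

lemma
  fixes p :: "'a::real_vector \<Rightarrow> real"
  assumes p: "seminorm (*\<^sub>R) p"
  shows seminorm_triangle: "p (x + y) \<le> p x + p y"
    and seminorm_scaleR: "p (a *\<^sub>R x) = \<bar>a\<bar> * p x"
    and seminorm_zero: "p 0 = 0"
    and seminorm_nonneg: "0 \<le> p x"
    and seminorm_diff_commute: "p (x - y) = p (y - x)"
    and seminorm_diff_triangle: "p (x - z) \<le> p (x - y) + p (y - z)"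
    and seminorm_diff_le: "p (x - y) \<le> p x + p y"
    and seminorm_abs_diff: "\<bar>p x - p y\<bar> \<le> p (x - y)"
proof -
  show tri: "p (x + y) \<le> p x + p y" for x y
    using p by (simp add: seminorm_def)
  show sc: "p (a *\<^sub>R x) = \<bar>a\<bar> * p x" for a x
    using p by (simp add: seminorm_def)
  show z: "p 0 = 0" using sc[of 0 0] by simp
  have m: "p (- x) = p x" for x using sc[of "-1" x] by simp
  show "0 \<le> p x" using tri[of x "- x"] m[of x] z by simp
  show c: "p (x - y) = p (y - x)" for x y using m[of "x - y"] by simp
  show "p (x - z) \<le> p (x - y) + p (y - z)" using tri[of "x - y" "y - z"] by simp
  show "p (x - y) \<le> p x + p y" using tri[of x "- y"] m[of y] by simp
  show "\<bar>p x - p y\<bar> \<le> p (x - y)"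
    using tri[of "x - y" y] tri[of "y - x" x] c[of x y] by simp
qed

lemma seminorm_sum:
  fixes p :: "'a::real_vector \<Rightarrow> real"
  assumes p: "seminorm (*\<^sub>R) p"
  shows "p (\<Sum>i\<in>I. f i) \<le> (\<Sum>i\<in>I. p (f i))"
proof (induction I rule: infinite_finite_induct)
  case (insert i I)
  then show ?case
    using seminorm_triangle[OF p, of "f i" "sum f I"] by simp
qed (simp_all add: seminorm_zero[OF p])

lemma seminorm_le_of_unit:
  fixes p q :: "'a::real_vector \<Rightarrow> real"
  assumes p: "seminorm (*\<^sub>R) p" and q: "seminorm (*\<^sub>R) q" and e: "e > 0"
    and pq: "\<And>x. p x < e \<Longrightarrow> q x \<le> K"
  shows "q x \<le> K / e * p x"
proof -
  have K: "K \<ge> 0"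
    using pq[of 0] e by (simp add: seminorm_zero[OF p] seminorm_zero[OF q])
  have "q x \<le> K / e * p x + t" if t: "t > 0" for t
  proof -
    \<comment> \<open>The shift \<open>s\<close> keeps the denominator positive when
      \<open>p x = 0\<close>. Its size turns the error \<open>K * s / e\<close> into
      \<open>K / (K + 1) * t\<close>, which is at most \<open>t\<close>.\<close>
    define s where "s = t * e / (K + 1)"
    have s: "s > 0" using t e K by (simp add: s_def)
    define c where "c = e / (p x + s)"
    have pos: "p x + s > 0" using s seminorm_nonneg[OF p, of x] by linarith
    have c: "c > 0" using e pos by (simp add: c_def)
    have "p (c *\<^sub>R x) < e"
      using e pos s c by (simp add: seminorm_scaleR[OF p] c_def field_simps)
    then have "c * q x \<le> K" using pq[of "c *\<^sub>R x"] c by (simp add: seminorm_scaleR[OF q])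
    then have "q x \<le> K * (p x + s) / e" using e pos c by (simp add: c_def field_simps)
    also have "\<dots> = K / e * p x + K / (K + 1) * t" using e K by (simp add: s_def field_simps)
    also have "\<dots> \<le> K / e * p x + t" using t K by (simp add: field_simps)
    finally show ?thesis .
  qed
  then show ?thesis by (rule field_le_epsilon)
qed

text \<open>The topology is handled from here on through real seminorms only. \<open>basis\<close>
  asks for a single ball inside each neighbourhood of 0, so directedness of the family is built in
  and no finite intersections of balls appear.\<close>

locale generating_seminorms =
  fixes \<Gamma> :: "('a::{real_vector, uniform_topological_group_add, t2_space} \<Rightarrow> real) set"
  assumes seminorm: "p \<in> \<Gamma> \<Longrightarrow> seminorm (*\<^sub>R) p"
    and continuous: "p \<in> \<Gamma> \<Longrightarrow> continuous_on UNIV p"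
    and basis: "open W \<Longrightarrow> 0 \<in> W \<Longrightarrow> \<exists>p\<in>\<Gamma>. \<exists>e>0. \<forall>y. p y < e \<longrightarrow> y \<in> W"
begin

lemmas triangle = seminorm_triangle[OF seminorm]
  and homogeneous = seminorm_scaleR[OF seminorm]
  and zero = seminorm_zero[OF seminorm]
  and nonneg = seminorm_nonneg[OF seminorm]
  and diff_commute = seminorm_diff_commute[OF seminorm]
  and diff_triangle = seminorm_diff_triangle[OF seminorm]
  and diff_le = seminorm_diff_le[OF seminorm]
  and sum_le = seminorm_sum[OF seminorm]

lemma tendsto_iff:
  "(f \<longlongrightarrow> l) F \<longleftrightarrow> (\<forall>p\<in>\<Gamma>. ((\<lambda>t. p (f t - l)) \<longlongrightarrow> 0) F)"
proof safe
  fix p assume f: "(f \<longlongrightarrow> l) F" and p: "p \<in> \<Gamma>"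
  have "((\<lambda>t. p (f t - l)) \<longlongrightarrow> p (l - l)) F"
    by (intro continuous_on_tendsto_compose[OF continuous[OF p]] tendsto_intros f) auto
  then show "((\<lambda>t. p (f t - l)) \<longlongrightarrow> 0) F" by (simp add: zero p)
next
  assume *: "\<forall>p\<in>\<Gamma>. ((\<lambda>t. p (f t - l)) \<longlongrightarrow> 0) F"
  show "(f \<longlongrightarrow> l) F"
  proof (rule topological_tendstoI)
    fix S assume S: "open S" "l \<in> S"
    have "open ((\<lambda>y. y + l) -` S)"
      by (intro open_vimage S continuous_intros)
    then obtain p e where p: "p \<in> \<Gamma>" "e > 0" "\<And>y. p y < e \<Longrightarrow> y + l \<in> S"
      using basis[of "(\<lambda>y. y + l) -` S"] S by auto
    have "eventually (\<lambda>t. p (f t - l) < e) F"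
      using * p by (auto intro: order_tendstoD)
    then show "eventually (\<lambda>t. f t \<in> S) F"
      by eventually_elim (use p(3) in fastforce)
  qed
qed

lemma tendsto_le:
  assumes p: "p \<in> \<Gamma>" and f: "(f \<longlongrightarrow> l) F" and F: "F \<noteq> bot" and b: "eventually (\<lambda>t. p (f t) \<le> c) F"
  shows "p l \<le> c"
  by (rule tendsto_upperbound[OF continuous_on_tendsto_compose[OF continuous[OF p] f] b F]) auto

lemma bounded_by_generating:
  assumes q: "seminorm (*\<^sub>R) q" and W: "open W" "0 \<in> W" "\<And>x. x \<in> W \<Longrightarrow> q x \<le> K"
  shows "\<exists>p\<in>\<Gamma>. \<exists>C\<ge>0. \<forall>x. q x \<le> C * p x"
proof -
  obtain p e where p: "p \<in> \<Gamma>" "e > 0" "\<And>y. p y < e \<Longrightarrow> y \<in> W"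
    using basis W by metis
  have "q x \<le> K / e * p x" for x
    using seminorm_le_of_unit[OF seminorm[OF p(1)] q p(2), of K] W(3) p(3) by blast
  moreover have "K \<ge> 0" using W(3)[OF W(2)] by (simp add: seminorm_zero[OF q])
  ultimately show ?thesis using p(1,2) by (intro bexI[of _ p] exI[of _ "K / e"]) auto
qed

lemma bounded_by_generating_continuous:
  assumes q: "seminorm (*\<^sub>R) q" "continuous_on UNIV q"
  shows "\<exists>p\<in>\<Gamma>. \<exists>C\<ge>0. \<forall>x. q x \<le> C * p x"
proof (rule bounded_by_generating[OF q(1), of "q -` {..<1}" 1])
  show "open (q -` {..<1})" by (rule open_vimage[OF _ q(2)]) simp
qed (auto simp: seminorm_zero[OF q(1)])

lemma continuous_on_seminorm:
  assumes "p \<in> \<Gamma>" "continuous_on S f"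
  shows "continuous_on S (\<lambda>s. p (f s))"
  by (rule continuous_on_compose2[OF continuous[OF assms(1)] assms(2)]) auto

text \<open>The real function \<open>p (f s - f s')\<close> is uniformly continuous on the compact
  square and vanishes on the diagonal; comparing \<open>(s, s')\<close> with \<open>(s, s)\<close>
  gives the claim.\<close>

lemma uniformly_continuous_seminorm:
  assumes f: "continuous_on {a..b::real} f" and p: "p \<in> \<Gamma>" and e: "e > 0"
  shows "\<exists>\<delta>>0. \<forall>s\<in>{a..b}. \<forall>s'\<in>{a..b}. \<bar>s - s'\<bar> < \<delta> \<longrightarrow> p (f s - f s') \<le> e"
proof -
  let ?g = "\<lambda>z. p (f (fst z) - f (snd z))"
  have "continuous_on ({a..b} \<times> {a..b}) ?g"
    by (intro continuous_on_seminorm[OF p] continuous_intros continuous_on_compose2[OF f]) auto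
  then have "uniformly_continuous_on ({a..b} \<times> {a..b}) ?g"
    by (intro compact_uniformly_continuous compact_Times) auto
  then obtain d where d: "d > 0" "\<And>z z'. z \<in> {a..b} \<times> {a..b} \<Longrightarrow> z' \<in> {a..b} \<times> {a..b} \<Longrightarrow>
      dist z' z < d \<Longrightarrow> dist (?g z') (?g z) < e"
    unfolding uniformly_continuous_on_def using e by meson
  have "p (f s - f s') \<le> e" if "s \<in> {a..b}" "s' \<in> {a..b}" "\<bar>s - s'\<bar> < d" for s s'
    using d(2)[of "(s, s)" "(s, s')"] that by (auto simp: dist_Pair_Pair dist_real_def abs_minus_commute zero p)
  then show ?thesis using d(1) by auto
qed

lemma bounded_on_interval:
  assumes f: "continuous_on {a..b::real} f" and p: "p \<in> \<Gamma>"
  shows "\<exists>K>0. \<forall>s\<in>{a..b}. p (f s) \<le> K"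
proof -
  have "compact ((\<lambda>s. p (f s)) ` {a..b})"
    by (intro compact_continuous_image continuous_on_seminorm[OF p f]) auto
  then have "bounded ((\<lambda>s. p (f s)) ` {a..b})" by (rule compact_imp_bounded)
  then obtain K where "K > 0" "\<And>s. s \<in> {a..b} \<Longrightarrow> \<bar>p (f s)\<bar> \<le> K"
    unfolding bounded_pos by auto
  then show ?thesis by (intro exI[of _ K]) force
qed

lemma cauchy_filter_filtermap:
  assumes "\<And>p e. p \<in> \<Gamma> \<Longrightarrow> e > 0 \<Longrightarrow>
    \<exists>P. eventually P F \<and> (\<forall>x y. P x \<longrightarrow> P y \<longrightarrow> p (f x - f y) < e)"
  shows "cauchy_filter (filtermap f F)"
  unfolding cauchy_filter_def
proof (rule filter_leI)
  fix P :: "'a \<times> 'a \<Rightarrow> bool" assume "eventually P uniformity"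
  \<comment> \<open>\<open>cauchy_seq_finset_iff_vanishing\<close> describes the uniformity as the
    pullback of \<open>nhds 0\<close> under the difference map.\<close>
  then obtain Q where Q: "eventually Q (nhds 0)" "\<And>x y. Q (y - x) \<Longrightarrow> P (x, y)"
    unfolding cauchy_seq_finset_iff_vanishing eventually_filtercomap by auto
  then obtain W where W: "open W" "0 \<in> W" "\<And>x. x \<in> W \<Longrightarrow> Q x"
    unfolding eventually_nhds by auto
  obtain p e where p: "p \<in> \<Gamma>" "e > 0" "\<And>y. p y < e \<Longrightarrow> y \<in> W" using basis W by metis
  obtain R where R: "eventually R F" "\<And>x y. R x \<Longrightarrow> R y \<Longrightarrow> p (f x - f y) < e"
    using assms[OF p(1,2)] by auto
  have "eventually (\<lambda>x. \<exists>z. R z \<and> x = f z) (filtermap f F)"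
    unfolding eventually_filtermap using R(1) by eventually_elim auto
  then show "eventually P (filtermap f F \<times>\<^sub>F filtermap f F)"
    unfolding eventually_prod_filter
    using R(2) p(3) W(3) Q(2) by (smt (verit, best))
qed

lemma convergent_filter:
  assumes "complete (UNIV :: 'a set)" "F \<noteq> bot"
    and "\<And>p e. p \<in> \<Gamma> \<Longrightarrow> e > 0 \<Longrightarrow>
      \<exists>P. eventually P F \<and> (\<forall>x y. P x \<longrightarrow> P y \<longrightarrow> p (f x - f y) < e)"
  shows "\<exists>l. (f \<longlongrightarrow> l) F"
  using cauchy_filter_complete_converges[OF cauchy_filter_filtermap[where f = f and F = F, OF assms(3)] assms(1)] assms(2)
  by (auto simp: filterlim_def filtermap_bot_iff)

lemma convergent_sequence:
  assumes "complete (UNIV :: 'a set)"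
    and "\<And>p e. p \<in> \<Gamma> \<Longrightarrow> e > 0 \<Longrightarrow>
      \<exists>N::nat. \<forall>m\<ge>N. \<forall>n\<ge>N. p (f m - f n) < e"
  shows "\<exists>l. f \<longlonglongrightarrow> l"
proof (rule convergent_filter[OF assms(1)])
  fix p and e :: real assume "p \<in> \<Gamma>" "e > 0"
  from assms(2)[OF this] obtain N where "\<forall>m\<ge>N. \<forall>n\<ge>N. p (f m - f n) < e" by auto
  then show "\<exists>P. eventually P sequentially \<and> (\<forall>x y. P x \<longrightarrow> P y \<longrightarrow> p (f x - f y) < e)"
    by (intro exI[of _ "\<lambda>n. n \<ge> N"]) (auto simp: eventually_ge_at_top)
qed simp

lemma totally_bounded_net:
  assumes S: "totally_bounded S" and p: "p \<in> \<Gamma>" and e: "e > 0"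
  shows "\<exists>N. finite N \<and> (\<forall>s\<in>S. \<exists>x\<in>N. p (s - x) < e)"
proof -
  have "open (p -` {..<e})" by (rule open_vimage[OF _ continuous[OF p]]) simp
  then have "eventually (\<lambda>x. p x < e) (nhds 0)"
    unfolding eventually_nhds using e by (intro exI[of _ "p -` {..<e}"]) (auto simp: zero p)
  then have "eventually (\<lambda>(x, y). p (y - x) < e) uniformity"
    unfolding cauchy_seq_finset_iff_vanishing eventually_filtercomap by auto
  from S[unfolded totally_bounded_def, rule_format, OF this] show ?thesis
    by simp
qed

end

section \<open>Sums and scalar multiples in limits, and domination of seminorms\<close>

lemma tendsto_sum_group:
  fixes f :: "'i \<Rightarrow> 'b \<Rightarrow> 'a::{topological_monoid_add, comm_monoid_add}"
  assumes "\<And>i. i \<in> I \<Longrightarrow> (f i \<longlongrightarrow> a i) F"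
  shows "((\<lambda>x. \<Sum>i\<in>I. f i x) \<longlongrightarrow> (\<Sum>i\<in>I. a i)) F"
  using assms by (induction I rule: infinite_finite_induct) (auto intro!: tendsto_add)

lemma continuous_on_sum_group:
  fixes f :: "'i \<Rightarrow> 'b::topological_space \<Rightarrow> 'a::{topological_monoid_add, comm_monoid_add}"
  assumes "\<And>i. i \<in> I \<Longrightarrow> continuous_on S (f i)"
  shows "continuous_on S (\<lambda>x. \<Sum>i\<in>I. f i x)"
  using assms unfolding continuous_on_def by (auto intro!: tendsto_sum_group)

lemma (in generating_seminorms) tendsto_scaleR_left:
  fixes y :: 'a
  assumes "(c \<longlongrightarrow> a) F"
  shows "((\<lambda>s. c s *\<^sub>R y) \<longlongrightarrow> a *\<^sub>R y) F"
  unfolding tendsto_iff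
proof
  fix p assume p: "p \<in> \<Gamma>"
  have "((\<lambda>s. \<bar>c s - a\<bar> * p y) \<longlongrightarrow> \<bar>a - a\<bar> * p y) F"
    by (intro tendsto_intros assms)
  then show "((\<lambda>s. p (c s *\<^sub>R y - a *\<^sub>R y)) \<longlongrightarrow> 0) F"
    by (simp add: homogeneous p flip: scaleR_diff_left)
qed

lemma (in generating_seminorms) continuous_on_scaleR_left:
  fixes y :: 'a
  shows "continuous_on S c \<Longrightarrow> continuous_on S (\<lambda>s. c s *\<^sub>R y)"
  unfolding continuous_on_def by (auto intro!: tendsto_scaleR_left)

lemma (in generating_seminorms) tendsto_scaleR_const:
  fixes g :: "'b \<Rightarrow> 'a"
  assumes "(g \<longlongrightarrow> l) F"
  shows "((\<lambda>x. a *\<^sub>R g x) \<longlongrightarrow> a *\<^sub>R l) F"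
  unfolding tendsto_iff
proof
  fix p assume p: "p \<in> \<Gamma>"
  have "((\<lambda>x. \<bar>a\<bar> * p (g x - l)) \<longlongrightarrow> \<bar>a\<bar> * 0) F"
    using assms p unfolding tendsto_iff by (intro tendsto_intros) auto
  then show "((\<lambda>x. p (a *\<^sub>R g x - a *\<^sub>R l)) \<longlongrightarrow> 0) F"
    by (simp add: homogeneous p flip: scaleR_diff_right)
qed

text \<open>A sum of continuous seminorms is again one and hence dominated by a member of the
  family. This reduces the finitely many balls that describe a neighbourhood in a seminorm topology
  to one.\<close>

lemma (in generating_seminorms) finite_dominated:
  assumes "finite F" "F \<subseteq> \<Gamma>" "\<Gamma> \<noteq> {}"
  shows "\<exists>p\<in>\<Gamma>. \<exists>C>0. \<forall>q\<in>F. \<forall>x. q x \<le> C * p x"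
  using assms
proof (induction F)
  case empty
  then show ?case by (auto intro: exI[of _ 1])
next
  case (insert q F)
  then obtain p C where p: "p \<in> \<Gamma>" "C > 0" "\<And>q x. q \<in> F \<Longrightarrow> q x \<le> C * p x" by blast
  have q: "q \<in> \<Gamma>" using insert by simp
  have "seminorm (*\<^sub>R) (\<lambda>x. C * p x + q x)"
    unfolding seminorm_def
  proof (intro conjI allI)
    fix x y
    show "C * p (x + y) + q (x + y) \<le> C * p x + q x + (C * p y + q y)"
      using mult_left_mono[OF triangle[OF p(1), of x y], of C] triangle[OF q, of x y] p(2)
      by (simp add: distrib_left)
  next
    fix c x
    show "C * p (c *\<^sub>R x) + q (c *\<^sub>R x) = norm c * (C * p x + q x)"
      by (simp add: homogeneous p q algebra_simps)
  qed
  moreover have "continuous_on UNIV (\<lambda>x. C * p x + q x)"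
    by (intro continuous_intros continuous p q)
  ultimately obtain p' C' where p': "p' \<in> \<Gamma>" "C' \<ge> 0" "\<And>x. C * p x + q x \<le> C' * p' x"
    using bounded_by_generating_continuous by meson
  have "q' x \<le> (C' + 1) * p' x" if "q' \<in> insert q F" for q' x
  proof -
    have "q' x \<le> C * p x + q x"
      using that p(2) p(3)[of q' x] nonneg[OF p(1), of x] nonneg[OF q, of x] by auto
    then show ?thesis using p'(3)[of x] nonneg[OF p'(1), of x] by (simp add: distrib_right)
  qed
  then show ?case using p'(1,2) by (intro bexI[of _ p'] exI[of _ "C' + 1"]) auto
qed

lemma (in generating_seminorms) nonempty: "\<Gamma> \<noteq> {}"
  using basis[of UNIV] by auto

lemma seminorm_linear_compose:
  assumes "linear F" "seminorm (*\<^sub>R) q"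
  shows "seminorm (*\<^sub>R) (\<lambda>x. q (F x))"
  using assms by (auto simp: seminorm_def linear_add linear_scale)

lemma linear_continuous_bound:
  fixes F :: "'a::{real_vector, uniform_topological_group_add, t2_space} \<Rightarrow>
    'b::{real_vector, uniform_topological_group_add, t2_space}"
  assumes X: "generating_seminorms \<Gamma>" and Y: "generating_seminorms \<Delta>"
    and F: "linear F" "continuous_on UNIV F" and q: "q \<in> \<Delta>"
  shows "\<exists>p\<in>\<Gamma>. \<exists>C\<ge>0. \<forall>x. q (F x) \<le> C * p x"
  by (rule generating_seminorms.bounded_by_generating_continuous[OF X
        seminorm_linear_compose[OF F(1) generating_seminorms.seminorm[OF Y q]]
        generating_seminorms.continuous_on_seminorm[OF Y q F(2)]])

lemma linear_bounded_continuous: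
  fixes F :: "'a::{real_vector, uniform_topological_group_add, t2_space} \<Rightarrow>
    'b::{real_vector, uniform_topological_group_add, t2_space}"
  assumes X: "generating_seminorms \<Gamma>" and Y: "generating_seminorms \<Delta>"
    and F: "linear F" "\<And>q. q \<in> \<Delta> \<Longrightarrow> \<exists>p\<in>\<Gamma>. \<exists>C\<ge>0. \<forall>x. q (F x) \<le> C * p x"
  shows "continuous_on UNIV F"
proof -
  interpret X: generating_seminorms \<Gamma> by (rule X)
  interpret Y: generating_seminorms \<Delta> by (rule Y)
  have "(F \<longlongrightarrow> F x) (at x)" for x
    unfolding Y.tendsto_iff
  proof
    fix q assume q: "q \<in> \<Delta>"
    then obtain p C where p: "p \<in> \<Gamma>" "C \<ge> 0" "\<And>x. q (F x) \<le> C * p x" using F(2) by metis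
    have "((\<lambda>y. y) \<longlongrightarrow> x) (at x)" by (rule tendsto_ident_at)
    then have "((\<lambda>y. C * p (y - x)) \<longlongrightarrow> C * 0) (at x)"
      unfolding X.tendsto_iff using p(1) by (intro tendsto_intros) auto
    from real_tendsto_sandwich[OF _ _ tendsto_const this[simplified]] show "((\<lambda>y. q (F y - F x)) \<longlongrightarrow> 0) (at x)"
      using p(3) by (simp add: Y.nonneg q flip: linear_diff[OF F(1)])
  qed
  then show ?thesis by (simp add: continuous_on_def)
qed

section \<open>Locally convex spaces have generating seminorms\<close>

text \<open>The Minkowski functional of a balanced convex set absorbs scalars of the field \<open>'k\<close>, so that
  the seminorms are seminorms over \<open>'k\<close> and not merely over the reals.\<close>

lemma minkowski_functional:
  fixes scale :: "'k::real_normed_field \<Rightarrow>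
    'x::{real_vector, uniform_topological_group_add, t2_space} \<Rightarrow> 'x"
  assumes X: "locally_convex_space scale" and W: "open W" "0 \<in> W"
  shows "\<exists>q. seminorm scale q \<and> continuous_on UNIV q \<and> (\<forall>x. q x < 1 \<longrightarrow> x \<in> W)"
proof -
  interpret locally_convex_space scale by (rule X)
  obtain V where V: "open V" "convex V" "0 \<in> V" "V \<subseteq> W" using locally_convex[OF W] by blast
  have "open ((\<lambda>(c, x). scale c x) -` V)" by (intro open_vimage V continuous_scale)
  moreover have "(0, 0) \<in> (\<lambda>(c, x). scale c x) -` V" using V by simp
  ultimately obtain C V' where CV: "open C" "open V'" "0 \<in> C" "0 \<in> V'" "C \<times> V' \<subseteq> (\<lambda>(c, x). scale c x) -` V"
    by (metis open_prod_elim mem_Sigma_iff)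
  obtain \<delta> where \<delta>: "\<delta> > 0" "\<And>c. norm c < \<delta> \<Longrightarrow> c \<in> C"
    using CV(1,3) unfolding open_dist by (metis dist_0_norm dist_commute)
  \<comment> \<open>The balanced core of \<open>V\<close> with respect to scalars of
    \<open>'k\<close>; it stays convex because every scalar acts linearly over the reals.\<close>
  define N where "N = {x. \<forall>c. norm c \<le> 1 \<longrightarrow> scale c x \<in> V}"
  have cont_scaleR: "continuous_on UNIV (\<lambda>x :: 'x. a *\<^sub>R x)" for a
  proof -
    have "continuous_on UNIV (\<lambda>x. (\<lambda>(c, x). scale c x) (of_real a, x))"
      by (rule continuous_on_compose2[OF continuous_scale]) (auto intro!: continuous_intros)
    then show ?thesis by (simp add: scale_of_real)
  qed
  \<comment> \<open>An open neighbourhood of 0 inside \<open>N\<close>: c x is (c \<delta> / 2)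
    times (2 / \<delta>) x, and the first factor has norm below \<delta> whenever c has norm at most
    1.\<close>
  define O1 where "O1 = (\<lambda>x. (2 / \<delta>) *\<^sub>R x) -` V'"
  have O1: "open O1" "0 \<in> O1" unfolding O1_def using CV by (auto intro!: open_vimage cont_scaleR)
  have O1N: "O1 \<subseteq> N"
  proof
    fix x assume x: "x \<in> O1"
    have "scale c x \<in> V" if c: "norm c \<le> 1" for c
    proof -
      have "norm (c * of_real (\<delta> / 2)) < \<delta>"
        using c \<delta> mult_right_mono[OF c, of "\<delta> / 2"] by (simp add: norm_mult)
      then have "(c * of_real (\<delta> / 2), (2 / \<delta>) *\<^sub>R x) \<in> C \<times> V'"
        using \<delta>(2) x by (auto simp only: O1_def vimage_eq mem_Sigma_iff)
      from subsetD[OF CV(5) this]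
      have "scale (c * of_real (\<delta> / 2)) ((2 / \<delta>) *\<^sub>R x) \<in> V"
        by (simp only: vimage_eq case_prod_conv)
      moreover have "c * of_real (\<delta> / 2) * of_real (2 / \<delta>) = c"
        using \<delta>(1) by (simp add: mult.assoc flip: of_real_mult)
      ultimately show ?thesis
        by (metis scale_of_real scale_scale)
    qed
    then show "x \<in> N" by (simp add: N_def)
  qed
  have linear_scale: "scale c (a *\<^sub>R x) = a *\<^sub>R scale c x" for c a x
    by (metis scale_of_real scale_left_commute)
  have convN: "convex N"
    unfolding convex_def N_def
    using V(2) by (auto simp: convex_def scale_right_distrib linear_scale)
  have balN: "scale c x \<in> N" if "x \<in> N" "norm c \<le> 1" for c x
    using that mult_le_one[of _ "norm c"] by (auto simp: N_def norm_mult)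
  have balR: "a *\<^sub>R x \<in> N" if "x \<in> N" "\<bar>a\<bar> \<le> 1" for a x
    using balN[OF that(1), of "of_real a"] that(2) by (simp add: scale_of_real)
  have NW: "N \<subseteq> W" using V(4) by (force simp: N_def dest: spec[of _ 1])
  have zN: "0 \<in> N" using O1 O1N by auto
  \<comment> \<open>The \<open>t > 0\<close> for which x lies in \<open>t\<close> times
    \<open>N\<close>. Balancedness makes this set upward closed, so \<open>q x < t\<close> already
    gives membership, whether or not the infimum is attained.\<close>
  define S where "S x = {t. t > 0 \<and> (1 / t) *\<^sub>R x \<in> N}" for x
  define q where "q x = Inf (S x)" for x
  have Sbdd: "bdd_below (S x)" for x by (rule bdd_belowI[of _ 0]) (auto simp: S_def)
  have Sne: "S x \<noteq> {}" for x
  proof -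
    have "continuous_on UNIV (\<lambda>a. (\<lambda>(c, x). scale c x) (of_real a, x))"
      by (rule continuous_on_compose2[OF continuous_scale]) (auto intro!: continuous_intros)
    then have "open ((\<lambda>a. a *\<^sub>R x) -` O1)" by (intro open_vimage O1) (simp add: scale_of_real)
    moreover have "0 \<in> (\<lambda>a. a *\<^sub>R x) -` O1" using O1 by simp
    ultimately obtain e where e: "e > 0" "\<And>a. \<bar>a\<bar> < e \<Longrightarrow> a *\<^sub>R x \<in> O1"
      unfolding open_dist by (metis dist_0_norm dist_commute real_norm_def vimage_eq)
    have "2 / e \<in> S x" using e(1) e(2)[of "e / 2"] O1N by (auto simp: S_def)
    then show ?thesis by auto
  qed
  have Sup: "t' \<in> S x" if t: "t \<in> S x" and tt': "t \<le> t'" for t t' x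
  proof -
    have "(t / t') *\<^sub>R ((1 / t) *\<^sub>R x) \<in> N"
      by (rule balR) (use t tt' in \<open>simp_all add: S_def\<close>)
    moreover have "t / t' * (1 / t) = 1 / t'" using t by (simp add: S_def)
    ultimately have "(1 / t') *\<^sub>R x \<in> N" by (simp only: scaleR_scaleR)
    then show ?thesis using t tt' by (auto simp: S_def)
  qed
  have q0: "0 \<le> q x" for x unfolding q_def by (rule cInf_greatest[OF Sne]) (auto simp: S_def)
  have qle: "q x \<le> t" if "t \<in> S x" for x t unfolding q_def by (rule cInf_lower[OF that Sbdd])
  have qlt: "t \<in> S x" if "q x < t" for x t
    using that Sup unfolding q_def by (metis cInf_lessD Sne less_imp_le)
  have tri: "q (x + y) \<le> q x + q y" for x y
  proof (rule field_le_epsilon)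
    fix e :: real assume e: "e > 0"
    define t s where "t = q x + e / 2" and "s = q y + e / 2"
    have pos: "t > 0" "s > 0" unfolding t_def s_def using q0[of x] q0[of y] e by auto
    have "t \<in> S x" "s \<in> S y" unfolding t_def s_def using e by (auto intro!: qlt)
    then have "(t / (t + s)) *\<^sub>R ((1 / t) *\<^sub>R x) + (s / (t + s)) *\<^sub>R ((1 / s) *\<^sub>R y) \<in> N"
      using pos by (intro convexD[OF convN]) (auto simp: S_def simp flip: add_divide_distrib)
    then have "(1 / (t + s)) *\<^sub>R (x + y) \<in> N"
      using pos by (simp add: scaleR_right_distrib)
    then have "t + s \<in> S (x + y)" using pos by (simp add: S_def)
    then show "q (x + y) \<le> q x + q y + e" using qle by (force simp: t_def s_def)
  qed
  have hom_le: "q (scale c x) \<le> norm c * q x" if c: "c \<noteq> 0" for c x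
  proof (rule field_le_epsilon)
    fix e :: real assume e: "e > 0"
    \<comment> \<open>The scalar splits into its modulus, absorbed by \<open>t\<close>, and the
      factor \<open>c / of_real (norm c)\<close> of norm 1, which maps \<open>N\<close> into itself.
      The converse inequality comes from applying this one to \<open>1 / c\<close>.\<close>
    define t where "t = q x + e / norm c"
    have t: "t > 0" "t \<in> S x" unfolding t_def using e c q0[of x] by (auto intro!: qlt add_nonneg_pos)
    have "scale (c / of_real (norm c)) ((1 / t) *\<^sub>R x) \<in> N"
      using t c by (intro balN) (auto simp: S_def norm_divide)
    moreover have "scale (c / of_real (norm c)) ((1 / t) *\<^sub>R x) = (1 / (norm c * t)) *\<^sub>R scale c x"
      by (simp add: field_simps flip: scale_of_real)
    ultimately have "norm c * t \<in> S (scale c x)" using c t by (simp add: S_def)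
    then show "q (scale c x) \<le> norm c * q x + e"
      using qle c by (force simp: t_def algebra_simps)
  qed
  have hom: "q (scale c x) = norm c * q x" for c x
  proof (cases "c = 0")
    case True
    have "q 0 \<le> e" if "e > 0" for e by (rule qle) (use that zN in \<open>simp add: S_def\<close>)
    then have "q 0 = 0" using q0[of 0] by (metis antisym field_le_epsilon add_0)
    then show ?thesis using True by simp
  next
    case False
    have "q x = q (scale (1 / c) (scale c x))" using False by simp
    also have "\<dots> \<le> norm (1 / c) * q (scale c x)" using False by (intro hom_le) simp
    finally have "norm c * q x \<le> q (scale c x)" using False by (simp add: norm_divide field_simps)
    then show ?thesis using hom_le[OF False, of x] by simp
  qed
  have sq: "seminorm scale q" using tri hom by (simp add: seminorm_def)
  have sqR: "seminorm (*\<^sub>R) q"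
    using tri hom[of "of_real _"] by (simp add: seminorm_def scale_of_real)
  have "continuous_on UNIV q"
    unfolding continuous_on_def
  proof
    fix x
    show "(q \<longlongrightarrow> q x) (at x within UNIV)"
    proof (rule tendstoI)
      fix e :: real assume e: "e > 0"
      have "open ((\<lambda>y. (2 / e) *\<^sub>R (y - x)) -` O1)"
        by (intro open_vimage O1 continuous_on_compose2[OF cont_scaleR] continuous_intros) auto
      then have "eventually (\<lambda>y. y \<in> (\<lambda>y. (2 / e) *\<^sub>R (y - x)) -` O1) (at x)"
        by (rule topological_tendstoD[OF tendsto_ident_at]) (simp add: O1(2))
      then show "eventually (\<lambda>y. dist (q y) (q x) < e) (at x within UNIV)"
      proof eventually_elim
        fix y assume "y \<in> (\<lambda>y. (2 / e) *\<^sub>R (y - x)) -` O1"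
        then have "e / 2 \<in> S (y - x)" using O1N e by (auto simp: S_def)
        then have "q (y - x) \<le> e / 2" by (rule qle)
        then show "dist (q y) (q x) < e"
          using seminorm_abs_diff[OF sqR, of y x] e by (simp add: dist_real_def)
      qed
    qed
  qed
  moreover have "x \<in> W" if "q x < 1" for x using qlt[OF that] NW by (auto simp: S_def)
  ultimately show ?thesis using sq by blast
qed

text \<open>The extrapolation space comes without a chosen fundamental system; the family of all its
  continuous seminorms takes that role.\<close>

lemma fundamental_system_continuous_seminorms:
  fixes scale :: "'k::real_normed_field \<Rightarrow> 'x::{ab_group_add, topological_space} \<Rightarrow> 'x"
  shows "fundamental_system scale {q. seminorm scale q \<and> continuous_on UNIV q}"
  unfolding fundamental_system_def by (auto intro!: exI[of _ 1])

lemma generating_seminorms: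
  fixes scale :: "'k::real_normed_field \<Rightarrow>
    'x::{real_vector, uniform_topological_group_add, t2_space} \<Rightarrow> 'x"
  assumes X: "locally_convex_space scale" and \<Gamma>: "fundamental_system scale \<Gamma>"
  shows "generating_seminorms \<Gamma>"
proof -
  interpret locally_convex_space scale by (rule X)
  show ?thesis
  proof
    fix p assume p: "p \<in> \<Gamma>"
    then have *: "seminorm scale p" "continuous_on UNIV p"
      using \<Gamma> by (auto simp: fundamental_system_def)
    show "continuous_on UNIV p" by fact
    show "seminorm (*\<^sub>R) p"
      using *(1) by (auto simp: seminorm_def simp flip: scale_of_real)
  next
    fix W :: "'x set" assume "open W" "0 \<in> W"
    then obtain q where q: "seminorm scale q" "continuous_on UNIV q" "\<And>x. q x < 1 \<Longrightarrow> x \<in> W"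
      using minkowski_functional[OF X] by metis
    then obtain p C where p: "p \<in> \<Gamma>" "C \<ge> 0" "\<And>x. q x \<le> C * p x"
      using \<Gamma> unfolding fundamental_system_def by blast
    have "y \<in> W" if y: "p y < 1 / (C + 1)" for y
    proof (rule q(3))
      have "q y \<le> C * p y" by (rule p)
      also have "\<dots> \<le> C * (1 / (C + 1))" using y p(2) by (intro mult_left_mono) auto
      also have "\<dots> < 1" using p(2) by (simp add: field_simps)
      finally show "q y < 1" .
    qed
    then show "\<exists>p\<in>\<Gamma>. \<exists>e>0. \<forall>y. p y < e \<longrightarrow> y \<in> W"
      using p(1,2) by (intro bexI[of _ p] exI[of _ "1 / (C + 1)"]) auto
  qed
qed

section \<open>Riemann integrals\<close>

definition riemann_sum :: "(real \<Rightarrow> 'a::real_vector) \<Rightarrow> (real \<times> real set) set \<Rightarrow> 'a"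
  where "riemann_sum f P = (\<Sum>(s, K)\<in>P. measure lborel K *\<^sub>R f s)"

text \<open>The nodes are counted backwards from \<open>b\<close>. For the integrand
  \<open>T (t - s) (g s)\<close> on [0,t] the node with index k thus carries the operator T((k + 1)
  h), which matches \<open>stieltjes_sum\<close> term by term.\<close>

definition left_sum :: "(real \<Rightarrow> 'a::real_vector) \<Rightarrow> real \<Rightarrow> real \<Rightarrow> nat \<Rightarrow> 'a"
  where "left_sum f a b n = (\<Sum>k<n. ((b - a) / n) *\<^sub>R f (b - real (Suc k) * ((b - a) / n)))"

definition uniform_division :: "real \<Rightarrow> real \<Rightarrow> nat \<Rightarrow> (real \<times> real set) set"
  where "uniform_division a b n =
    (\<lambda>k. (b - real (Suc k) * ((b - a) / n),
      {b - real (Suc k) * ((b - a) / n)..b - real k * ((b - a) / n)})) ` {..<n}"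

lemma grid_bounds:
  assumes ab: "a \<le> b" and k: "k \<le> n" and n: "n > 0"
  shows "b - real k * ((b - a) / real n) \<in> {a..b}"
proof -
  have "real k * ((b - a) / real n) \<le> real n * ((b - a) / real n)"
    using assms by (intro mult_right_mono) auto
  then have "real k * ((b - a) / real n) \<le> b - a" using n by simp
  moreover have "0 \<le> real k * ((b - a) / real n)" using ab by simp
  ultimately show ?thesis by auto
qed

lemma uniform_division_tagged:
  assumes ab: "a \<le> b" and n: "n > 0"
  shows "uniform_division a b n tagged_division_of {a..b}"
proof (rule tagged_division_ofI)
  define h where "h = (b - a) / real n"
  have h: "h \<ge> 0" using ab by (simp add: h_def)
  have step: "b - real (Suc k) * h \<le> b - real k * h" for k
    using h by (simp add: algebra_simps)
  show "finite (uniform_division a b n)" by (simp add: uniform_division_def)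
  fix x K assume "(x, K) \<in> uniform_division a b n"
  then obtain k where k: "k < n" "x = b - real (Suc k) * h" "K = {b - real (Suc k) * h..b - real k * h}"
    unfolding uniform_division_def h_def by blast
  show "x \<in> K" unfolding k using step[of k] by auto
  show "K \<subseteq> {a..b}"
    using grid_bounds[OF ab _ n, of "Suc k"] grid_bounds[OF ab _ n, of k] k unfolding h_def by auto
  show "\<exists>a b. K = cbox a b" unfolding k by auto
next
  define h where "h = (b - a) / real n"
  have h: "h \<ge> 0" using ab by (simp add: h_def)
  fix x1 K1 x2 K2
  assume *: "(x1, K1) \<in> uniform_division a b n" "(x2, K2) \<in> uniform_division a b n" "(x1, K1) \<noteq> (x2, K2)"
  then obtain k l where k: "x1 = b - real (Suc k) * h" "K1 = {b - real (Suc k) * h..b - real k * h}"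
    and l: "x2 = b - real (Suc l) * h" "K2 = {b - real (Suc l) * h..b - real l * h}"
    unfolding uniform_division_def h_def by blast
  have "k \<noteq> l" using *(3) k l by auto
  moreover have "b - real l * h \<le> b - real (Suc k) * h" if "k < l" for k l
    using that h by (intro diff_left_mono mult_right_mono) auto
  ultimately have "b - real l * h \<le> b - real (Suc k) * h \<or> b - real k * h \<le> b - real (Suc l) * h"
    by (meson linorder_neqE_nat)
  then show "interior K1 \<inter> interior K2 = {}"
    unfolding k l interior_atLeastAtMost_real by auto
next
  define h where "h = (b - a) / real n"
  have h: "h \<ge> 0" using ab by (simp add: h_def)
  have nh: "real n * h = b - a" using n by (simp add: h_def)
  show "\<Union>{K. \<exists>x. (x, K) \<in> uniform_division a b n} = {a..b}"
  proof (intro equalityI subsetI)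
    fix x assume "x \<in> \<Union>{K. \<exists>x. (x, K) \<in> uniform_division a b n}"
    then obtain k where k: "k < n" "x \<in> {b - real (Suc k) * h..b - real k * h}"
      unfolding uniform_division_def h_def by blast
    then show "x \<in> {a..b}"
      using grid_bounds[OF ab _ n, of "Suc k"] grid_bounds[OF ab _ n, of k] k unfolding h_def
      by (meson atLeastAtMost_iff less_imp_le order_trans Suc_leI)
  next
    fix x assume x: "x \<in> {a..b}"
    \<comment> \<open>The first grid point, counted from the right, that is not to the right of
      \<open>x\<close>; it bounds the subinterval containing \<open>x\<close> from the left. It has
      index 0 only when \<open>x = b\<close>.\<close>
    define m where "m = (LEAST m. b - real m * h \<le> x)"
    have mx: "b - real m * h \<le> x" unfolding m_def by (rule LeastI[of _ n]) (use x nh in auto)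
    have mn: "m \<le> n" unfolding m_def by (rule Least_le) (use x nh in auto)
    obtain k where k: "k < n" "x \<in> {b - real (Suc k) * h..b - real k * h}"
    proof (cases m)
      case 0
      then have "x = b" using mx x by auto
      then show ?thesis using that[of 0] n h by auto
    next
      case (Suc k)
      then have "\<not> b - real k * h \<le> x" using not_less_Least[of k "\<lambda>m. b - real m * h \<le> x"] by (simp add: m_def)
      then show ?thesis using that[of k] mx mn Suc by auto
    qed
    then have "(b - real (Suc k) * h, {b - real (Suc k) * h..b - real k * h}) \<in> uniform_division a b n"
      unfolding uniform_division_def h_def by blast
    then show "x \<in> \<Union>{K. \<exists>x. (x, K) \<in> uniform_division a b n}" using k by blast
  qed
qed

lemma uniform_division_mesh:
  assumes ab: "a \<le> b" and K: "(s, K) \<in> uniform_division a b n"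
  shows "measure lborel K = (b - a) / n"
proof -
  obtain k where k: "K = {b - real (Suc k) * ((b - a) / n)..b - real k * ((b - a) / n)}"
    using K unfolding uniform_division_def by blast
  have "b - real (Suc k) * ((b - a) / n) \<le> b - real k * ((b - a) / n)"
    using ab by (intro diff_left_mono mult_right_mono) auto
  moreover have "real (Suc k) * h = real k * h + h" for h by (simp add: distrib_right)
  ultimately show ?thesis unfolding k by (simp del: of_nat_Suc times_divide_eq_right)
qed

text \<open>A division is a set, so for \<open>a = b\<close> its members coincide and the indexing
  is not injective. Both sides are 0 then, and reindexing works otherwise.\<close>

lemma riemann_sum_uniform:
  assumes ab: "a \<le> b"
  shows "riemann_sum f (uniform_division a b n) = left_sum f a b n"
proof (cases "a = b")
  case True
  then have "measure lborel K *\<^sub>R f s = 0" if "(s, K) \<in> uniform_division a b n" for s K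
    using uniform_division_mesh[OF ab that] by simp
  then show ?thesis using True by (auto simp: riemann_sum_def left_sum_def intro!: sum.neutral)
next
  case False
  have inj: "inj_on (\<lambda>k. (b - real (Suc k) * ((b - a) / n),
      {b - real (Suc k) * ((b - a) / n)..b - real k * ((b - a) / n)})) {..<n}"
    using False by (auto simp: inj_on_def)
  have "riemann_sum f (uniform_division a b n) = (\<Sum>(s, K)\<in>uniform_division a b n. ((b - a) / n) *\<^sub>R f s)"
    unfolding riemann_sum_def by (intro sum.cong) (auto simp: uniform_division_mesh[OF ab])
  also have "\<dots> = left_sum f a b n"
    unfolding uniform_division_def left_sum_def by (subst sum.reindex[OF inj]) simp
  finally show ?thesis .
qed

text \<open>Both sides are the integral of the indicator function of \<open>cbox u v\<close> over
  \<open>{a..b}\<close>, once computed piece by piece over the division and once directly.\<close>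

lemma content_sum_Int_tagged_division:
  assumes Q: "Q tagged_division_of {a..b::real}" and K: "cbox u v \<subseteq> {a..b}"
  shows "(\<Sum>(s, L)\<in>Q. measure lborel (cbox u v \<inter> L)) = measure lborel (cbox u v)"
proof -
  let ?f = "indicator (cbox u v) :: real \<Rightarrow> real"
  have int: "(?f has_integral measure lborel (cbox u v \<inter> cbox c d)) (cbox c d)" for c d
  proof -
    have "((\<lambda>_. 1 :: real) has_integral measure lborel (cbox u v \<inter> cbox c d)) (cbox u v \<inter> cbox c d)"
      using has_integral_const[of "1::real" "max u c" "min v d"]
      by (simp add: Int_interval)
    then have "((\<lambda>x. if x \<in> cbox u v \<inter> cbox c d then 1 else 0 :: real) has_integral
        measure lborel (cbox u v \<inter> cbox c d)) (cbox c d)"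
      by (subst has_integral_restrict) auto
    then show ?thesis
      by (rule has_integral_eq[rotated]) (auto simp: indicator_def)
  qed
  have "(?f has_integral (\<Sum>(s, L)\<in>Q. measure lborel (cbox u v \<inter> L))) {a..b}"
    using tagged_division_ofD(4)[OF Q] int
    by (intro has_integral_combine_tagged_division[OF Q]) metis
  moreover have "(?f has_integral measure lborel (cbox u v)) {a..b}"
    using int[of a b] K by (metis Int_absorb2 box_real(2))
  ultimately show ?thesis by (rule has_integral_unique)
qed

lemma has_riemann_integral_linear:
  assumes "linear F" "continuous_on UNIV F" "has_riemann_integral f I a b"
  shows "has_riemann_integral (\<lambda>s. F (f s)) (F I) a b"
  unfolding has_riemann_integral_def
proof (intro allI impI)
  fix W assume W: "open W \<and> F I \<in> W"
  then have "open (F -` W) \<and> I \<in> F -` W" using open_vimage[OF _ assms(2)] by simp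
  then obtain \<delta> where "\<delta> > 0" and \<delta>: "\<And>P. P tagged_division_of {a..b} \<and> (\<forall>(s, K)\<in>P. measure lborel K < \<delta>) \<Longrightarrow>
      (\<Sum>(s, K)\<in>P. measure lborel K *\<^sub>R f s) \<in> F -` W"
    using assms(3) unfolding has_riemann_integral_def by meson
  moreover have "F (\<Sum>(s, K)\<in>P. measure lborel K *\<^sub>R f s) = (\<Sum>(s, K)\<in>P. measure lborel K *\<^sub>R F (f s))"
    for P :: "(real \<times> real set) set"
    unfolding linear_sum[OF assms(1)]
    by (intro sum.cong) (auto simp: linear_scale[OF assms(1)])
  ultimately show "\<exists>\<delta>>0. \<forall>P. P tagged_division_of {a..b} \<and> (\<forall>(s, K)\<in>P. measure lborel K < \<delta>) \<longrightarrow>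
      (\<Sum>(s, K)\<in>P. measure lborel K *\<^sub>R F (f s)) \<in> W"
    by (intro exI[of _ \<delta>]) auto
qed

lemma has_riemann_integral_cong:
  assumes f: "has_riemann_integral f I a b" and eq: "\<And>s. s \<in> {a..b} \<Longrightarrow> f s = g s"
  shows "has_riemann_integral g I a b"
proof -
  have "(\<Sum>(s, K)\<in>P. measure lborel K *\<^sub>R f s) = (\<Sum>(s, K)\<in>P. measure lborel K *\<^sub>R g s)"
    if "P tagged_division_of {a..b}" for P
  proof -
    have "f s = g s" if "(s, K) \<in> P" for s K
      using tagged_division_ofD(2,3)[OF \<open>P tagged_division_of {a..b}\<close> that] by (intro eq) blast
    then show ?thesis by (intro sum.cong refl) auto
  qed
  then show ?thesis using f unfolding has_riemann_integral_def by auto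
qed

section \<open>Algebra of left sums\<close>

lemma left_sum_linear: "linear F \<Longrightarrow> F (left_sum f a b n) = left_sum (\<lambda>s. F (f s)) a b n"
  by (simp add: left_sum_def linear_sum linear_scale)

lemma left_sum_diff: "left_sum (\<lambda>s. f s - g s) a b n = left_sum f a b n - left_sum g a b n"
  by (simp add: left_sum_def sum_subtractf scaleR_diff_right)

lemma left_sum_shift: "left_sum f (a + c) (b + c) n = left_sum (\<lambda>s. f (s + c)) a b n"
  by (simp add: left_sum_def algebra_simps)

lemma left_sum_cong:
  assumes "a \<le> b" "\<And>s. s \<in> {a..b} \<Longrightarrow> f s = g s"
  shows "left_sum f a b n = left_sum g a b n"
proof -
  have "f (b - real (Suc k) * ((b - a) / n)) = g (b - real (Suc k) * ((b - a) / n))" if "k < n" for k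
    using that grid_bounds[OF assms(1), of "Suc k" n] by (intro assms(2)) auto
  then show ?thesis unfolding left_sum_def by (intro sum.cong) auto
qed

context generating_seminorms
begin

lemma has_riemann_integral_iff:
  fixes f :: "real \<Rightarrow> 'a"
  shows
  "has_riemann_integral f I a b \<longleftrightarrow>
    (\<forall>p\<in>\<Gamma>. \<forall>e>0. \<exists>\<delta>>0. \<forall>P. P tagged_division_of {a..b} \<and> (\<forall>(s, K)\<in>P. measure lborel K < \<delta>) \<longrightarrow>
      p (riemann_sum f P - I) < e)"
    (is "?L = ?R")
proof
  assume L: ?L
  show ?R
  proof (intro ballI allI impI)
    fix p and e :: real assume p: "p \<in> \<Gamma>" and e: "e > 0"
    have "open ((\<lambda>x. p (x - I)) -` {..<e})"
      by (intro open_vimage continuous_on_seminorm p continuous_intros)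
    then show "\<exists>\<delta>>0. \<forall>P. P tagged_division_of {a..b} \<and> (\<forall>(s, K)\<in>P. measure lborel K < \<delta>) \<longrightarrow>
      p (riemann_sum f P - I) < e"
      using L[unfolded has_riemann_integral_def, rule_format, of "(\<lambda>x. p (x - I)) -` {..<e}"] e
      by (simp add: zero p riemann_sum_def)
  qed
next
  assume R: ?R
  show ?L
    unfolding has_riemann_integral_def
  proof (intro allI impI)
    fix W assume W: "open W \<and> I \<in> W"
    have "open ((\<lambda>y. y + I) -` W)" using W by (intro open_vimage continuous_intros) auto
    moreover have "0 \<in> (\<lambda>y. y + I) -` W" using W by simp
    ultimately obtain p e where p: "p \<in> \<Gamma>" "e > 0" "\<And>y. p y < e \<Longrightarrow> y \<in> (\<lambda>y. y + I) -` W"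
      using basis by metis
    obtain \<delta> where \<delta>: "\<delta> > 0" "\<And>P. P tagged_division_of {a..b} \<and> (\<forall>(s, K)\<in>P. measure lborel K < \<delta>) \<Longrightarrow>
      p (riemann_sum f P - I) < e"
      using R p(1,2) by metis
    have "riemann_sum f P \<in> W" if "P tagged_division_of {a..b} \<and> (\<forall>(s, K)\<in>P. measure lborel K < \<delta>)" for P
      using p(3)[OF \<delta>(2)[OF that]] by simp
    then show "\<exists>\<delta>>0. \<forall>P. P tagged_division_of {a..b} \<and> (\<forall>(s, K)\<in>P. measure lborel K < \<delta>) \<longrightarrow>
      (\<Sum>(s, K)\<in>P. measure lborel K *\<^sub>R f s) \<in> W"
      using \<delta>(1) by (auto simp: riemann_sum_def)
  qed
qed

lemma riemann_sum_tendsto: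
  fixes f :: "real \<Rightarrow> 'a"
  assumes f: "has_riemann_integral f I a b"
    and P: "\<And>n. n > 0 \<Longrightarrow> P n tagged_division_of {a..b}"
    and mesh: "\<And>n s K. n > 0 \<Longrightarrow> (s, K) \<in> P n \<Longrightarrow> measure lborel K \<le> c / real n"
  shows "(\<lambda>n. riemann_sum f (P n)) \<longlonglongrightarrow> I"
  unfolding tendsto_iff
proof
  fix p assume p: "p \<in> \<Gamma>"
  show "(\<lambda>n. p (riemann_sum f (P n) - I)) \<longlonglongrightarrow> 0"
  proof (rule tendstoI)
    fix e :: real assume e: "e > 0"
    obtain \<delta> where \<delta>: "\<delta> > 0" "\<And>P. P tagged_division_of {a..b} \<and> (\<forall>(s, K)\<in>P. measure lborel K < \<delta>) \<Longrightarrow>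
      p (riemann_sum f P - I) < e"
      using f[unfolded has_riemann_integral_iff] p e by metis
    have "(\<lambda>n. c / real n) \<longlonglongrightarrow> 0" by (rule lim_const_over_n)
    then have "eventually (\<lambda>n. c / real n < \<delta>) sequentially" using \<delta>(1) by (rule order_tendstoD)
    then show "eventually (\<lambda>n. dist (p (riemann_sum f (P n) - I)) 0 < e) sequentially"
      using eventually_gt_at_top[of 0]
    proof eventually_elim
      case (elim n)
      then have "p (riemann_sum f (P n) - I) < e"
        using P[of n] mesh[of n] by (intro \<delta>(2)) fastforce
      then show ?case by (simp add: nonneg p)
    qed
  qed
qed

lemma left_sum_tendsto:
  fixes f :: "real \<Rightarrow> 'a"
  assumes "a \<le> b" "has_riemann_integral f I a b"
  shows "left_sum f a b \<longlonglongrightarrow> I"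
proof -
  have "(\<lambda>n. riemann_sum f (uniform_division a b n)) \<longlonglongrightarrow> I"
    by (rule riemann_sum_tendsto[OF assms(2), of _ "b - a"])
      (auto simp: uniform_division_tagged assms(1) dest: uniform_division_mesh[OF assms(1)])
  then show ?thesis by (simp add: riemann_sum_uniform assms(1))
qed

text \<open>Any two Riemann integrals are limits of the same sequence of left sums, hence equal in a
  Hausdorff space; this gives the \<open>THE\<close> in \<open>riemann_integral\<close> its
  meaning.\<close>

lemma riemann_integral_eq:
  fixes f :: "real \<Rightarrow> 'a"
  assumes "a \<le> b" "has_riemann_integral f I a b"
  shows "riemann_integral a b f = I"
  unfolding riemann_integral_def
  using assms(2) LIMSEQ_unique[OF left_sum_tendsto[OF assms(1)] left_sum_tendsto[OF assms]]
  by (rule the_equality)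

text \<open>Instead of constructing a common refinement, both sums are written as double sums over
  pairs of intervals \<open>K\<close>, \<open>L\<close> with weight the length of the intersection.
  If \<open>K\<close> and \<open>L\<close> meet, both tags are within \<delta> of a common point,
  hence the factor 2; otherwise the weight is 0.\<close>

lemma riemann_sum_diff_le:
  assumes P: "P tagged_division_of {a..b}" "\<And>s K. (s, K) \<in> P \<Longrightarrow> measure lborel K < \<delta>"
    and Q: "Q tagged_division_of {a..b}" "\<And>s K. (s, K) \<in> Q \<Longrightarrow> measure lborel K < \<delta>"
    and ab: "a \<le> b" and p: "p \<in> \<Gamma>"
    and f: "\<And>s s'. s \<in> {a..b} \<Longrightarrow> s' \<in> {a..b} \<Longrightarrow> \<bar>s - s'\<bar> < 2 * \<delta> \<Longrightarrow> p (f s - f s') \<le> e"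
  shows "p (riemann_sum f P - riemann_sum f Q) \<le> (b - a) * e"
proof -
  have box: "\<exists>u v. K = cbox u v \<and> u \<le> v" if "R tagged_division_of {a..b}" "(s, K) \<in> R" for R s K
    using tagged_division_ofD(2,4)[OF that] by (metis box_ne_empty(1) empty_iff inner_real_def box_real(2) atLeastatMost_empty_iff)
  have split: "measure lborel K = (\<Sum>(s', L)\<in>R'. measure lborel (K \<inter> L))"
    if R: "R tagged_division_of {a..b}" and R': "R' tagged_division_of {a..b}" and K: "(s, K) \<in> R" for R R' s K
  proof -
    obtain u v where "K = cbox u v" using box[OF R K] by auto
    then show ?thesis
      using content_sum_Int_tagged_division[OF R', of u v] tagged_division_ofD(3)[OF R K] by simp
  qed
  have near: "\<bar>s - z\<bar> < \<delta>" if R: "R tagged_division_of {a..b}" and K: "(s, K) \<in> R" "measure lborel K < \<delta>" "z \<in> K" for R s K z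
  proof -
    obtain u v where uv: "K = cbox u v" "u \<le> v" using box[OF R K(1)] by auto
    have "s \<in> K" by (rule tagged_division_ofD(2)[OF R K(1)])
    then show ?thesis using uv K by (auto simp: content_real)
  qed
  have "riemann_sum f P = (\<Sum>(s, K)\<in>P. \<Sum>(s', L)\<in>Q. measure lborel (K \<inter> L) *\<^sub>R f s)"
    unfolding riemann_sum_def
    by (intro sum.cong refl) (auto simp: split[OF P(1) Q(1)] scaleR_sum_left case_prod_unfold)
  moreover have "riemann_sum f Q = (\<Sum>(s, K)\<in>P. \<Sum>(s', L)\<in>Q. measure lborel (K \<inter> L) *\<^sub>R f s')"
  proof -
    have "riemann_sum f Q = (\<Sum>(s', L)\<in>Q. \<Sum>(s, K)\<in>P. measure lborel (K \<inter> L) *\<^sub>R f s')"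
      unfolding riemann_sum_def
      by (intro sum.cong refl)
        (auto simp: split[OF Q(1) P(1)] scaleR_sum_left case_prod_unfold Int_commute)
    then show ?thesis by (simp add: case_prod_unfold sum.swap[of _ P Q])
  qed
  ultimately have "riemann_sum f P - riemann_sum f Q =
      (\<Sum>(s, K)\<in>P. \<Sum>(s', L)\<in>Q. measure lborel (K \<inter> L) *\<^sub>R (f s - f s'))"
    by (simp add: case_prod_unfold sum_subtractf scaleR_diff_right)
  also have "p \<dots> \<le> (\<Sum>(s, K)\<in>P. p (\<Sum>(s', L)\<in>Q. measure lborel (K \<inter> L) *\<^sub>R (f s - f s')))"
    using sum_le[OF p] by (simp add: case_prod_unfold)
  also have "\<dots> \<le> (\<Sum>(s, K)\<in>P. \<Sum>(s', L)\<in>Q. measure lborel (K \<inter> L) * e)"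
  proof (rule sum_mono, clarify)
    fix s K assume K: "(s, K) \<in> P"
    have "p (\<Sum>(s', L)\<in>Q. measure lborel (K \<inter> L) *\<^sub>R (f s - f s')) \<le>
        (\<Sum>(s', L)\<in>Q. p (measure lborel (K \<inter> L) *\<^sub>R (f s - f s')))"
      using sum_le[OF p] by (simp add: case_prod_unfold)
    also have "\<dots> \<le> (\<Sum>(s', L)\<in>Q. measure lborel (K \<inter> L) * e)"
    proof (rule sum_mono, clarify)
      fix s' L assume L: "(s', L) \<in> Q"
      show "p (measure lborel (K \<inter> L) *\<^sub>R (f s - f s')) \<le> measure lborel (K \<inter> L) * e"
      proof (cases "K \<inter> L = {}")
        case False
        then obtain z where "z \<in> K" "z \<in> L" by auto
        then have "\<bar>s - z\<bar> < \<delta>" "\<bar>s' - z\<bar> < \<delta>"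
          using near[OF P(1) K P(2)[OF K]] near[OF Q(1) L Q(2)[OF L]] by auto
        then have "p (f s - f s') \<le> e"
          using tagged_division_ofD(2,3)[OF P(1) K] tagged_division_ofD(2,3)[OF Q(1) L]
          by (intro f) auto
        then show ?thesis by (simp add: homogeneous p mult_left_mono)
      qed (simp add: zero p)
    qed
    finally show "p (\<Sum>(s', L)\<in>Q. measure lborel (K \<inter> L) *\<^sub>R (f s - f s')) \<le>
        (\<Sum>(s', L)\<in>Q. measure lborel (K \<inter> L) * e)" .
  qed
  also have "\<dots> = (\<Sum>(s, K)\<in>P. measure lborel K * e)"
    by (intro sum.cong refl) (auto simp: split[OF P(1) Q(1)] sum_distrib_right case_prod_unfold)
  also have "\<dots> = (\<Sum>(s, K)\<in>P. measure lborel K) * e"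
    by (simp add: sum_distrib_right case_prod_unfold)
  also have "(\<Sum>(s, K)\<in>P. measure lborel K) = b - a"
    using additive_content_tagged_division[of P a b] P(1) ab by simp
  finally show ?thesis .
qed

text \<open>The candidate is the limit along uniform divisions. The Cauchy estimate holds for
  arbitrary pairs of fine divisions, so letting one of them run through the uniform ones bounds the
  distance of any fine Riemann sum from the limit.\<close>

lemma has_riemann_integral_continuous:
  fixes f :: "real \<Rightarrow> 'a"
  assumes "complete (UNIV :: 'a set)" and ab: "a \<le> b" and f: "continuous_on {a..b} f"
  shows "\<exists>I. has_riemann_integral f I a b"
proof -
  have unif: "\<exists>\<delta>>0. \<forall>P Q. P tagged_division_of {a..b} \<and> (\<forall>(s, K)\<in>P. measure lborel K < \<delta>) \<longrightarrow>
      Q tagged_division_of {a..b} \<and> (\<forall>(s, K)\<in>Q. measure lborel K < \<delta>) \<longrightarrow>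
      p (riemann_sum f P - riemann_sum f Q) < e" if p: "p \<in> \<Gamma>" and e: "e > 0" for p e
  proof -
    define e' where "e' = e / (b - a + 1)"
    have e': "e' > 0" using e ab by (simp add: e'_def)
    obtain \<delta> where \<delta>: "\<delta> > 0" "\<And>s s'. s \<in> {a..b} \<Longrightarrow> s' \<in> {a..b} \<Longrightarrow> \<bar>s - s'\<bar> < \<delta> \<Longrightarrow> p (f s - f s') \<le> e'"
      using uniformly_continuous_seminorm[OF f p e'] by metis
    have less: "(b - a) * e' < e" using e ab by (simp add: e'_def field_simps)
    have "p (riemann_sum f P - riemann_sum f Q) < e"
      if "P tagged_division_of {a..b} \<and> (\<forall>(s, K)\<in>P. measure lborel K < \<delta> / 2)"
        "Q tagged_division_of {a..b} \<and> (\<forall>(s, K)\<in>Q. measure lborel K < \<delta> / 2)" for P Q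
    proof -
      have "p (riemann_sum f P - riemann_sum f Q) \<le> (b - a) * e'"
        using that \<delta>(2) ab p by (intro riemann_sum_diff_le[where \<delta> = "\<delta> / 2"]) auto
      then show ?thesis using less by simp
    qed
    then show ?thesis using \<delta>(1) by (intro exI[of _ "\<delta> / 2"]) auto
  qed
  have mesh: "\<exists>N>0. \<forall>n\<ge>N. uniform_division a b n tagged_division_of {a..b} \<and>
      (\<forall>(s, K)\<in>uniform_division a b n. measure lborel K < \<delta>)" if "\<delta> > 0" for \<delta>
  proof -
    have "(\<lambda>n. (b - a) / real n) \<longlonglongrightarrow> 0" by (rule lim_const_over_n)
    then have "eventually (\<lambda>n. (b - a) / real n < \<delta>) sequentially" using that by (rule order_tendstoD)
    then obtain N where N: "\<And>n. n \<ge> N \<Longrightarrow> (b - a) / real n < \<delta>"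
      unfolding eventually_sequentially by auto
    then show ?thesis
      by (intro exI[of _ "Suc N"])
        (auto simp: uniform_division_tagged ab dest!: uniform_division_mesh[OF ab])
  qed
  obtain I where I: "(\<lambda>n. riemann_sum f (uniform_division a b n)) \<longlonglongrightarrow> I"
  proof -
    have "\<exists>N. \<forall>m\<ge>N. \<forall>n\<ge>N. p (riemann_sum f (uniform_division a b m) - riemann_sum f (uniform_division a b n)) < e"
      if "p \<in> \<Gamma>" "e > 0" for p e
      using unif[OF that] mesh by metis
    from convergent_sequence[where f = "\<lambda>n. riemann_sum f (uniform_division a b n)", OF assms(1) this]
    show ?thesis using that by blast
  qed
  have "has_riemann_integral f I a b"
    unfolding has_riemann_integral_iff
  proof (intro ballI allI impI)
    fix p and e :: real assume p: "p \<in> \<Gamma>" and e: "e > 0"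
    then obtain \<delta> where \<delta>: "\<delta> > 0" and
      *: "\<And>P Q. P tagged_division_of {a..b} \<and> (\<forall>(s, K)\<in>P. measure lborel K < \<delta>) \<Longrightarrow>
      Q tagged_division_of {a..b} \<and> (\<forall>(s, K)\<in>Q. measure lborel K < \<delta>) \<Longrightarrow>
      p (riemann_sum f P - riemann_sum f Q) < e / 2"
      using unif[of p "e / 2"] by auto
    have "p (riemann_sum f P - I) < e"
      if P: "P tagged_division_of {a..b} \<and> (\<forall>(s, K)\<in>P. measure lborel K < \<delta>)" for P
    proof -
      obtain N where N: "N > 0" "\<And>n. n \<ge> N \<Longrightarrow> uniform_division a b n tagged_division_of {a..b} \<and>
        (\<forall>(s, K)\<in>uniform_division a b n. measure lborel K < \<delta>)"
        using mesh[OF \<delta>] by metis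
      have "p (riemann_sum f P - I) \<le> e / 2"
      proof (rule tendsto_le[OF p])
        show "(\<lambda>n. riemann_sum f P - riemann_sum f (uniform_division a b n)) \<longlonglongrightarrow> riemann_sum f P - I"
          by (intro tendsto_intros I)
        show "eventually (\<lambda>n. p (riemann_sum f P - riemann_sum f (uniform_division a b n)) \<le> e / 2) sequentially"
          using eventually_ge_at_top[of N]
          by eventually_elim (use *[OF P N(2)] in \<open>simp add: less_imp_le\<close>)
      qed simp
      then show ?thesis using e by simp
    qed
    then show "\<exists>\<delta>>0. \<forall>P. P tagged_division_of {a..b} \<and> (\<forall>(s, K)\<in>P. measure lborel K < \<delta>) \<longrightarrow>
      p (riemann_sum f P - I) < e" using \<delta> by blast
  qed
  then show ?thesis ..
qed

text \<open>The uniform divisions of both halves together form a division of the whole interval, in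
  general not a uniform one. This is where the integral as a limit over all fine divisions is
  used.\<close>

lemma riemann_integral_combine:
  fixes f :: "real \<Rightarrow> 'a"
  assumes abc: "a \<le> b" "b \<le> c"
    and I: "has_riemann_integral f I a b" and J: "has_riemann_integral f J b c"
    and L: "has_riemann_integral f L a c"
  shows "L = I + J"
proof -
  let ?P = "\<lambda>n. uniform_division a b n \<union> uniform_division b c n"
  have P: "?P n tagged_division_of {a..c}" if "n > 0" for n
  proof -
    have "?P n tagged_division_of {a..b} \<union> {b..c}"
      using abc that by (intro tagged_division_Un uniform_division_tagged) (auto simp: interior_atLeastAtMost_real)
    then show ?thesis using abc by (simp add: ivl_disj_un_two_touch)
  qed
  have "(\<lambda>n. riemann_sum f (?P n)) \<longlonglongrightarrow> L"
  proof (rule riemann_sum_tendsto[OF L P, where c = "c - a"])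
    fix n :: nat and s K assume "n > 0" "(s, K) \<in> ?P n"
    then show "measure lborel K \<le> (c - a) / n"
      using abc by (auto simp: uniform_division_mesh intro!: divide_right_mono)
  qed
  moreover have "riemann_sum f (?P n) = left_sum f a b n + left_sum f b c n" if n: "n > 0" for n
  proof -
    \<comment> \<open>The union is a union of sets, so a pair common to both divisions would be
      counted once instead of twice. Such a pair sits over the single point \<open>b\<close> and
      contributes 0.\<close>
    have "measure lborel K *\<^sub>R f s = 0" if K: "(s, K) \<in> uniform_division a b n \<inter> uniform_division b c n" for s K
    proof -
      have "K \<subseteq> {a..b}" "K \<subseteq> {b..c}"
        using K tagged_division_ofD(3)[OF uniform_division_tagged[OF _ n]] abc by blast+
      then have "K \<subseteq> {b}" by force
      then have "measure lborel K = 0" by (auto simp: subset_singleton_iff)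
      then show ?thesis by simp
    qed
    then have "riemann_sum f (?P n) = riemann_sum f (uniform_division a b n) + riemann_sum f (uniform_division b c n)"
      unfolding riemann_sum_def
      by (intro sum.union_inter_neutral tagged_division_of_finite[OF uniform_division_tagged] ballI)
        (use abc n in auto)
    then show ?thesis by (simp add: riemann_sum_uniform abc)
  qed
  then have ev: "eventually (\<lambda>n. riemann_sum f (?P n) = left_sum f a b n + left_sum f b c n) sequentially"
    by (intro eventually_sequentiallyI[of 1]) auto
  ultimately have "(\<lambda>n. left_sum f a b n + left_sum f b c n) \<longlonglongrightarrow> L"
    using Lim_transform_eventually ev by fast
  moreover have "(\<lambda>n. left_sum f a b n + left_sum f b c n) \<longlonglongrightarrow> I + J"
    by (intro tendsto_add left_sum_tendsto abc I J)
  ultimately show ?thesis by (rule LIMSEQ_unique)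
qed

end

section \<open>Semigroups with invertible generator\<close>

text \<open>\<open>R\<close> stands for the inverse of the generator: \<open>R_derivative\<close>
  says that \<open>R x\<close> is in the domain and is mapped to \<open>x\<close>.
  Quasi-equicontinuity is kept in the form of bounds that are uniform on each compact time
  interval.\<close>

locale inverted_semigroup = generating_seminorms \<Gamma>
  for \<Gamma> :: "('a::{real_vector, uniform_topological_group_add, t2_space} \<Rightarrow> real) set" +
  fixes T :: "real \<Rightarrow> 'a \<Rightarrow> 'a" and R :: "'a \<Rightarrow> 'a"
  assumes complete: "complete (UNIV :: 'a set)"
    and T_linear: "t \<ge> 0 \<Longrightarrow> linear (T t)"
    and T_zero: "T 0 x = x"
    and T_add: "t \<ge> 0 \<Longrightarrow> s \<ge> 0 \<Longrightarrow> T (t + s) x = T t (T s x)"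
    and T_continuous: "continuous_on {0..} (\<lambda>t. T t x)"
    and T_bounded: "q \<in> \<Gamma> \<Longrightarrow> \<exists>p\<in>\<Gamma>. \<exists>C\<ge>0. \<forall>t\<in>{0..\<tau>}. \<forall>x. q (T t x) \<le> C * p x"
    and R_linear: "linear R"
    and R_continuous: "continuous_on UNIV R"
    and R_T: "t \<ge> 0 \<Longrightarrow> R (T t x) = T t (R x)"
    and R_derivative: "((\<lambda>t. (T t (R x) - R x) /\<^sub>R t) \<longlongrightarrow> x) (at_right 0)"
begin

lemma T_diff: "t \<ge> 0 \<Longrightarrow> T t (x - y) = T t x - T t y"
  by (rule linear_diff[OF T_linear])

lemma T_scaleR: "t \<ge> 0 \<Longrightarrow> T t (a *\<^sub>R x) = a *\<^sub>R T t x"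
  by (rule linear_scale[OF T_linear])

lemma T_null: "t \<ge> 0 \<Longrightarrow> T t 0 = 0"
  by (rule linear_0[OF T_linear])

lemma T_bounded_single: "q \<in> \<Gamma> \<Longrightarrow> t \<ge> 0 \<Longrightarrow> \<exists>p\<in>\<Gamma>. \<exists>C\<ge>0. \<forall>x. q (T t x) \<le> C * p x"
  using T_bounded[of q t] by (meson atLeastAtMost_iff order_refl)

lemma T_continuous_UNIV: "t \<ge> 0 \<Longrightarrow> continuous_on UNIV (T t)"
  by (intro linear_bounded_continuous[OF generating_seminorms_axioms generating_seminorms_axioms])
    (auto intro: T_linear T_bounded_single)

lemma generator_domain_R: "R x \<in> generator_domain T"
  unfolding generator_domain_def using R_derivative by blast

lemma generator_R: "generator T (R x) = x"
  unfolding generator_def by (rule tendsto_Lim[OF _ R_derivative]) simp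

lemma R_bounded: "q \<in> \<Gamma> \<Longrightarrow> \<exists>p\<in>\<Gamma>. \<exists>C\<ge>0. \<forall>x. q (R x) \<le> C * p x"
  by (rule linear_continuous_bound[OF generating_seminorms_axioms generating_seminorms_axioms
        R_linear R_continuous])

lemma R_tendsto: "(f \<longlongrightarrow> x) F \<Longrightarrow> ((\<lambda>t. R (f t)) \<longlongrightarrow> R x) F"
  by (rule continuous_on_tendsto_compose[OF R_continuous]) auto

lemma T_tendsto: "t \<ge> 0 \<Longrightarrow> (f \<longlongrightarrow> x) F \<Longrightarrow> ((\<lambda>s. T t (f s)) \<longlongrightarrow> T t x) F"
  by (rule continuous_on_tendsto_compose[OF T_continuous_UNIV]) auto

text \<open>Strong continuity alone is separate continuity. The variation of the vector is absorbed
  by the equicontinuity on [0,\<tau>], the variation of time by strong continuity at the fixed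
  vector \<open>g z\<close>.\<close>

lemma T_continuous_joint:
  assumes a: "continuous_on S a" "\<And>z. z \<in> S \<Longrightarrow> a z \<in> {0..\<tau>}" and g: "continuous_on S g"
  shows "continuous_on S (\<lambda>z. T (a z) (g z))"
  unfolding continuous_on_def tendsto_iff
proof (intro ballI)
  fix z q assume z: "z \<in> S" and q: "q \<in> \<Gamma>"
  obtain p C where p: "p \<in> \<Gamma>" "C \<ge> 0" "\<And>t x. t \<in> {0..\<tau>} \<Longrightarrow> q (T t x) \<le> C * p x"
    using T_bounded[OF q, of \<tau>] by metis
  have "((\<lambda>w. p (g w - g z)) \<longlongrightarrow> 0) (at z within S)"
    using g z p(1) unfolding continuous_on_def tendsto_iff by blast
  moreover have "continuous_on S (\<lambda>w. T (a w) (g z))"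
    using a(2) by (intro continuous_on_compose2[OF T_continuous a(1)]) force
  then have "((\<lambda>w. q (T (a w) (g z) - T (a z) (g z))) \<longlongrightarrow> 0) (at z within S)"
    using z q unfolding continuous_on_def tendsto_iff by blast
  ultimately have lim: "((\<lambda>w. C * p (g w - g z) + q (T (a w) (g z) - T (a z) (g z))) \<longlongrightarrow> 0) (at z within S)"
    by (auto intro!: tendsto_eq_intros)
  have "q (T (a w) (g w) - T (a z) (g z)) \<le> C * p (g w - g z) + q (T (a w) (g z) - T (a z) (g z))"
    if "w \<in> S" for w
  proof -
    have "q (T (a w) (g w) - T (a z) (g z)) \<le>
        q (T (a w) (g w) - T (a w) (g z)) + q (T (a w) (g z) - T (a z) (g z))"
      by (rule diff_triangle[OF q])
    moreover have "q (T (a w) (g w) - T (a w) (g z)) \<le> C * p (g w - g z)"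
      using p(3)[OF a(2)[OF that], of "g w - g z"] a(2)[OF that] by (simp add: T_diff)
    ultimately show ?thesis by simp
  qed
  then have "eventually (\<lambda>w. q (T (a w) (g w) - T (a z) (g z)) \<le>
      C * p (g w - g z) + q (T (a w) (g z) - T (a z) (g z))) (at z within S)"
    by (auto simp: eventually_at_filter)
  then show "((\<lambda>w. q (T (a w) (g w) - T (a z) (g z))) \<longlongrightarrow> 0) (at z within S)"
    by (intro real_tendsto_sandwich[OF _ _ tendsto_const lim]) (simp_all add: nonneg q)
qed

text \<open>Joint continuity makes \<open>p (T h (g s) - g s)\<close> uniformly continuous on a
  compact rectangle, and it vanishes at \<open>h = 0\<close>. A one-point interval with a constant
  \<open>g\<close> gives the statement for a single vector.\<close>

lemma T_near_identity:
  assumes g: "continuous_on {a..b::real} g" and p: "p \<in> \<Gamma>" and e: "e > 0"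
  shows "\<exists>\<delta>>0. \<forall>h\<in>{0..<\<delta>}. \<forall>s\<in>{a..b}. p (T h (g s) - g s) \<le> e"
proof -
  let ?S = "{0..1} \<times> {a..b}" and ?f = "\<lambda>z. p (T (fst z) (g (snd z)) - g (snd z))"
  have g': "continuous_on ?S (\<lambda>z. g (snd z))"
    by (intro continuous_on_compose2[OF g] continuous_intros) auto
  have "continuous_on ?S (\<lambda>z. T (fst z) (g (snd z)))"
    by (rule T_continuous_joint[where \<tau> = 1]) (auto intro!: continuous_intros g')
  then have "continuous_on ?S ?f"
    by (intro continuous_on_seminorm[OF p] continuous_intros g')
  then have "uniformly_continuous_on ?S ?f"
    by (intro compact_uniformly_continuous compact_Times) auto
  then obtain d where d: "d > 0" "\<And>z z'. z \<in> ?S \<Longrightarrow> z' \<in> ?S \<Longrightarrow> dist z' z < d \<Longrightarrow> dist (?f z') (?f z) < e"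
    unfolding uniformly_continuous_on_def using e by meson
  have "p (T h (g s) - g s) \<le> e" if "h \<in> {0..<min d 1}" "s \<in> {a..b}" for h s
    using d(2)[of "(0, s)" "(h, s)"] that
    by (simp add: dist_Pair_Pair dist_real_def zero p T_zero)
  then show ?thesis using d(1) by (intro exI[of _ "min d 1"]) auto
qed

lemma T_telescope:
  assumes h: "h \<ge> 0"
  shows "(\<Sum>k<n. T (real k * h) (T h x - x)) = T (real n * h) x - x"
proof (induction n)
  case (Suc n)
  have "T (real (Suc n) * h) x = T (real n * h + h) x" by (simp add: distrib_right add.commute)
  then show ?case using Suc h by (simp add: T_diff T_add)
qed (simp add: T_zero)

text \<open>A mean value inequality: \<open>R (T h y - y)\<close> is the integral of \<open>T s y\<close> over \<open>[0, h]\<close>.\<close>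

lemma increment_R_bound:
  assumes p: "p \<in> \<Gamma>" and h: "h \<ge> 0" and e: "\<And>s. s \<in> {0..h} \<Longrightarrow> p (T s y - y) \<le> e"
  shows "p (T h (R y) - R y - h *\<^sub>R y) \<le> h * e"
proof (cases "h = 0")
  case True
  then show ?thesis by (simp add: T_zero zero p)
next
  case False
  then have h: "h > 0" using h by simp
  obtain p' C where p': "p' \<in> \<Gamma>" "C \<ge> 0" "\<And>t x. t \<in> {0..h} \<Longrightarrow> p (T t x) \<le> C * p' x"
    using T_bounded[OF p, of h] by metis
  \<comment> \<open>The error of the difference quotient at \<open>R y\<close> with step
    \<open>h / (n + 1)\<close>; it tends to 0. Telescoping over the n + 1 steps replaces the
    integral of \<open>T s y\<close> by a finite sum whose error is governed by
    \<open>z n\<close>.\<close>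
  define z where "z n = (T (h / real (Suc n)) (R y) - R y) /\<^sub>R (h / real (Suc n)) - y" for n
  have "filterlim (\<lambda>n. h / real (Suc n)) (at_right 0) sequentially"
    using h by (intro filterlim_at_withinI LIMSEQ_Suc lim_const_over_n) (auto simp: filterlim_at intro!: LIMSEQ_Suc lim_const_over_n)
  from filterlim_compose[OF R_derivative this]
  have "(\<lambda>n. p' (z n)) \<longlonglongrightarrow> 0"
    unfolding z_def tendsto_iff using p'(1) by blast
  then have lim: "(\<lambda>n. h * (e + C * p' (z n))) \<longlonglongrightarrow> h * e"
    by (auto intro!: tendsto_eq_intros)
  have "p (T h (R y) - R y - h *\<^sub>R y) \<le> h * (e + C * p' (z n))" for n
  proof -
    define c where "c = h / real (Suc n)"
    have c: "c > 0" "real (Suc n) * c = h" using h by (simp_all add: c_def)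
    have kc: "real k * c \<in> {0..h}" if "k < Suc n" for k
      using that c mult_right_mono[of "real k" "real (Suc n)" c] by auto
    have z: "T c (R y) - R y = c *\<^sub>R (y + z n)"
      using c unfolding z_def c_def[symmetric] by simp
    have "T h (R y) - R y - h *\<^sub>R y = (\<Sum>k<Suc n. T (real k * c) (T c (R y) - R y)) - (\<Sum>k<Suc n. c *\<^sub>R y)"
      using T_telescope[where h = c and n = "Suc n" and x = "R y"] c by (simp add: scaleR_add_left[symmetric] scaleR_scaleR sum_constant_scaleR del: sum.lessThan_Suc of_nat_Suc)
    also have "\<dots> = (\<Sum>k<Suc n. c *\<^sub>R (T (real k * c) y - y) + c *\<^sub>R T (real k * c) (z n))"
      unfolding sum_subtractf[symmetric] z
      using c by (intro sum.cong refl) (simp add: T_scaleR linear_add[OF T_linear] scaleR_add_right scaleR_diff_right)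
    also have "p \<dots> \<le> (\<Sum>k<Suc n. p (c *\<^sub>R (T (real k * c) y - y) + c *\<^sub>R T (real k * c) (z n)))"
      by (rule sum_le[OF p])
    also have "\<dots> \<le> (\<Sum>k<Suc n. c * (e + C * p' (z n)))"
    proof (rule sum_mono)
      fix k assume "k \<in> {..<Suc n}"
      then have k: "real k * c \<in> {0..h}" using kc by blast
      have "p (c *\<^sub>R (T (real k * c) y - y) + c *\<^sub>R T (real k * c) (z n)) \<le>
          c * p (T (real k * c) y - y) + c * p (T (real k * c) (z n))"
        using triangle[OF p] homogeneous[OF p] c by (metis abs_of_pos)
      also have "\<dots> \<le> c * e + c * (C * p' (z n))"
        using c p'(3)[OF k] e[OF k] by (intro add_mono mult_left_mono) auto
      finally show "p (c *\<^sub>R (T (real k * c) y - y) + c *\<^sub>R T (real k * c) (z n)) \<le> c * (e + C * p' (z n))"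
        by (simp add: distrib_left)
    qed
    also have "\<dots> = h * (e + C * p' (z n))"
      using c by (simp add: mult.assoc[symmetric] del: of_nat_Suc)
    finally show ?thesis .
  qed
  then show ?thesis
    by (intro tendsto_lowerbound[OF lim]) auto
qed

section \<open>Convolution with the semigroup\<close>

lemma convolution_has_integral:
  assumes t: "t \<ge> 0" and g: "continuous_on {0..t} g"
  shows "has_riemann_integral (\<lambda>s. T (t - s) (g s)) (convolution T g t) 0 t"
proof -
  have "continuous_on {0..t} (\<lambda>s. T (t - s) (g s))"
    by (rule T_continuous_joint[where \<tau> = t]) (auto intro!: continuous_intros g)
  then obtain I where "has_riemann_integral (\<lambda>s. T (t - s) (g s)) I 0 t"
    using has_riemann_integral_continuous[OF complete t] by blast
  then show ?thesis unfolding convolution_def by (simp add: riemann_integral_eq[OF t])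
qed

lemma convolution_left_sum:
  assumes t: "t \<ge> 0" and g: "continuous_on {0..t} g"
  shows "left_sum (\<lambda>s. T (t - s) (g s)) 0 t \<longlonglongrightarrow> convolution T g t"
  by (rule left_sum_tendsto[OF t convolution_has_integral[OF t g]])

text \<open>Riemann--Stieltjes sums of \<open>g (t - s)\<close> against the operator-valued function \<open>T\<close>; they play the
  role of \<open>A (T * g) (t)\<close>.\<close>

definition stieltjes_sum :: "(real \<Rightarrow> 'a) \<Rightarrow> real \<Rightarrow> nat \<Rightarrow> 'a"
  where "stieltjes_sum g t n = (\<Sum>k<n. T (real (Suc k) * (t / n)) (g (t - real (Suc k) * (t / n))) -
    T (real k * (t / n)) (g (t - real (Suc k) * (t / n))))"

text \<open>Each term is compared with the term of the left sum at the same node. Their difference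
  consists of two parts of order h times the deviation of T(h) from the identity on the values of
  \<open>g\<close>, and there are n terms with n h = t.\<close>

lemma R_stieltjes_sum:
  assumes t: "t \<ge> 0" and g: "continuous_on {0..t} g"
  shows "(\<lambda>n. R (stieltjes_sum g t n)) \<longlonglongrightarrow> convolution T g t"
proof -
  have "(\<lambda>n. R (stieltjes_sum g t n) - left_sum (\<lambda>s. T (t - s) (g s)) 0 t n) \<longlonglongrightarrow> 0"
    unfolding tendsto_iff
  proof
    fix q assume q: "q \<in> \<Gamma>"
    obtain p C where p: "p \<in> \<Gamma>" "C \<ge> 0" "\<And>s x. s \<in> {0..t} \<Longrightarrow> q (T s x) \<le> C * p x"
      using T_bounded[OF q, of t] by metis
    show "(\<lambda>n. q (R (stieltjes_sum g t n) - left_sum (\<lambda>s. T (t - s) (g s)) 0 t n - 0)) \<longlonglongrightarrow> 0"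
    proof (rule tendstoI)
      fix e :: real assume e: "e > 0"
      define e' where "e' = e / (2 * t * C + 1)"
      have pos: "2 * t * C + 1 > 0" using t p(2) by (simp add: add_nonneg_pos)
      then have e': "e' > 0" using e by (simp add: e'_def)
      have less: "2 * t * C * e' < e"
        using pos e by (simp add: e'_def field_simps)
      obtain \<delta> where \<delta>: "\<delta> > 0" "\<And>h s. h \<in> {0..<\<delta>} \<Longrightarrow> s \<in> {0..t} \<Longrightarrow> p (T h (g s) - g s) \<le> e'"
        using T_near_identity[OF g p(1) e'] by blast
      have "(\<lambda>n. t / real n) \<longlonglongrightarrow> 0" by (rule lim_const_over_n)
      then have "eventually (\<lambda>n. t / real n < \<delta>) sequentially" using \<delta>(1) by (rule order_tendstoD)
      then show "eventually (\<lambda>n. dist (q (R (stieltjes_sum g t n) -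
          left_sum (\<lambda>s. T (t - s) (g s)) 0 t n - 0)) 0 < e) sequentially"
        using eventually_gt_at_top[of 0]
      proof eventually_elim
        case (elim n)
        define h where "h = t / real n"
        have h: "h \<ge> 0" "h < \<delta>" "real n * h = t" using t elim by (simp_all add: h_def)
        let ?y = "\<lambda>k. g (t - real (Suc k) * h)"
        have sum_eq: "R (stieltjes_sum g t n) - left_sum (\<lambda>s. T (t - s) (g s)) 0 t n =
            (\<Sum>k<n. T (real k * h) (T h (R (?y k)) - R (?y k) - h *\<^sub>R ?y k) -
              h *\<^sub>R T (real k * h) (T h (?y k) - ?y k))"
        proof -
          \<comment> \<open>The left sum carries T((k + 1) h) y, while R applied to the increment
            yields T(k h) y to first order. The last term on the right corrects for this shift by
            one step.\<close>
          have eq: "R (T (real (Suc k) * h) y - T (real k * h) y) - h *\<^sub>R T (real (Suc k) * h) y =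
              T (real k * h) (T h (R y) - R y - h *\<^sub>R y) - h *\<^sub>R T (real k * h) (T h y - y)" for k y
          proof -
            have "T (real (Suc k) * h) x = T (real k * h) (T h x)" for x
              using h T_add[of "real k * h" h x] by (simp add: distrib_right add.commute)
            then show ?thesis
              using h by (simp add: T_diff T_scaleR linear_diff[OF R_linear] R_T scaleR_diff_right)
          qed
          show ?thesis
            unfolding stieltjes_sum_def left_sum_def linear_sum[OF R_linear] diff_0_right
              h_def[symmetric] sum_subtractf[symmetric]
            by (intro sum.cong refl) (simp add: eq del: of_nat_Suc)
        qed
        have "q (R (stieltjes_sum g t n) - left_sum (\<lambda>s. T (t - s) (g s)) 0 t n) \<le>
            (\<Sum>k<n. q (T (real k * h) (T h (R (?y k)) - R (?y k) - h *\<^sub>R ?y k) -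
              h *\<^sub>R T (real k * h) (T h (?y k) - ?y k)))"
          unfolding sum_eq by (rule sum_le[OF q])
        also have "\<dots> \<le> (\<Sum>k<n. C * (h * e') + h * (C * e'))"
        proof (rule sum_mono)
          fix k assume "k \<in> {..<n}"
          then have k: "k < n" by simp
          have kh: "real k * h \<in> {0..t}" "t - real (Suc k) * h \<in> {0..t}"
            using h k mult_right_mono[of "real k" "real n" h] mult_right_mono[of "real (Suc k)" "real n" h] by auto
          have "q (T (real k * h) (T h (R (?y k)) - R (?y k) - h *\<^sub>R ?y k)) \<le>
              C * p (T h (R (?y k)) - R (?y k) - h *\<^sub>R ?y k)"
            by (rule p(3)[OF kh(1)])
          also have "\<dots> \<le> C * (h * e')"
            using \<delta>(2)[OF _ kh(2)] h by (intro mult_left_mono p increment_R_bound) auto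
          finally have 1: "q (T (real k * h) (T h (R (?y k)) - R (?y k) - h *\<^sub>R ?y k)) \<le> C * (h * e')" .
          have "q (T (real k * h) (T h (?y k) - ?y k)) \<le> C * p (T h (?y k) - ?y k)"
            by (rule p(3)[OF kh(1)])
          also have "\<dots> \<le> C * e'"
            using \<delta>(2)[OF _ kh(2)] h by (intro mult_left_mono p) auto
          finally have "q (h *\<^sub>R T (real k * h) (T h (?y k) - ?y k)) \<le> h * (C * e')"
            using h by (simp add: homogeneous q mult_left_mono)
          with 1 show "q (T (real k * h) (T h (R (?y k)) - R (?y k) - h *\<^sub>R ?y k) -
              h *\<^sub>R T (real k * h) (T h (?y k) - ?y k)) \<le> C * (h * e') + h * (C * e')"
            using diff_le[OF q] by (meson add_mono order_trans)
        qed
        also have "\<dots> = 2 * (real n * h) * C * e'" by (simp add: algebra_simps)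
        also have "\<dots> < e" using less h by simp
        finally show ?case by (simp add: nonneg q)
      qed
    qed
  qed
  from tendsto_add[OF this convolution_left_sum[OF t g]] show ?thesis by simp
qed

lemma convolution_diff:
  assumes t: "t \<ge> 0" and f: "continuous_on {0..t} f" and g: "continuous_on {0..t} g"
  shows "convolution T (\<lambda>s. f s - g s) t = convolution T f t - convolution T g t"
proof (rule LIMSEQ_unique)
  show "left_sum (\<lambda>s. T (t - s) (f s - g s)) 0 t \<longlonglongrightarrow> convolution T (\<lambda>s. f s - g s) t"
    by (intro convolution_left_sum[OF t] continuous_intros f g)
  have eq: "left_sum (\<lambda>s. T (t - s) (f s - g s)) 0 t n =
      left_sum (\<lambda>s. T (t - s) (f s)) 0 t n - left_sum (\<lambda>s. T (t - s) (g s)) 0 t n" for n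
    unfolding left_sum_diff[symmetric] by (rule left_sum_cong) (use t in \<open>auto simp: T_diff\<close>)
  show "left_sum (\<lambda>s. T (t - s) (f s - g s)) 0 t \<longlonglongrightarrow> convolution T f t - convolution T g t"
    unfolding eq[abs_def] by (intro tendsto_diff convolution_left_sum t f g)
qed

lemma convolution_T:
  assumes t: "t \<ge> 0" and h: "h \<ge> 0" and f: "continuous_on {0..t} f"
  shows "convolution T (\<lambda>s. T h (f s)) t = T h (convolution T f t)"
proof (rule LIMSEQ_unique)
  show "left_sum (\<lambda>s. T (t - s) (T h (f s))) 0 t \<longlonglongrightarrow> convolution T (\<lambda>s. T h (f s)) t"
    using h by (intro convolution_left_sum[OF t] continuous_on_compose2[OF T_continuous_UNIV] f) auto
  have eq: "left_sum (\<lambda>s. T (t - s) (T h (f s))) 0 t n = T h (left_sum (\<lambda>s. T (t - s) (f s)) 0 t n)" for n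
    unfolding left_sum_linear[OF T_linear[OF h]]
  proof (rule left_sum_cong[OF t])
    fix s assume "s \<in> {0..t}"
    then show "T (t - s) (T h (f s)) = T h (T (t - s) (f s))"
      using h T_add[of h "t - s"] T_add[of "t - s" h] by (simp add: add.commute)
  qed
  show "left_sum (\<lambda>s. T (t - s) (T h (f s))) 0 t \<longlonglongrightarrow> T h (convolution T f t)"
    unfolding eq[abs_def] by (intro T_tendsto h convolution_left_sum t f)
qed

lemma convolution_scaleR:
  assumes t: "t \<ge> 0" and f: "continuous_on {0..t} f"
  shows "convolution T (\<lambda>s. a *\<^sub>R f s) t = a *\<^sub>R convolution T f t"
proof (rule LIMSEQ_unique)
  have lin: "linear (\<lambda>x. a *\<^sub>R x :: 'a)" by (rule linearI) (simp_all add: scaleR_add_right)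
  have "continuous_on {0..t} (\<lambda>s. a *\<^sub>R f s)"
    using f unfolding continuous_on_def by (auto intro: tendsto_scaleR_const)
  then show "left_sum (\<lambda>s. T (t - s) (a *\<^sub>R f s)) 0 t \<longlonglongrightarrow> convolution T (\<lambda>s. a *\<^sub>R f s) t"
    by (rule convolution_left_sum[OF t])
  have eq: "left_sum (\<lambda>s. T (t - s) (a *\<^sub>R f s)) 0 t n = a *\<^sub>R left_sum (\<lambda>s. T (t - s) (f s)) 0 t n" for n
    unfolding left_sum_linear[OF lin] by (rule left_sum_cong[OF t]) (simp add: T_scaleR)
  show "left_sum (\<lambda>s. T (t - s) (a *\<^sub>R f s)) 0 t \<longlonglongrightarrow> a *\<^sub>R convolution T f t"
    unfolding eq[abs_def] by (intro tendsto_scaleR_const convolution_left_sum t f)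
qed

text \<open>For a constant function the Stieltjes sums telescope to \<open>T t y - y\<close>,
  independently of the number of steps.\<close>

lemma convolution_const:
  assumes t: "t \<ge> 0"
  shows "convolution T (\<lambda>_. y) t = R (T t y - y)"
proof (rule LIMSEQ_unique)
  show "(\<lambda>n. R (stieltjes_sum (\<lambda>_. y) t n)) \<longlonglongrightarrow> convolution T (\<lambda>_. y) t"
    by (rule R_stieltjes_sum[OF t]) simp
  have "stieltjes_sum (\<lambda>_. y) t n = T t y - y" if "n > 0" for n
  proof -
    have "stieltjes_sum (\<lambda>_. y) t n = T (real n * (t / real n)) y - T (real 0 * (t / real n)) y"
      unfolding stieltjes_sum_def
      by (rule sum_lessThan_telescope[where f = "\<lambda>k. T (real k * (t / real n)) y"])
    then show ?thesis using that by (simp add: T_zero)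
  qed
  then have "eventually (\<lambda>n. R (T t y - y) = R (stieltjes_sum (\<lambda>_. y) t n)) sequentially"
    by (intro eventually_sequentiallyI[of 1]) auto
  then show "(\<lambda>n. R (stieltjes_sum (\<lambda>_. y) t n)) \<longlonglongrightarrow> R (T t y - y)"
    by (rule Lim_transform_eventually[OF tendsto_const])
qed

text \<open>Splitting the integral at \<open>t\<close> leaves a factor T(h) on [0,t] and a
  translated convolution on [t,t+h]; this is the restart of the inhomogeneous evolution at time
  \<open>t\<close>.\<close>

lemma convolution_add:
  assumes t: "t \<ge> 0" and h: "h \<ge> 0" and f: "continuous_on {0..t + h} f"
  shows "convolution T f (t + h) = T h (convolution T f t) + convolution T (\<lambda>s. f (s + t)) h"
proof -
  let ?F = "\<lambda>s. T (t + h - s) (f s)"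
  have f1: "continuous_on {0..t} f" by (rule continuous_on_subset[OF f]) (use h in auto)
  have f2: "continuous_on {0..h} (\<lambda>s. f (s + t))"
    by (intro continuous_on_compose2[OF f] continuous_intros) (use t in auto)
  have F: "continuous_on {0..t + h} ?F"
    by (rule T_continuous_joint[where \<tau> = "t + h"]) (auto intro!: continuous_intros f)
  obtain I where I: "has_riemann_integral ?F I 0 t"
    using has_riemann_integral_continuous[OF complete t continuous_on_subset[OF F]] h by auto
  obtain J where J: "has_riemann_integral ?F J t (t + h)"
    using has_riemann_integral_continuous[OF complete _ continuous_on_subset[OF F], of t "t + h"] h t by auto
  have "convolution T f (t + h) = I + J"
    using convolution_has_integral[OF _ f] t h I J by (intro riemann_integral_combine[OF t]) auto
  moreover have "I = T h (convolution T f t)"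
  proof (rule LIMSEQ_unique[OF left_sum_tendsto[OF t I]])
    have eq: "left_sum ?F 0 t n = T h (left_sum (\<lambda>s. T (t - s) (f s)) 0 t n)" for n
      unfolding left_sum_linear[OF T_linear[OF h]]
    proof (rule left_sum_cong[OF t])
      fix s assume "s \<in> {0..t}"
      then show "T (t + h - s) (f s) = T h (T (t - s) (f s))"
        using h T_add[of h "t - s"] by (simp add: algebra_simps)
    qed
    show "left_sum ?F 0 t \<longlonglongrightarrow> T h (convolution T f t)"
      unfolding eq[abs_def] by (intro T_tendsto h convolution_left_sum t f1)
  qed
  moreover have "J = convolution T (\<lambda>s. f (s + t)) h"
  proof (rule LIMSEQ_unique[OF left_sum_tendsto[OF _ J]])
    have eq: "left_sum ?F t (t + h) n = left_sum (\<lambda>s. T (h - s) (f (s + t))) 0 h n" for n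
      using left_sum_shift[of ?F 0 t h n] by (simp add: algebra_simps)
    show "left_sum ?F t (t + h) \<longlonglongrightarrow> convolution T (\<lambda>s. f (s + t)) h"
      unfolding eq[abs_def] by (intro convolution_left_sum h f2)
  qed (use h in simp)
  ultimately show ?thesis by simp
qed

end

section \<open>Bounded semivariation and maximal regularity\<close>

text \<open>\<open>max 0\<close> turns the extended real supremum into a nonnegative real constant
  by which later estimates can be multiplied.\<close>

lemma semivariation_bound:
  fixes n :: nat
  assumes V: "semivariation q p a b \<alpha> < \<infinity>"
    and "d 0 = a" "d n = b" "strict_mono_on {0..n} d" "\<And>i. i \<in> {1..n} \<Longrightarrow> p (x i) \<le> 1"
  shows "q (\<Sum>i = 1..n. \<alpha> (d i) (x i) - \<alpha> (d (i - 1)) (x i)) \<le>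
    max 0 (real_of_ereal (semivariation q p a b \<alpha>))"
proof -
  have "ereal (q (\<Sum>i = 1..n. \<alpha> (d i) (x i) - \<alpha> (d (i - 1)) (x i))) \<le> semivariation q p a b \<alpha>"
    unfolding semivariation_def using assms(2-) by (intro Sup_upper) blast
  then show ?thesis using V by (cases "semivariation q p a b \<alpha>") auto
qed

locale input_operator = inverted_semigroup \<Gamma> T R + U: generating_seminorms \<Delta>
  for \<Gamma> :: "('a::{real_vector, uniform_topological_group_add, t2_space} \<Rightarrow> real) set"
    and T R and \<Delta> :: "('u::{real_vector, uniform_topological_group_add, t2_space} \<Rightarrow> real) set" +
  fixes D :: "'u \<Rightarrow> 'a" and r :: real
  assumes D_linear: "linear D" and D_continuous: "continuous_on UNIV D" and r_pos: "0 < r"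
begin

text \<open>Outside the domain of the generator this is an unspecified value of \<open>Lim\<close>.
  The equation \<open>convolution T (D \<circ> f) t = R (response f t)\<close> certifies that the
  value is the genuine one.\<close>

definition response :: "(real \<Rightarrow> 'u) \<Rightarrow> real \<Rightarrow> 'a"
  where "response f t = generator T (convolution T (D \<circ> f) t)"

lemma D_compose: "continuous_on S f \<Longrightarrow> continuous_on S (D \<circ> f)"
  using continuous_on_compose2[OF D_continuous, of S f] by (simp add: comp_def)

lemma response_eqI: "convolution T (D \<circ> f) t = R w \<Longrightarrow> response f t = w"
  by (simp add: response_def generator_R)

text \<open>The coefficients are arbitrary vectors, so that the bound applies to sums with values of
  f as well as to differences of sums on two grids. One \<open>M\<close> serves all \<open>t\<close>
  up to \<open>r\<close>, and the bound is already in homogeneous form.\<close>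

definition grid_bounded :: "('a \<Rightarrow> real) \<Rightarrow> ('u \<Rightarrow> real) \<Rightarrow> real \<Rightarrow> bool"
  where "grid_bounded q p M \<longleftrightarrow> M \<ge> 0 \<and>
    (\<forall>t\<in>{0..r}. \<forall>n x. \<forall>\<delta>>0. (\<forall>k<n. p (x k) \<le> \<delta>) \<longrightarrow>
      q (\<Sum>k<n. T (real (Suc k) * (t / n)) (D (x k)) - T (real k * (t / n)) (D (x k))) \<le> M * \<delta>)"

lemma grid_boundedD:
  assumes "grid_bounded q p M"
  shows "M \<ge> 0" "t \<in> {0..r} \<Longrightarrow> \<delta> > 0 \<Longrightarrow> (\<And>k. k < n \<Longrightarrow> p (x k) \<le> \<delta>) \<Longrightarrow>
    q (\<Sum>k<n. T (real (Suc k) * (t / n)) (D (x k)) - T (real k * (t / n)) (D (x k))) \<le> M * \<delta>"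
  using assms unfolding grid_bounded_def by blast+

definition response_bounded :: "('a \<Rightarrow> real) \<Rightarrow> ('u \<Rightarrow> real) \<Rightarrow> real \<Rightarrow> bool"
  where "response_bounded q p M \<longleftrightarrow> M \<ge> 0 \<and>
    (\<forall>t\<in>{0..r}. \<forall>f. continuous_on {0..t} f \<longrightarrow>
      (\<forall>\<delta>>0. (\<forall>s\<in>{0..t}. p (f s) \<le> \<delta>) \<longrightarrow> q (response f t) \<le> M * \<delta>))"

lemma response_boundedD:
  assumes "response_bounded q p M"
  shows "M \<ge> 0" "t \<in> {0..r} \<Longrightarrow> continuous_on {0..t} f \<Longrightarrow> \<delta> > 0 \<Longrightarrow> (\<And>s. s \<in> {0..t} \<Longrightarrow> p (f s) \<le> \<delta>) \<Longrightarrow>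
    q (response f t) \<le> M * \<delta>"
  using assms unfolding response_bounded_def by blast+

text \<open>After scaling the coefficients into the unit ball, the grid of [0,t] is completed to a
  partition of [0,r] by one interval with coefficient 0, which adds nothing to the sum.\<close>

lemma semivariation_grid_bound:
  assumes V: "semivariation q p 0 r (\<lambda>t u. T t (D u)) < \<infinity>" and q: "q \<in> \<Gamma>" and p: "p \<in> \<Delta>"
  shows "\<exists>M. grid_bounded q p M"
proof -
  define M where "M = max 0 (real_of_ereal (semivariation q p 0 r (\<lambda>t u. T t (D u))))"
  show ?thesis
    unfolding grid_bounded_def
  proof (intro exI[of _ M] conjI ballI allI impI)
    show "M \<ge> 0" by (simp add: M_def)
    fix t \<delta> :: real and n :: nat and x
    assume t: "t \<in> {0..r}" and \<delta>: "\<delta> > 0" and x: "\<forall>k<n. p (x k) \<le> \<delta>"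
    let ?S = "\<lambda>y. \<Sum>k<n. T (real (Suc k) * (t / n)) (D (y k)) - T (real k * (t / n)) (D (y k))"
    show "q (?S x) \<le> M * \<delta>"
    proof (cases "t = 0 \<or> n = 0")
      case True
      then show ?thesis using \<delta> q by (auto simp: zero M_def)
    next
      case False
      then have t0: "t > 0" and n: "n > 0" using t by auto
      define y where "y k = (1 / \<delta>) *\<^sub>R x k" for k
      have y: "p (y k) \<le> 1" if "k < n" for k
        using x that \<delta> by (simp add: y_def U.homogeneous p)
      have Sx: "?S x = \<delta> *\<^sub>R ?S y"
        using t0 \<delta> by (simp add: y_def scaleR_sum_right linear_scale[OF D_linear] T_scaleR scaleR_diff_right
            del: of_nat_Suc)
      \<comment> \<open>For \<open>t = r\<close> the grid already ends at \<open>r\<close>, and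
        repeating that point would violate strict monotonicity.\<close>
      define N where "N = (if t < r then Suc n else n)"
      define d where "d i = (if i \<le> n then real i * (t / n) else r)" for i
      \<comment> \<open>Coefficients in the semivariation are indexed from 1, those of the grid from
        0.\<close>
      define z where "z i = (if i \<le> n then y (i - 1) else 0)" for i
      have "q (\<Sum>i = 1..N. T (d i) (D (z i)) - T (d (i - 1)) (D (z i))) \<le> M"
        unfolding M_def
      proof (rule semivariation_bound[OF V])
        show "d 0 = 0" by (simp add: d_def)
        show "d N = r" using t n by (auto simp: d_def N_def)
        show "strict_mono_on {0..N} d"
        proof (rule strict_mono_onI)
          fix i j assume ij: "i \<in> {0..N}" "j \<in> {0..N}" "i < j"
          show "d i < d j"
          proof (cases "j \<le> n")
            case True
            then show ?thesis using ij t0 n by (simp add: d_def divide_strict_right_mono)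
          next
            case False
            then have "t < r" "i \<le> n" using ij by (auto simp: N_def split: if_splits)
            moreover have "real i * (t / n) \<le> t"
              using \<open>i \<le> n\<close> t0 n by (simp add: field_simps)
            ultimately show ?thesis using False by (simp add: d_def)
          qed
        qed
        show "p (z i) \<le> 1" if "i \<in> {1..N}" for i
          using that y[of "i - 1"] by (auto simp: z_def U.zero p)
      qed
      also have "(\<Sum>i = 1..N. T (d i) (D (z i)) - T (d (i - 1)) (D (z i))) =
          (\<Sum>i = 1..n. T (d i) (D (z i)) - T (d (i - 1)) (D (z i)))"
      proof (cases "t < r")
        case True
        then have "T (d N) (D (z N)) - T (d (N - 1)) (D (z N)) = 0"
          using t0 r_pos by (simp add: N_def z_def linear_0[OF D_linear] T_null d_def)
        then show ?thesis using True by (simp add: N_def)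
      qed (simp add: N_def)
      also have "\<dots> = ?S y"
        unfolding One_nat_def sum.atLeast1_atMost_eq
        by (intro sum.cong) (auto simp: d_def z_def simp del: of_nat_Suc)
      finally show ?thesis using \<delta> unfolding Sx by (simp add: homogeneous q field_simps del: of_nat_Suc)
    qed
  qed
qed

text \<open>Every coarse increment telescopes over its block of m fine increments, all evaluated at
  the coarse node of block \<open>l div m\<close>. The difference of the two sums is therefore again
  a sum over the fine grid, with differences of values of \<open>f\<close> as coefficients.\<close>

lemma stieltjes_sum_refine:
  assumes t: "t \<ge> 0" and n: "n > 0" and m: "m > 0"
  shows "stieltjes_sum (D \<circ> f) t n - stieltjes_sum (D \<circ> f) t (n * m) =
    (\<Sum>l<n * m. T (real (Suc l) * (t / real (n * m)))
        (D (f (t - real (Suc (l div m)) * (t / n)) - f (t - real (Suc l) * (t / real (n * m))))) -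
      T (real l * (t / real (n * m)))
        (D (f (t - real (Suc (l div m)) * (t / n)) - f (t - real (Suc l) * (t / real (n * m))))))"
proof -
  define h where "h = t / real (n * m)"
  have h: "h \<ge> 0" "t / real n = real m * h" using t m by (simp_all add: h_def)
  let ?y = "\<lambda>k. D (f (t - real (Suc k) * (t / n)))"
  have "stieltjes_sum (D \<circ> f) t n =
      (\<Sum>k<n. \<Sum>l = k * m..<k * m + m. T (real (Suc l) * h) (?y (l div m)) - T (real l * h) (?y (l div m)))"
    unfolding stieltjes_sum_def
  proof (rule sum.cong[OF refl])
    fix k
    have "(\<Sum>l = k * m..<k * m + m. T (real (Suc l) * h) (?y (l div m)) - T (real l * h) (?y (l div m))) =
        (\<Sum>l = k * m..<k * m + m. T (real (Suc l) * h) (?y k) - T (real l * h) (?y k))"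
    proof (rule sum.cong[OF refl])
      fix l assume "l \<in> {k * m..<k * m + m}"
      then have "l div m = k"
        by (intro div_nat_eqI) (auto simp: mult.commute)
      then show "T (real (Suc l) * h) (?y (l div m)) - T (real l * h) (?y (l div m)) =
        T (real (Suc l) * h) (?y k) - T (real l * h) (?y k)" by simp
    qed
    also have "\<dots> = T (real (k * m + m) * h) (?y k) - T (real (k * m) * h) (?y k)"
      using sum_Suc_diff'[of "k * m" "k * m + m" "\<lambda>l. T (real l * h) (?y k)"] by simp
    also have "real (k * m + m) * h = real (Suc k) * (t / n)" by (simp add: h(2) algebra_simps)
    also have "real (k * m) * h = real k * (t / n)" by (simp add: h(2))
    finally show "T (real (Suc k) * (t / n)) ((D \<circ> f) (t - real (Suc k) * (t / n))) -
        T (real k * (t / n)) ((D \<circ> f) (t - real (Suc k) * (t / n))) =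
        (\<Sum>l = k * m..<k * m + m. T (real (Suc l) * h) (?y (l div m)) - T (real l * h) (?y (l div m)))"
      by simp
  qed
  also have "\<dots> = (\<Sum>l<n * m. T (real (Suc l) * h) (?y (l div m)) - T (real l * h) (?y (l div m)))"
    by (rule sum.nat_group)
  finally have eq: "stieltjes_sum (D \<circ> f) t n =
      (\<Sum>l<n * m. T (real (Suc l) * h) (?y (l div m)) - T (real l * h) (?y (l div m)))" .
  show ?thesis
    unfolding eq unfolding stieltjes_sum_def h_def[symmetric] sum_subtractf[symmetric]
    using h(1) by (intro sum.cong refl) (simp add: linear_diff[OF D_linear] T_diff del: of_nat_Suc)
qed

lemma stieltjes_sum_refine_bound:
  assumes M: "grid_bounded q p M" and t: "t \<in> {0..r}"
    and \<delta>: "\<delta> > 0" "\<And>s s'. s \<in> {0..t} \<Longrightarrow> s' \<in> {0..t} \<Longrightarrow> \<bar>s - s'\<bar> \<le> t / n \<Longrightarrow> p (f s - f s') \<le> \<delta>"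
    and n: "n > 0" and m: "m > 0"
  shows "q (stieltjes_sum (D \<circ> f) t n - stieltjes_sum (D \<circ> f) t (n * m)) \<le> M * \<delta>"
proof -
  have t0: "t \<ge> 0" using t by simp
  show ?thesis
    unfolding stieltjes_sum_refine[OF t0 n m]
  proof (rule grid_boundedD(2)[OF M t \<delta>(1)])
    fix l assume l: "l < n * m"
    define h where "h = t / real (n * m)"
    have h: "h \<ge> 0" "t / real n = real m * h" "real (n * m) * h = t" using t0 n m by (simp_all add: h_def)
    \<comment> \<open>In fine steps from the right end, the coarse node of the block of
      \<open>l\<close> has index \<open>Suc (l div m) * m\<close>. It is at least the fine index
      \<open>Suc l\<close> and exceeds it by less than m, so the two nodes are at most one coarse
      step apart.\<close>
    have lm: "Suc l \<le> Suc (l div m) * m" "Suc (l div m) * m \<le> l + m"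
      using m by (auto simp: div_mult_mod_eq dividend_less_div_times Suc_le_eq)
    have "Suc (l div m) \<le> n" using l m by (simp add: Suc_le_eq div_less_iff_less_mult)
    then have lm2: "Suc (l div m) * m \<le> n * m" by (rule mult_le_mono1)
    have s1: "real (Suc (l div m)) * (t / n) = real (Suc (l div m) * m) * h" unfolding h(2) of_nat_mult by (rule mult.assoc[symmetric])
    have b1: "real (Suc l) * h \<le> real (Suc (l div m) * m) * h"
      by (rule mult_right_mono[OF of_nat_mono[OF lm(1)] h(1)])
    have b2: "real (Suc (l div m) * m) * h \<le> real (n * m) * h"
      by (rule mult_right_mono[OF of_nat_mono[OF lm2] h(1)])
    have b3: "real (Suc (l div m) * m) * h \<le> real (Suc l + m) * h"
      by (rule mult_right_mono[OF of_nat_mono[OF order_trans[OF lm(2)]] h(1)]) simp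
    have b0: "0 \<le> real (Suc l) * h" using h by simp
    show "p (f (t - real (Suc (l div m)) * (t / n)) - f (t - real (Suc l) * (t / real (n * m)))) \<le> \<delta>"
    proof (rule \<delta>(2))
      show "t - real (Suc (l div m)) * (t / n) \<in> {0..t}" "t - real (Suc l) * (t / real (n * m)) \<in> {0..t}"
        unfolding s1 h_def[symmetric] using b0 b1 b2 h(3) by auto
      have "real (Suc l + m) * h = real (Suc l) * h + real m * h" by (simp add: algebra_simps)
      then show "\<bar>t - real (Suc (l div m)) * (t / n) - (t - real (Suc l) * (t / real (n * m)))\<bar> \<le> t / n"
        unfolding s1 h_def[symmetric] using b1 b3 h(2) by linarith
    qed
  qed
qed

text \<open>The grids for different n are not nested, so the sums for m and n are both compared with
  the one for \<open>m * n\<close>. Existence of the limit and membership in the domain come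
  together, since R maps the sums to a sequence converging to the convolution.\<close>

lemma response_convergence:
  assumes V: "bounded_semivariation \<Gamma> \<Delta> 0 r (\<lambda>t u. T t (D u))"
    and t: "t \<in> {0..r}" and f: "continuous_on {0..t} f"
  shows "stieltjes_sum (D \<circ> f) t \<longlonglongrightarrow> response f t" "convolution T (D \<circ> f) t = R (response f t)"
proof -
  have t0: "t \<ge> 0" using t by simp
  have "\<exists>w. stieltjes_sum (D \<circ> f) t \<longlonglongrightarrow> w"
  proof (rule convergent_sequence[OF complete])
    fix q and e :: real assume q: "q \<in> \<Gamma>" and e: "e > 0"
    obtain p where p: "p \<in> \<Delta>" "semivariation q p 0 r (\<lambda>t u. T t (D u)) < \<infinity>"
      using V q unfolding bounded_semivariation_def by blast
    obtain M where gb: "grid_bounded q p M" using semivariation_grid_bound[OF p(2) q p(1)] ..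
    note M = grid_boundedD[OF this]
    define \<delta> where "\<delta> = e / (2 * M + 1)"
    have "\<delta> > 0" "\<delta> * (2 * M + 1) = e" using e M(1) by (simp_all add: \<delta>_def)
    then have \<delta>: "\<delta> > 0" "M * \<delta> + M * \<delta> < e" by (simp_all add: algebra_simps)
    obtain \<eta> where \<eta>: "\<eta> > 0" "\<And>s s'. s \<in> {0..t} \<Longrightarrow> s' \<in> {0..t} \<Longrightarrow> \<bar>s - s'\<bar> < \<eta> \<Longrightarrow> p (f s - f s') \<le> \<delta>"
      using U.uniformly_continuous_seminorm[OF f p(1) \<delta>(1)] by metis
    have "(\<lambda>n. t / real n) \<longlonglongrightarrow> 0" by (rule lim_const_over_n)
    then have "eventually (\<lambda>n. t / real n < \<eta>) sequentially" using \<eta>(1) by (rule order_tendstoD)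
    then obtain N where N: "\<And>n. n \<ge> N \<Longrightarrow> t / real n < \<eta>" unfolding eventually_sequentially by auto
    have refine: "q (stieltjes_sum (D \<circ> f) t n - stieltjes_sum (D \<circ> f) t (n * m)) \<le> M * \<delta>"
      if "n \<ge> Suc N" "m \<ge> Suc N" for n m
      using that N[of n] \<eta>(2) by (intro stieltjes_sum_refine_bound[OF gb t \<delta>(1)]) auto
    show "\<exists>N. \<forall>m\<ge>N. \<forall>n\<ge>N. q (stieltjes_sum (D \<circ> f) t m - stieltjes_sum (D \<circ> f) t n) < e"
    proof (intro exI[of _ "Suc N"] allI impI)
      fix m n assume mn: "Suc N \<le> m" "Suc N \<le> n"
      have "q (stieltjes_sum (D \<circ> f) t m - stieltjes_sum (D \<circ> f) t n) \<le>
          q (stieltjes_sum (D \<circ> f) t m - stieltjes_sum (D \<circ> f) t (m * n)) +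
          q (stieltjes_sum (D \<circ> f) t (m * n) - stieltjes_sum (D \<circ> f) t n)"
        by (rule diff_triangle[OF q])
      also have "\<dots> \<le> M * \<delta> + M * \<delta>"
        using refine[OF mn] refine[OF mn(2,1)]
        by (intro add_mono) (simp_all add: diff_commute[OF q, of "stieltjes_sum (D \<circ> f) t (m * n)"] mult.commute)
      finally show "q (stieltjes_sum (D \<circ> f) t m - stieltjes_sum (D \<circ> f) t n) < e" using \<delta>(2) by simp
    qed
  qed
  then obtain w where w: "stieltjes_sum (D \<circ> f) t \<longlonglongrightarrow> w" ..
  have "convolution T (D \<circ> f) t = R w"
    by (rule LIMSEQ_unique[OF R_stieltjes_sum[OF t0 D_compose[OF f]] R_tendsto[OF w]])
  with w show "stieltjes_sum (D \<circ> f) t \<longlonglongrightarrow> response f t" "convolution T (D \<circ> f) t = R (response f t)"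
    by (simp_all add: response_eqI)
qed

text \<open>The grid bound applies to each Stieltjes sum with the values of \<open>f\<close> as
  coefficients and is kept in the limit. That it holds for all \<open>t\<close> with one
  \<open>M\<close> is what later allows short intervals and bounded ranges.\<close>

lemma response_bound:
  assumes V: "bounded_semivariation \<Gamma> \<Delta> 0 r (\<lambda>t u. T t (D u))" and q: "q \<in> \<Gamma>"
  shows "\<exists>p\<in>\<Delta>. \<exists>M. response_bounded q p M"
proof -
  obtain p where p: "p \<in> \<Delta>" "semivariation q p 0 r (\<lambda>t u. T t (D u)) < \<infinity>"
    using V q unfolding bounded_semivariation_def by blast
  obtain M where gb: "grid_bounded q p M" using semivariation_grid_bound[OF p(2) q p(1)] ..
    note M = grid_boundedD[OF this]
  have "q (response f t) \<le> M * \<delta>"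
    if t: "t \<in> {0..r}" and f: "continuous_on {0..t} f" and \<delta>: "\<delta> > 0" "\<And>s. s \<in> {0..t} \<Longrightarrow> p (f s) \<le> \<delta>" for t f \<delta>
  proof (rule tendsto_le[OF q response_convergence(1)[OF V t f]])
    have "q (stieltjes_sum (D \<circ> f) t n) \<le> M * \<delta>" for n
      unfolding stieltjes_sum_def comp_def
    proof (rule M(2)[OF t \<delta>(1)])
      fix k assume "k < n"
      then show "p (f (t - real (Suc k) * (t / n))) \<le> \<delta>"
        using grid_bounds[of 0 t "Suc k" n] t by (intro \<delta>(2)) auto
    qed
    then show "eventually (\<lambda>n. q (stieltjes_sum (D \<circ> f) t n) \<le> M * \<delta>) sequentially" by simp
  qed simp
  then have "response_bounded q p M" unfolding response_bounded_def using M(1) by blast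
  then show ?thesis using p(1) by blast
qed

section \<open>Differences, constants and time shifts of the response\<close>

lemma response_diff:
  assumes V: "bounded_semivariation \<Gamma> \<Delta> 0 r (\<lambda>t u. T t (D u))"
    and t: "t \<in> {0..r}" and f: "continuous_on {0..t} f" and g: "continuous_on {0..t} g"
  shows "response (\<lambda>s. f s - g s) t = response f t - response g t"
proof (rule response_eqI)
  have "convolution T (D \<circ> (\<lambda>s. f s - g s)) t = convolution T (\<lambda>s. (D \<circ> f) s - (D \<circ> g) s) t"
    by (simp add: comp_def linear_diff[OF D_linear])
  also have "\<dots> = R (response f t) - R (response g t)"
    using t convolution_diff[OF _ D_compose[OF f] D_compose[OF g]] response_convergence(2)[OF V t] f g by simp
  finally show "convolution T (D \<circ> (\<lambda>s. f s - g s)) t = R (response f t - response g t)"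
    by (simp add: linear_diff[OF R_linear])
qed

lemma response_const: "t \<ge> 0 \<Longrightarrow> response (\<lambda>_. u) t = T t (D u) - D u"
  by (rule response_eqI) (simp add: comp_def convolution_const)

lemma response_add:
  assumes V: "bounded_semivariation \<Gamma> \<Delta> 0 r (\<lambda>t u. T t (D u))"
    and t: "t \<ge> 0" and h: "h \<ge> 0" and th: "t + h \<le> r" and f: "continuous_on {0..r} f"
  shows "response f (t + h) = T h (response f t) + response (\<lambda>s. f (s + t)) h"
proof (rule response_eqI)
  have f1: "continuous_on {0..t} f" "continuous_on {0..t + h} f"
    using t h th by (auto intro: continuous_on_subset[OF f])
  have f2: "continuous_on {0..h} (\<lambda>s. f (s + t))"
    by (intro continuous_on_compose2[OF f] continuous_intros) (use t th in auto)
  have "convolution T (D \<circ> f) (t + h) = T h (convolution T (D \<circ> f) t) + convolution T (D \<circ> (\<lambda>s. f (s + t))) h"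
    using convolution_add[OF t h D_compose[OF f1(2)]] by (simp add: comp_def)
  also have "\<dots> = T h (R (response f t)) + R (response (\<lambda>s. f (s + t)) h)"
    using t h th by (simp add: response_convergence(2)[OF V] f1 f2)
  finally show "convolution T (D \<circ> f) (t + h) = R (T h (response f t) + response (\<lambda>s. f (s + t)) h)"
    by (simp add: linear_add[OF R_linear] R_T h)
qed

text \<open>The bound by \<open>M\<close> does not improve on short intervals. So the constant
  \<open>f t\<close> is subtracted first: the remainder is small by uniform continuity of
  \<open>f\<close>, and the constant has the explicit response
  \<open>T h (D (f t)) - D (f t)\<close>, small uniformly in \<open>t\<close> by
  compactness.\<close>

lemma response_small:
  assumes V: "bounded_semivariation \<Gamma> \<Delta> 0 r (\<lambda>t u. T t (D u))"
    and f: "continuous_on {0..r} f" and q: "q \<in> \<Gamma>" and e: "e > 0"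
  shows "\<exists>\<delta>>0. \<forall>t h. 0 \<le> t \<and> 0 \<le> h \<and> h < \<delta> \<and> t + h \<le> r \<longrightarrow> q (response (\<lambda>s. f (s + t)) h) \<le> e"
proof -
  obtain p M where p: "p \<in> \<Delta>" and "response_bounded q p M" using response_bound[OF V q] by blast
  note M = response_boundedD[OF this(2)]
  define e' where "e' = e / (2 * (M + 1))"
  have e': "e' > 0" "M * e' \<le> e / 2" using e M(1) by (simp_all add: e'_def field_simps)
  obtain \<delta>1 where \<delta>1: "\<delta>1 > 0" "\<And>s s'. s \<in> {0..r} \<Longrightarrow> s' \<in> {0..r} \<Longrightarrow> \<bar>s - s'\<bar> < \<delta>1 \<Longrightarrow> p (f s - f s') \<le> e'"
    using U.uniformly_continuous_seminorm[OF f p e'(1)] by metis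
  obtain \<delta>2 where \<delta>2: "\<delta>2 > 0" "\<And>h s. h \<in> {0..<\<delta>2} \<Longrightarrow> s \<in> {0..r} \<Longrightarrow> q (T h ((D \<circ> f) s) - (D \<circ> f) s) \<le> e / 2"
    using T_near_identity[OF D_compose[OF f] q, of "e / 2"] e by auto
  have "q (response (\<lambda>s. f (s + t)) h) \<le> e" if th: "0 \<le> t" "0 \<le> h" "h < min \<delta>1 \<delta>2" "t + h \<le> r" for t h
  proof -
    have f2: "continuous_on {0..h} (\<lambda>s. f (s + t))"
      by (intro continuous_on_compose2[OF f] continuous_intros) (use th in auto)
    have "response (\<lambda>s. f (s + t) - f t) h = response (\<lambda>s. f (s + t)) h - response (\<lambda>_. f t) h"
      using th by (intro response_diff[OF V] f2) auto
    then have "response (\<lambda>s. f (s + t)) h = response (\<lambda>s. f (s + t) - f t) h + (T h (D (f t)) - D (f t))"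
      using th by (simp add: response_const)
    moreover have "q (response (\<lambda>s. f (s + t) - f t) h) \<le> M * e'"
    proof (rule M(2)[OF _ _ e'(1)])
      show "continuous_on {0..h} (\<lambda>s. f (s + t) - f t)" by (intro continuous_intros f2)
      show "p (f (s + t) - f t) \<le> e'" if "s \<in> {0..h}" for s
        using th that by (intro \<delta>1(2)) auto
    qed (use th in auto)
    moreover have "q (T h (D (f t)) - D (f t)) \<le> e / 2"
      using \<delta>2(2)[of h t] th by simp
    ultimately show ?thesis
      using triangle[OF q, of "response (\<lambda>s. f (s + t) - f t) h" "T h (D (f t)) - D (f t)"] e'(2) by simp
  qed
  then show ?thesis using \<delta>1(1) \<delta>2(1) by (intro exI[of _ "min \<delta>1 \<delta>2"]) auto
qed

text \<open>The choice of \<delta> is uniform in the base point. Whatever may fail to be uniform is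
  left in the term \<open>T h (response f t) - response f t\<close>, which the continuity proofs
  treat in different ways.\<close>

lemma response_increment:
  assumes V: "bounded_semivariation \<Gamma> \<Delta> 0 r (\<lambda>t u. T t (D u))"
    and f: "continuous_on {0..r} f" and q: "q \<in> \<Gamma>" and e: "e > 0"
  shows "\<exists>\<delta>>0. \<forall>t h. 0 \<le> t \<and> 0 \<le> h \<and> h < \<delta> \<and> t + h \<le> r \<longrightarrow>
    q (response f (t + h) - response f t) \<le> q (T h (response f t) - response f t) + e"
proof -
  obtain \<delta> where \<delta>: "\<delta> > 0" "\<And>t h. 0 \<le> t \<Longrightarrow> 0 \<le> h \<Longrightarrow> h < \<delta> \<Longrightarrow> t + h \<le> r \<Longrightarrow> q (response (\<lambda>s. f (s + t)) h) \<le> e"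
    using response_small[OF V f q e] by blast
  have "q (response f (t + h) - response f t) \<le> q (T h (response f t) - response f t) + e"
    if "0 \<le> t" "0 \<le> h" "h < \<delta>" "t + h \<le> r" for t h
  proof -
    have eq: "response f (t + h) - response f t = (T h (response f t) - response f t) + response (\<lambda>s. f (s + t)) h"
      using response_add[OF V that(1,2,4) f] by simp
    show ?thesis
      using triangle[OF q, of "T h (response f t) - response f t" "response (\<lambda>s. f (s + t)) h"] \<delta>(2)[OF that]
      unfolding eq by linarith
  qed
  then show ?thesis using \<delta>(1) by blast
qed

text \<open>To the right of \<open>t\<close> the base point is \<open>t\<close> itself, so strong
  continuity at the single vector \<open>response f t\<close> controls the remaining term.\<close>

lemma response_right_continuous:
  assumes V: "bounded_semivariation \<Gamma> \<Delta> 0 r (\<lambda>t u. T t (D u))" and f: "continuous_on {0..r} f"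
  shows "right_continuous_on 0 r (response f)"
  unfolding right_continuous_on_def tendsto_iff
proof (intro ballI)
  fix t q assume t: "t \<in> {0..<r}" and q: "q \<in> \<Gamma>"
  show "((\<lambda>s. q (response f s - response f t)) \<longlongrightarrow> 0) (at_right t)"
  proof (rule tendstoI)
    fix e :: real assume e: "e > 0"
    obtain \<delta>1 where \<delta>1: "\<delta>1 > 0" "\<And>h. 0 \<le> h \<Longrightarrow> h < \<delta>1 \<Longrightarrow> t + h \<le> r \<Longrightarrow>
        q (response f (t + h) - response f t) \<le> q (T h (response f t) - response f t) + e / 3"
      using response_increment[OF V f q, of "e / 3"] e t by auto
    obtain \<delta>2 where \<delta>2: "\<delta>2 > 0" "\<And>h. h \<in> {0..<\<delta>2} \<Longrightarrow> q (T h (response f t) - response f t) \<le> e / 3"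
      using T_near_identity[of 0 0 "\<lambda>_. response f t", OF continuous_on_const q, of "e / 3"] e by auto
    have "eventually (\<lambda>s. s \<in> {t<..<t + min (min \<delta>1 \<delta>2) (r - t)}) (at_right t)"
      using \<delta>1(1) \<delta>2(1) t by (intro eventually_at_right_real) auto
    then show "eventually (\<lambda>s. dist (q (response f s - response f t)) 0 < e) (at_right t)"
    proof eventually_elim
      case (elim s)
      then have s: "s - t \<ge> 0" "s - t < \<delta>1" "s - t < \<delta>2" "s \<le> r" by auto
      then have "q (response f (t + (s - t)) - response f t) \<le> e / 3 + e / 3"
        using \<delta>1(2)[of "s - t"] \<delta>2(2)[of "s - t"] by simp
      then show ?case using e by (simp add: nonneg q)
    qed
  qed
qed

text \<open>For a left limit the base point s = t - h varies with the step, which is why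
  \<open>near\<close> is uniform over the whole range of the response. The step from the smaller to
  the larger time then covers both sides of t.\<close>

lemma response_continuous:
  assumes V: "bounded_semivariation \<Gamma> \<Delta> 0 r (\<lambda>t u. T t (D u))" and f: "continuous_on {0..r} f"
    and near: "\<And>q e. q \<in> \<Gamma> \<Longrightarrow> e > 0 \<Longrightarrow>
      \<exists>\<delta>>0. \<forall>h\<in>{0..<\<delta>}. \<forall>t\<in>{0..r}. q (T h (response f t) - response f t) \<le> e"
  shows "continuous_on {0..r} (response f)"
  unfolding continuous_on_def tendsto_iff
proof (intro ballI)
  fix t q assume t: "t \<in> {0..r}" and q: "q \<in> \<Gamma>"
  show "((\<lambda>s. q (response f s - response f t)) \<longlongrightarrow> 0) (at t within {0..r})"
  proof (rule tendstoI)
    fix e :: real assume e: "e > 0"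
    obtain \<delta>1 where \<delta>1: "\<delta>1 > 0" "\<And>t h. 0 \<le> t \<Longrightarrow> 0 \<le> h \<Longrightarrow> h < \<delta>1 \<Longrightarrow> t + h \<le> r \<Longrightarrow>
        q (response f (t + h) - response f t) \<le> q (T h (response f t) - response f t) + e / 3"
      using response_increment[OF V f q, of "e / 3"] e by auto
    obtain \<delta>2 where \<delta>2: "\<delta>2 > 0" "\<And>h t. h \<in> {0..<\<delta>2} \<Longrightarrow> t \<in> {0..r} \<Longrightarrow> q (T h (response f t) - response f t) \<le> e / 3"
      using near[OF q, of "e / 3"] e by auto
    have step: "q (response f s' - response f s) < e"
      if "s \<in> {0..r}" "s' \<in> {0..r}" "s \<le> s'" "s' - s < min \<delta>1 \<delta>2" for s s'
    proof -
      have "q (response f (s + (s' - s)) - response f s) \<le> e / 3 + e / 3"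
        using \<delta>1(2)[of s "s' - s"] \<delta>2(2)[of "s' - s" s] that by simp
      then show ?thesis using e by simp
    qed
    have "eventually (\<lambda>s. s \<in> ball t (min \<delta>1 \<delta>2)) (at t within {0..r})"
      using \<delta>1(1) \<delta>2(1) by (intro topological_tendstoD[OF tendsto_ident_at]) auto
    moreover have "eventually (\<lambda>s. s \<in> {0..r}) (at t within {0..r})"
      by (simp add: eventually_at_filter)
    ultimately show "eventually (\<lambda>s. dist (q (response f s - response f t)) 0 < e) (at t within {0..r})"
    proof eventually_elim
      case (elim s)
      then have "q (response f s - response f t) < e"
        using step[of t s] step[of s t] t
        by (cases "t \<le> s") (auto simp: dist_real_def diff_commute[OF q, of "response f s"])
      then show ?case by (simp add: nonneg q)
    qed
  qed
qed

text \<open>A finite net reduces the claim to finitely many vectors, and equicontinuity on [0,1]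
  controls the distance to the net. Of the three parts of size e / 3, two come from the distance to
  the net: one under T(h) and one under T(0).\<close>

lemma T_near_identity_totally_bounded:
  assumes S: "totally_bounded S" and q: "q \<in> \<Gamma>" and e: "e > 0"
  shows "\<exists>\<delta>>0. \<forall>h\<in>{0..<\<delta>}. \<forall>x\<in>S. q (T h x - x) \<le> e"
proof -
  obtain p C where p: "p \<in> \<Gamma>" "C \<ge> 0" "\<And>t x. t \<in> {0..1} \<Longrightarrow> q (T t x) \<le> C * p x"
    using T_bounded[OF q, of 1] by metis
  define e' where "e' = e / (3 * (C + 1))"
  have e': "e' > 0" "C * e' \<le> e / 3" using e p(2) by (simp_all add: e'_def field_simps)
  obtain N where N: "finite N" "\<And>s. s \<in> S \<Longrightarrow> \<exists>x\<in>N. p (s - x) < e'"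
    using totally_bounded_net[OF S p(1) e'(1)] by blast
  have "eventually (\<lambda>h. q (T h x - x) \<le> e / 3) (at_right 0)" for x
  proof -
    obtain \<delta> where "\<delta> > 0" "\<And>h. h \<in> {0..<\<delta>} \<Longrightarrow> q (T h x - x) \<le> e / 3"
      using T_near_identity[of 0 0 "\<lambda>_. x", OF continuous_on_const q, of "e / 3"] e by auto
    then show ?thesis unfolding eventually_at_right_field by (intro exI[of _ \<delta>]) auto
  qed
  then have "eventually (\<lambda>h. \<forall>x\<in>N. q (T h x - x) \<le> e / 3) (at_right 0)"
    by (intro eventually_ball_finite N(1)) auto
  then obtain \<delta> where \<delta>: "\<delta> > 0" "\<And>h x. 0 < h \<Longrightarrow> h < \<delta> \<Longrightarrow> x \<in> N \<Longrightarrow> q (T h x - x) \<le> e / 3"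
    unfolding eventually_at_right_field by auto
  have "q (T h s - s) \<le> e" if h: "h \<in> {0..<min \<delta> 1}" and s: "s \<in> S" for h s
  proof (cases "h = 0")
    case True
    then show ?thesis using e by (simp add: T_zero zero q)
  next
    case False
    obtain x where x: "x \<in> N" "p (s - x) < e'" using N(2)[OF s] by blast
    have small: "q (T t (s - x)) \<le> e / 3" if "t \<in> {0..1}" for t
    proof -
      have "q (T t (s - x)) \<le> C * p (s - x)" by (rule p(3)[OF that])
      also have "\<dots> \<le> C * e'" using x p(2) by (intro mult_left_mono) auto
      finally show ?thesis using e'(2) by simp
    qed
    have "T h s - s = T h (s - x) - T 0 (s - x) + (T h x - x)"
      using h by (simp add: T_diff T_zero)
    then have "q (T h s - s) \<le> q (T h (s - x)) + q (T 0 (s - x)) + q (T h x - x)"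
      using triangle[OF q, of "T h (s - x) - T 0 (s - x)" "T h x - x"] diff_le[OF q, of "T h (s - x)" "T 0 (s - x)"] by simp
    then show ?thesis
      using small[of h] small[of 0] \<delta>(2)[of h x] h x False by simp
  qed
  then show ?thesis using \<delta>(1) by (intro exI[of _ "min \<delta> 1"]) auto
qed

text \<open>\<open>f\<close> is bounded on [0,r] in each seminorm, and the constant in
  \<open>response_bound\<close> is independent of time. The range of the response is therefore
  bounded, and precompact by hypothesis.\<close>

lemma response_continuous_schwartz:
  assumes V: "bounded_semivariation \<Gamma> \<Delta> 0 r (\<lambda>t u. T t (D u))" and f: "continuous_on {0..r} f"
    and schwartz: "generalised_schwartz \<Gamma>"
  shows "continuous_on {0..r} (response f)"
proof -
  have "bounded_set \<Gamma> (response f ` {0..r})"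
    unfolding bounded_set_def
  proof
    fix q assume q: "q \<in> \<Gamma>"
    obtain p M where p: "p \<in> \<Delta>" and "response_bounded q p M" using response_bound[OF V q] by blast
  note M = response_boundedD[OF this(2)]
    obtain K where K: "K > 0" "\<And>s. s \<in> {0..r} \<Longrightarrow> p (f s) \<le> K"
      using U.bounded_on_interval[OF f p] by blast
    have "q (response f t) \<le> M * K" if "t \<in> {0..r}" for t
      using that K by (intro M(2)) (auto intro: continuous_on_subset[OF f])
    then show "bdd_above (q ` response f ` {0..r})" by (intro bdd_aboveI[of _ "M * K"]) auto
  qed
  then have tb: "totally_bounded (response f ` {0..r})"
    using schwartz by (simp add: generalised_schwartz_def)
  show ?thesis
  proof (rule response_continuous[OF V f])
    fix q and e :: real assume "q \<in> \<Gamma>" "e > 0"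
    from T_near_identity_totally_bounded[OF tb this]
    show "\<exists>\<delta>>0. \<forall>h\<in>{0..<\<delta>}. \<forall>t\<in>{0..r}. q (T h (response f t) - response f t) \<le> e" by simp
  qed
qed

text \<open>The maps \<open>S h\<close> on U stand for the semigroup moved through \<open>D\<close>.
  Then \<open>T h (response f t)\<close> is the response to \<open>S h\<close> applied to
  \<open>f\<close>, and the deviation from the identity becomes the response to a uniformly small
  function.\<close>

lemma response_continuous_commuting:
  assumes V: "bounded_semivariation \<Gamma> \<Delta> 0 r (\<lambda>t u. T t (D u))" and f: "continuous_on {0..r} f"
    and S: "\<And>h u. h \<ge> 0 \<Longrightarrow> T h (D u) = D (S h u)"
    and Sf: "\<And>h. h \<ge> 0 \<Longrightarrow> continuous_on {0..r} (\<lambda>s. S h (f s))"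
    and near: "\<And>p e. p \<in> \<Delta> \<Longrightarrow> e > 0 \<Longrightarrow> \<exists>\<delta>>0. \<forall>h\<in>{0..<\<delta>}. \<forall>s\<in>{0..r}. p (S h (f s) - f s) \<le> e"
  shows "continuous_on {0..r} (response f)"
proof (rule response_continuous[OF V f])
  fix q and e :: real assume q: "q \<in> \<Gamma>" and e: "e > 0"
  obtain p M where p: "p \<in> \<Delta>" and "response_bounded q p M" using response_bound[OF V q] by blast
  note M = response_boundedD[OF this(2)]
  define e' where "e' = e / (M + 1)"
  have e': "e' > 0" "M * e' \<le> e" using e M(1) by (simp_all add: e'_def field_simps)
  obtain \<delta> where \<delta>: "\<delta> > 0" "\<And>h s. h \<in> {0..<\<delta>} \<Longrightarrow> s \<in> {0..r} \<Longrightarrow> p (S h (f s) - f s) \<le> e'"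
    using near[OF p e'(1)] by metis
  have "q (T h (response f t) - response f t) \<le> e" if h: "h \<in> {0..<\<delta>}" and t: "t \<in> {0..r}" for h t
  proof -
    have ft: "continuous_on {0..t} f" "continuous_on {0..t} (\<lambda>s. S h (f s))"
      using t h by (auto intro: continuous_on_subset[OF f] continuous_on_subset[OF Sf])
    have "response (\<lambda>s. S h (f s)) t = T h (response f t)"
    proof (rule response_eqI)
      have "convolution T (D \<circ> (\<lambda>s. S h (f s))) t = convolution T (\<lambda>s. T h ((D \<circ> f) s)) t"
        using h by (simp add: comp_def S)
      also have "\<dots> = T h (convolution T (D \<circ> f) t)"
        using h t by (intro convolution_T D_compose ft) auto
      also have "\<dots> = R (T h (response f t))"
        using h by (simp add: response_convergence(2)[OF V t ft(1)] R_T)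
      finally show "convolution T (D \<circ> (\<lambda>s. S h (f s))) t = R (T h (response f t))" .
    qed
    then have "T h (response f t) - response f t = response (\<lambda>s. S h (f s) - f s) t"
      by (simp add: response_diff[OF V t ft(2,1)])
    moreover have "q (response (\<lambda>s. S h (f s) - f s) t) \<le> M * e'"
      using h t by (intro M(2)[OF t _ e'(1)] continuous_intros ft \<delta>(2)) auto
    ultimately show ?thesis using e'(2) by simp
  qed
  then show "\<exists>\<delta>>0. \<forall>h\<in>{0..<\<delta>}. \<forall>t\<in>{0..r}. q (T h (response f t) - response f t) \<le> e"
    using \<delta>(1) by blast
qed

end

section \<open>From admissibility to bounded semivariation\<close>

definition ramp :: "real \<Rightarrow> real \<Rightarrow> real \<Rightarrow> real"
  where "ramp \<epsilon> d s = max 0 (min 1 ((s - d) / \<epsilon>))"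

lemma ramp_mono: "\<epsilon> > 0 \<Longrightarrow> s \<le> s' \<Longrightarrow> d' \<le> d \<Longrightarrow> ramp \<epsilon> d s \<le> ramp \<epsilon> d' s'"
  unfolding ramp_def by (intro max.mono min.mono divide_right_mono) auto

lemma ramp_bounds: "ramp \<epsilon> d s \<in> {0..1}"
  by (simp add: ramp_def)

lemma ramp_zero: "\<epsilon> > 0 \<Longrightarrow> s \<le> d \<Longrightarrow> ramp \<epsilon> d s = 0"
  by (simp add: ramp_def divide_nonpos_pos)

lemma ramp_one: "\<epsilon> > 0 \<Longrightarrow> d + \<epsilon> \<le> s \<Longrightarrow> ramp \<epsilon> d s = 1"
  by (simp add: ramp_def)

lemma continuous_on_ramp: "continuous_on S g \<Longrightarrow> continuous_on S (\<lambda>s. ramp \<epsilon> d (g s))"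
  unfolding ramp_def divide_inverse by (intro continuous_intros)

lemma sum_Abel:
  fixes a :: "nat \<Rightarrow> 'a::real_vector"
  shows "(\<Sum>k<n. c (Suc k) *\<^sub>R (a (Suc k) - a k)) =
    c n *\<^sub>R a n - c 0 *\<^sub>R a 0 - (\<Sum>k<n. (c (Suc k) - c k) *\<^sub>R a k)"
  by (induction n) (simp_all add: algebra_simps)

context inverted_semigroup
begin

lemma convolution_sum:
  assumes t: "t \<ge> 0" and I: "finite I" and g: "\<And>i. i \<in> I \<Longrightarrow> continuous_on {0..t} (g i)"
  shows "convolution T (\<lambda>s. \<Sum>i\<in>I. g i s) t = (\<Sum>i\<in>I. convolution T (g i) t)"
  using I g
proof (induction I)
  case empty
  show ?case using convolution_const[OF t, of 0] t by (simp add: T_null linear_0[OF R_linear])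
next
  case (insert i I)
  have cont: "continuous_on {0..t} (g i)" "continuous_on {0..t} (\<lambda>s. \<Sum>i\<in>I. g i s)"
    using insert.prems by (auto intro: continuous_on_sum_group)
  \<comment> \<open>Additivity is read off from \<open>convolution_diff\<close> by writing
    \<open>g i\<close> as a difference of two continuous functions.\<close>
  have "convolution T (g i) t =
      convolution T (\<lambda>s. (g i s + (\<Sum>i\<in>I. g i s)) - (\<Sum>i\<in>I. g i s)) t" by simp
  also have "\<dots> = convolution T (\<lambda>s. g i s + (\<Sum>i\<in>I. g i s)) t - convolution T (\<lambda>s. \<Sum>i\<in>I. g i s) t"
    by (intro convolution_diff t continuous_on_add cont)
  finally show ?case using insert by simp
qed

text \<open>Summation by parts turns the Stieltjes sum into \<open>T r y\<close> minus an average of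
  orbit values T(k h) y. The weights are the increments of the ramp: they are nonnegative, add up to
  1 and are concentrated near \<open>d\<close>.\<close>

lemma stieltjes_sum_ramp_bound:
  assumes d: "d \<in> {0..<r}" and \<epsilon>: "0 < \<epsilon>" "\<epsilon> \<le> r - d" "\<epsilon> < \<eta>" and n: "n > 0" "r / n < \<eta>" and p: "p \<in> \<Gamma>"
    and \<eta>: "\<And>s. s \<in> {0..r} \<Longrightarrow> \<bar>s - d\<bar> < \<eta> \<Longrightarrow> p (T d y - T s y) \<le> e"
  shows "p (stieltjes_sum (\<lambda>s. ramp \<epsilon> d (r - s) *\<^sub>R y) r n - (T r y - T d y)) \<le> e"
proof -
  define h where "h = r / n"
  have r: "r > 0" using d by auto
  have h: "h > 0" "real n * h = r" "h < \<eta>" using r n by (simp_all add: h_def)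
  define c where "c k = ramp \<epsilon> d (real k * h)" for k :: nat
  define a where "a k = T (real k * h) y" for k :: nat
  define w where "w k = c (Suc k) - c k" for k
  \<comment> \<open>The ramp starts at \<open>d\<close>, which is at least 0, and is complete at
    \<open>d + \<epsilon>\<close>, which is at most \<open>r\<close>; both boundary terms of the
    summation by parts are thus explicit.\<close>
  have c: "c 0 = 0" "c n = 1"
    using d \<epsilon> h by (auto simp: c_def ramp_zero ramp_one)
  have w: "w k \<ge> 0" for k
    unfolding w_def c_def using ramp_mono[OF \<epsilon>(1), of "real k * h" "real (Suc k) * h" d d] h
    by (simp add: mult_right_mono)
  have w_sum: "(\<Sum>k<n. w k) = 1"
    unfolding w_def using c by (simp add: sum_lessThan_telescope)
  have "stieltjes_sum (\<lambda>s. ramp \<epsilon> d (r - s) *\<^sub>R y) r n = (\<Sum>k<n. c (Suc k) *\<^sub>R (a (Suc k) - a k))"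
    unfolding stieltjes_sum_def h_def[symmetric] c_def a_def
    using h by (intro sum.cong) (simp_all add: T_scaleR scaleR_diff_right del: of_nat_Suc)
  also have "\<dots> = T r y - (\<Sum>k<n. w k *\<^sub>R a k)"
    unfolding sum_Abel c w_def by (simp add: a_def h)
  finally have "stieltjes_sum (\<lambda>s. ramp \<epsilon> d (r - s) *\<^sub>R y) r n - (T r y - T d y) =
      (\<Sum>k<n. w k) *\<^sub>R T d y - (\<Sum>k<n. w k *\<^sub>R a k)" by (simp add: w_sum)
  also have "\<dots> = (\<Sum>k<n. w k *\<^sub>R (T d y - a k))"
    by (simp add: scaleR_sum_left sum_subtractf scaleR_diff_right)
  finally have eq: "stieltjes_sum (\<lambda>s. ramp \<epsilon> d (r - s) *\<^sub>R y) r n - (T r y - T d y) =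
      (\<Sum>k<n. w k *\<^sub>R (T d y - a k))" .
  have "p (\<Sum>k<n. w k *\<^sub>R (T d y - a k)) \<le> (\<Sum>k<n. p (w k *\<^sub>R (T d y - a k)))"
    by (rule sum_le[OF p])
  also have "\<dots> \<le> (\<Sum>k<n. w k * e)"
  proof (rule sum_mono)
    fix k assume "k \<in> {..<n}"
    then have k: "k < n" by simp
    have kh: "real k * h \<in> {0..r}" using h k mult_right_mono[of "real k" "real n" h] by auto
    have suc: "real (Suc k) * h = real k * h + h" by (simp add: distrib_right)
    show "p (w k *\<^sub>R (T d y - a k)) \<le> w k * e"
    proof (cases "w k = 0")
      case False
      \<comment> \<open>A nonzero weight means that the ramp grows between k h and (k + 1) h. This
        forces k h to lie above d - h and below d + \<epsilon>, hence within \<eta> of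
        \<open>d\<close>.\<close>
      have "\<not> real (Suc k) * h \<le> d"
      proof
        assume "real (Suc k) * h \<le> d"
        then have "c (Suc k) = 0" "c k = 0"
          using \<epsilon>(1) h(1) unfolding c_def suc by (auto intro!: ramp_zero)
        then show False using False by (simp add: w_def)
      qed
      moreover have "\<not> d + \<epsilon> \<le> real k * h"
      proof
        assume "d + \<epsilon> \<le> real k * h"
        then have "c (Suc k) = 1" "c k = 1"
          using \<epsilon>(1) h(1) unfolding c_def suc by (auto intro!: ramp_one)
        then show False using False by (simp add: w_def)
      qed
      ultimately have "\<bar>real k * h - d\<bar> < \<eta>" unfolding suc using \<epsilon> h by auto
      from \<eta>[OF kh this] show ?thesis
        using w[of k] by (simp add: homogeneous p a_def mult_left_mono)
    qed (simp add: zero p)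
  qed
  also have "\<dots> = e" by (simp add: w_sum flip: sum_distrib_right)
  finally show ?thesis unfolding eq .
qed

text \<open>As \<open>\<epsilon>\<close> tends to \<open>0\<close>, the ramp turns into the indicator function of \<open>(d, r]\<close>, whose convolution
  is the right-hand side.\<close>

lemma convolution_ramp_tendsto:
  assumes d: "d \<in> {0..r}" and r: "r > 0"
  shows "((\<lambda>\<epsilon>. convolution T (\<lambda>s. ramp \<epsilon> d (r - s) *\<^sub>R y) r) \<longlongrightarrow> R (T r y - T d y)) (at_right 0)"
proof (cases "d = r")
  case True
  \<comment> \<open>With \<open>d = r\<close> the ramp has no room to rise inside [0,r] and vanishes
    at all times that occur; the limit is then 0 on both sides.\<close>
  have "convolution T (\<lambda>s. ramp \<epsilon> d (r - s) *\<^sub>R y) r = 0" if "\<epsilon> > 0" for \<epsilon>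
  proof -
    have "stieltjes_sum (\<lambda>s. ramp \<epsilon> d (r - s) *\<^sub>R y) r n = 0" for n
      unfolding stieltjes_sum_def
    proof (rule sum.neutral, rule ballI)
      fix k assume "k \<in> {..<n}"
      then have "r - real (Suc k) * ((r - 0) / real n) \<in> {0..r}"
        using r by (intro grid_bounds) auto
      then have "ramp \<epsilon> d (r - (r - real (Suc k) * (r / real n))) = 0"
        using True that by (intro ramp_zero) auto
      then show "T (real (Suc k) * (r / real n)) (ramp \<epsilon> d (r - (r - real (Suc k) * (r / real n))) *\<^sub>R y) -
          T (real k * (r / real n)) (ramp \<epsilon> d (r - (r - real (Suc k) * (r / real n))) *\<^sub>R y) = 0"
        using r by (simp add: T_null del: of_nat_Suc)
    qed
    moreover have "(\<lambda>n. R (stieltjes_sum (\<lambda>s. ramp \<epsilon> d (r - s) *\<^sub>R y) r n)) \<longlonglongrightarrow>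
        convolution T (\<lambda>s. ramp \<epsilon> d (r - s) *\<^sub>R y) r"
      using r by (intro R_stieltjes_sum continuous_on_scaleR_left continuous_on_ramp continuous_intros) auto
    ultimately show ?thesis by (simp add: linear_0[OF R_linear] LIMSEQ_const_iff)
  qed
  then have "eventually (\<lambda>\<epsilon>. 0 = convolution T (\<lambda>s. ramp \<epsilon> d (r - s) *\<^sub>R y) r) (at_right 0)"
    by (auto simp: eventually_at_filter)
  then show ?thesis
    using True by (simp add: linear_0[OF R_linear] Lim_transform_eventually[OF tendsto_const])
next
  case False
  then have d': "d \<in> {0..<r}" using d by auto
  show ?thesis
    unfolding tendsto_iff
  proof
    fix q assume q: "q \<in> \<Gamma>"
    show "((\<lambda>\<epsilon>. q (convolution T (\<lambda>s. ramp \<epsilon> d (r - s) *\<^sub>R y) r - R (T r y - T d y))) \<longlongrightarrow> 0) (at_right 0)"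
    proof (rule tendstoI)
      fix e :: real assume e: "e > 0"
      obtain p C where p: "p \<in> \<Gamma>" "C \<ge> 0" "\<And>x. q (R x) \<le> C * p x"
        using R_bounded[OF q] by metis
      define e' where "e' = e / (C + 1)"
      have e': "e' > 0" "C * e' < e" using e p(2) by (simp_all add: e'_def field_simps)
      have "continuous_on {0..r} (\<lambda>s. T s y)"
        by (rule continuous_on_subset[OF T_continuous]) auto
      from uniformly_continuous_seminorm[OF this p(1) e'(1)]
      obtain \<eta> where \<eta>: "\<eta> > 0" "\<And>s s'. s \<in> {0..r} \<Longrightarrow> s' \<in> {0..r} \<Longrightarrow> \<bar>s - s'\<bar> < \<eta> \<Longrightarrow> p (T s y - T s' y) \<le> e'"
        by metis
      have "(\<lambda>n. r / real n) \<longlonglongrightarrow> 0" by (rule lim_const_over_n)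
      then have "eventually (\<lambda>n. r / real n < \<eta>) sequentially" using \<eta>(1) by (rule order_tendstoD)
      then have ev: "eventually (\<lambda>n. n > 0 \<and> r / real n < \<eta>) sequentially"
        using eventually_gt_at_top[of 0] by eventually_elim simp
      have "q (convolution T (\<lambda>s. ramp \<epsilon> d (r - s) *\<^sub>R y) r - R (T r y - T d y)) < e"
        if \<epsilon>: "0 < \<epsilon>" "\<epsilon> < min \<eta> (r - d)" for \<epsilon>
      proof -
        let ?g = "\<lambda>s. ramp \<epsilon> d (r - s) *\<^sub>R y"
        have "q (convolution T ?g r - R (T r y - T d y)) \<le> C * e'"
        proof (rule tendsto_le[OF q])
          show "(\<lambda>n. R (stieltjes_sum ?g r n) - R (T r y - T d y)) \<longlonglongrightarrow> convolution T ?g r - R (T r y - T d y)"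
            using r by (intro tendsto_diff tendsto_const R_stieltjes_sum continuous_on_scaleR_left
                continuous_on_ramp continuous_intros) auto
          show "eventually (\<lambda>n. q (R (stieltjes_sum ?g r n) - R (T r y - T d y)) \<le> C * e') sequentially"
            using ev
          proof eventually_elim
            case (elim n)
            have "p (stieltjes_sum ?g r n - (T r y - T d y)) \<le> e'"
            proof (rule stieltjes_sum_ramp_bound[OF d' \<epsilon>(1)])
              show "p (T d y - T s y) \<le> e'" if "s \<in> {0..r}" "\<bar>s - d\<bar> < \<eta>" for s
                using \<eta>(2)[OF d that(1)] that(2) by (simp add: abs_minus_commute)
            qed (use \<epsilon> elim p in auto)
            then have "C * p (stieltjes_sum ?g r n - (T r y - T d y)) \<le> C * e'"
              using p(2) by (rule mult_left_mono)
            moreover have "q (R (stieltjes_sum ?g r n) - R (T r y - T d y)) \<le> C * p (stieltjes_sum ?g r n - (T r y - T d y))"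
              using p(3) by (simp flip: linear_diff[OF R_linear])
            ultimately show ?case by simp
          qed
        qed simp
        then show ?thesis using e'(2) by simp
      qed
      then show "eventually (\<lambda>\<epsilon>. dist (q (convolution T (\<lambda>s. ramp \<epsilon> d (r - s) *\<^sub>R y) r - R (T r y - T d y))) 0 < e) (at_right 0)"
        unfolding eventually_at_right_field
        using \<eta>(1) d' by (intro exI[of _ "min \<eta> (r - d)"]) (auto simp: nonneg q)
    qed
  qed
qed

text \<open>The quotient is the mean of \<open>T s y\<close> over [0,h]. The constant 3 arises as 2
  for the deviation \<open>T s y - y\<close>, estimated by the triangle inequality, and 1 for
  \<open>y\<close> itself.\<close>

lemma difference_quotient_bound:
  assumes q: "q \<in> \<Gamma>" and b: "\<And>t x. t \<in> {0..1} \<Longrightarrow> q (T t x) \<le> b x" and h: "0 < h" "h \<le> 1"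
  shows "q ((T h (R y) - R y) /\<^sub>R h) \<le> 3 * b y"
proof -
  have y: "q y \<le> b y" using b[of 0 y] by (simp add: T_zero)
  have "q (T s y - y) \<le> 2 * b y" if "s \<in> {0..h}" for s
    using diff_le[OF q, of "T s y" y] b[of s y] y that h by auto
  then have "q (T h (R y) - R y - h *\<^sub>R y) \<le> h * (2 * b y)"
    by (rule increment_R_bound[OF q less_imp_le[OF h(1)]])
  moreover have "q (T h (R y) - R y) \<le> q (T h (R y) - R y - h *\<^sub>R y) + q (h *\<^sub>R y)"
    using triangle[OF q, of "T h (R y) - R y - h *\<^sub>R y" "h *\<^sub>R y"] by simp
  moreover have "q (h *\<^sub>R y) \<le> h * b y"
    using y h by (simp add: homogeneous q mult_left_mono)
  ultimately have "q (T h (R y) - R y) \<le> h * (3 * b y)" by (simp add: algebra_simps)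
  then show ?thesis unfolding homogeneous[OF q] using h by (simp add: field_simps)
qed

end

context input_operator
begin

text \<open>The semivariation sum \<open>w\<close> is what a step function with values
  \<open>x i\<close> would produce. Its continuous approximations have response bounded by
  \<open>K\<close>. The responses need not converge, but their images under R converge to
  \<open>R w\<close>, and the difference quotients carry the bound over to \<open>w\<close>.\<close>

lemma step_response_bound:
  fixes n :: nat
  assumes q: "q \<in> \<Gamma>" and q': "q' \<in> \<Gamma>" and C: "C \<ge> 0" "\<And>t x. t \<in> {0..1} \<Longrightarrow> q (T t x) \<le> C * q' x"
    and p: "p \<in> \<Delta>"
    and dom: "\<And>f. f \<in> C_space r \<Longrightarrow> convolution T (D \<circ> f) r = R (response f r)"
    and K: "\<And>f. f \<in> C_space r \<Longrightarrow> (\<And>s. s \<in> {0..r} \<Longrightarrow> p (f s) \<le> 1) \<Longrightarrow> q' (response f r) \<le> K"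
    and d: "d 0 = 0" "d n = r" "strict_mono_on {0..n} d" and x: "\<And>i. i \<in> {1..n} \<Longrightarrow> p (x i) \<le> 1"
  shows "q (\<Sum>i = 1..n. T (d i) (D (x i)) - T (d (i - 1)) (D (x i))) \<le> 3 * (C * K)"
proof -
  define w where "w = (\<Sum>i = 1..n. T (d i) (D (x i)) - T (d (i - 1)) (D (x i)))"
  have d_le: "d i \<le> d j" if "i \<le> j" "j \<le> n" for i j
    using that strict_mono_on_leD[OF d(3), of i j] by simp
  have d_mem: "d i \<in> {0..r}" if "i \<le> n" for i
    using d_le[of 0 i] d_le[of i n] d that by simp
  \<comment> \<open>A difference of consecutive ramps, approximating the indicator function of the
    interval from \<open>d (i - 1)\<close> to \<open>d i\<close>. The functions are nonnegative and
    their sum telescopes to at most 1, so the unit ball of \<open>p\<close> is preserved.\<close>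
  define \<phi> where "\<phi> \<epsilon> i s = ramp \<epsilon> (d (i - 1)) s - ramp \<epsilon> (d i) s" for \<epsilon> and i :: nat and s
  define f where "f \<epsilon> s = (if s \<in> {0..r} then \<Sum>i = 1..n. \<phi> \<epsilon> i (r - s) *\<^sub>R x i else 0)" for \<epsilon> s
  have f_cont: "continuous_on {0..r} (\<lambda>s. \<Sum>i = 1..n. \<phi> \<epsilon> i (r - s) *\<^sub>R x i)" for \<epsilon>
    unfolding \<phi>_def
    by (intro continuous_on_sum_group U.continuous_on_scaleR_left continuous_on_ramp continuous_intros)
  have f_C: "f \<epsilon> \<in> C_space r" for \<epsilon>
  proof -
    have "continuous_on {0..r} (f \<epsilon>)"
      by (rule continuous_on_eq[OF f_cont[of \<epsilon>]]) (simp add: f_def)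
    then show ?thesis by (simp add: C_space_def f_def)
  qed
  have f_le: "p (f \<epsilon> s) \<le> 1" if \<epsilon>: "\<epsilon> > 0" and s: "s \<in> {0..r}" for \<epsilon> s
  proof -
    have \<phi>0: "\<phi> \<epsilon> i (r - s) \<ge> 0" if "i \<in> {1..n}" for i
      unfolding \<phi>_def using ramp_mono[OF \<epsilon>, of "r - s" "r - s" "d (i - 1)" "d i"] d_le[of "i - 1" i] that by simp
    have "p (f \<epsilon> s) \<le> (\<Sum>i = 1..n. p (\<phi> \<epsilon> i (r - s) *\<^sub>R x i))"
      using s U.sum_le[OF p, of "\<lambda>i. \<phi> \<epsilon> i (r - s) *\<^sub>R x i" "{1..n}"] by (simp add: f_def)
    also have "\<dots> \<le> (\<Sum>i = 1..n. \<phi> \<epsilon> i (r - s))"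
      using \<phi>0 x by (intro sum_mono) (simp add: U.homogeneous p mult_left_le)
    also have "\<dots> = (\<Sum>i<n. ramp \<epsilon> (d i) (r - s) - ramp \<epsilon> (d (Suc i)) (r - s))"
      unfolding \<phi>_def One_nat_def sum.atLeast1_atMost_eq by simp
    also have "\<dots> = ramp \<epsilon> (d 0) (r - s) - ramp \<epsilon> (d n) (r - s)"
      by (rule sum_lessThan_telescope')
    also have "\<dots> \<le> 1" using ramp_bounds[of \<epsilon> "d 0" "r - s"] ramp_bounds[of \<epsilon> "d n" "r - s"] by simp
    finally show ?thesis .
  qed
  define g where "g \<epsilon> e i s = ramp \<epsilon> e (r - s) *\<^sub>R D (x i)" for \<epsilon> e i s
  have g_cont: "continuous_on {0..r} (g \<epsilon> e i)" for \<epsilon> e i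
    unfolding g_def by (intro continuous_on_scaleR_left continuous_on_ramp continuous_intros)
  have conv: "convolution T (D \<circ> f \<epsilon>) r =
      (\<Sum>i = 1..n. convolution T (g \<epsilon> (d (i - 1)) i) r - convolution T (g \<epsilon> (d i) i) r)" for \<epsilon>
  proof -
    have "convolution T (D \<circ> f \<epsilon>) r = convolution T (\<lambda>s. \<Sum>i = 1..n. g \<epsilon> (d (i - 1)) i s - g \<epsilon> (d i) i s) r"
    proof (rule LIMSEQ_unique)
      show "left_sum (\<lambda>s. T (r - s) ((D \<circ> f \<epsilon>) s)) 0 r \<longlonglongrightarrow> convolution T (D \<circ> f \<epsilon>) r"
        using r_pos f_C[of \<epsilon>] by (intro convolution_left_sum D_compose) (auto simp: C_space_def)
      have eq: "left_sum (\<lambda>s. T (r - s) ((D \<circ> f \<epsilon>) s)) 0 r =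
          left_sum (\<lambda>s. T (r - s) (\<Sum>i = 1..n. g \<epsilon> (d (i - 1)) i s - g \<epsilon> (d i) i s)) 0 r"
        using r_pos
        by (intro ext left_sum_cong)
          (simp_all add: f_def \<phi>_def g_def linear_sum[OF D_linear] linear_scale[OF D_linear]
            linear_diff[OF D_linear] scaleR_diff_left)
      show "left_sum (\<lambda>s. T (r - s) ((D \<circ> f \<epsilon>) s)) 0 r \<longlonglongrightarrow>
          convolution T (\<lambda>s. \<Sum>i = 1..n. g \<epsilon> (d (i - 1)) i s - g \<epsilon> (d i) i s) r"
        unfolding eq using r_pos
        by (intro convolution_left_sum continuous_on_sum_group continuous_on_diff g_cont) auto
    qed
    also have "\<dots> = (\<Sum>i = 1..n. convolution T (\<lambda>s. g \<epsilon> (d (i - 1)) i s - g \<epsilon> (d i) i s) r)"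
      using r_pos by (intro convolution_sum continuous_on_diff g_cont) auto
    also have "\<dots> = (\<Sum>i = 1..n. convolution T (g \<epsilon> (d (i - 1)) i) r - convolution T (g \<epsilon> (d i) i) r)"
      using r_pos by (intro sum.cong refl convolution_diff g_cont) auto
    finally show ?thesis .
  qed
  have "((\<lambda>\<epsilon>. \<Sum>i = 1..n. convolution T (g \<epsilon> (d (i - 1)) i) r - convolution T (g \<epsilon> (d i) i) r) \<longlongrightarrow>
      (\<Sum>i = 1..n. R (T r (D (x i)) - T (d (i - 1)) (D (x i))) - R (T r (D (x i)) - T (d i) (D (x i))))) (at_right 0)"
    unfolding g_def using r_pos d_mem
    by (intro tendsto_sum_group tendsto_diff convolution_ramp_tendsto) auto
  also have "(\<Sum>i = 1..n. R (T r (D (x i)) - T (d (i - 1)) (D (x i))) - R (T r (D (x i)) - T (d i) (D (x i)))) = R w"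
    unfolding w_def linear_sum[OF R_linear] by (simp flip: linear_diff[OF R_linear])
  finally have lim: "((\<lambda>\<epsilon>. R (response (f \<epsilon>) r)) \<longlongrightarrow> R w) (at_right 0)"
    unfolding conv[symmetric] using dom[OF f_C] by simp
  \<comment> \<open>At fixed \<open>h\<close> the quotient depends continuously on its vector, so
    \<epsilon> can tend to 0 first. The bound does not involve \<open>h\<close>, which leaves the
    limit \<open>h\<close> to 0 for the end.\<close>
  have quot: "q ((T h (R w) - R w) /\<^sub>R h) \<le> 3 * (C * K)" if h: "0 < h" "h \<le> 1" for h
  proof (rule tendsto_le[OF q])
    show "((\<lambda>\<epsilon>. inverse h *\<^sub>R (T h (R (response (f \<epsilon>) r)) - R (response (f \<epsilon>) r))) \<longlongrightarrow> (T h (R w) - R w) /\<^sub>R h) (at_right 0)"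
      using h by (intro tendsto_scaleR_const tendsto_diff T_tendsto lim) simp
    have "q ((T h (R (response (f \<epsilon>) r)) - R (response (f \<epsilon>) r)) /\<^sub>R h) \<le> 3 * (C * K)" if \<epsilon>: "\<epsilon> > 0" for \<epsilon>
    proof -
      have "q ((T h (R (response (f \<epsilon>) r)) - R (response (f \<epsilon>) r)) /\<^sub>R h) \<le> 3 * (C * q' (response (f \<epsilon>) r))"
        using difference_quotient_bound[OF q C(2) h] .
      also have "\<dots> \<le> 3 * (C * K)"
        using K[OF f_C f_le[OF \<epsilon>]] C(1) by (intro mult_left_mono) auto
      finally show ?thesis .
    qed
    then show "eventually (\<lambda>\<epsilon>. q (inverse h *\<^sub>R (T h (R (response (f \<epsilon>) r)) - R (response (f \<epsilon>) r))) \<le> 3 * (C * K)) (at_right 0)"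
      by (auto simp: eventually_at_filter)
  qed simp
  have "q w \<le> 3 * (C * K)"
  proof (rule tendsto_le[OF q R_derivative])
    show "eventually (\<lambda>h. q ((T h (R w) - R w) /\<^sub>R h) \<le> 3 * (C * K)) (at_right 0)"
      unfolding eventually_at_right_field using quot by (intro exI[of _ 1]) auto
  qed simp
  then show ?thesis by (simp add: w_def)
qed

text \<open>The bound on responses is requested for a seminorm \<open>q'\<close> that dominates
  \<open>q\<close> along T on [0,1], because the estimate of difference quotients passes from
  \<open>q\<close> to \<open>q'\<close>.\<close>

lemma bounded_semivariation_if_response_continuous:
  assumes dom: "\<And>f. f \<in> C_space r \<Longrightarrow> convolution T (D \<circ> f) r = R (response f r)"
    and bound: "\<And>q. q \<in> \<Gamma> \<Longrightarrow> \<exists>p\<in>\<Delta>. \<exists>K. \<forall>f\<in>C_space r. (\<forall>s\<in>{0..r}. p (f s) \<le> 1) \<longrightarrow> q (response f r) \<le> K"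
  shows "bounded_semivariation \<Gamma> \<Delta> 0 r (\<lambda>t u. T t (D u))"
  unfolding bounded_semivariation_def
proof
  fix q assume q: "q \<in> \<Gamma>"
  obtain q' C where q': "q' \<in> \<Gamma>" "C \<ge> 0" "\<And>t x. t \<in> {0..1} \<Longrightarrow> q (T t x) \<le> C * q' x"
    using T_bounded[OF q, of 1] by metis
  obtain p K where p: "p \<in> \<Delta>"
    and K: "\<And>f. f \<in> C_space r \<Longrightarrow> (\<And>s. s \<in> {0..r} \<Longrightarrow> p (f s) \<le> 1) \<Longrightarrow> q' (response f r) \<le> K"
    using bound[OF q'(1)] by blast
  have "semivariation q p 0 r (\<lambda>t u. T t (D u)) \<le> ereal (3 * (C * K))"
    unfolding semivariation_def
  proof (rule Sup_least, clarify)
    fix n :: nat and d x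
    assume d: "d 0 = 0" "r = d n" "strict_mono_on {0..n} d" and x: "\<forall>i\<in>{1..n}. p (x i) \<le> 1"
    have "q (\<Sum>i = 1..n. T (d i) (D (x i)) - T (d (i - 1)) (D (x i))) \<le> 3 * (C * K)"
      by (rule step_response_bound[OF q q'(1) q'(2) q'(3) p dom K d(1) d(2)[symmetric] d(3) x[rule_format]])
    then show "ereal (q (\<Sum>i = 1..n. T (d i) (D (x i)) - T (d (i - 1)) (D (x i)))) \<le> ereal (3 * (C * K))"
      by simp
  qed
  also have "\<dots> < \<infinity>" by simp
  finally show "\<exists>p\<in>\<Delta>. semivariation q p 0 r (\<lambda>t u. T t (D u)) < \<infinity>" using p by blast
qed

end

section \<open>Embeddings and seminorm topologies\<close>

text \<open>The image of the unit ball of \<open>p\<close> is relatively open and so contains the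
  trace of a ball around 0. The topology \<tau> is left abstract: it is the seminorm topology of the
  extrapolation space in one use and the topology of U in the other.\<close>

lemma embedding_seminorm_bound:
  fixes e :: "'a::real_vector \<Rightarrow> 'b::{real_vector, uniform_topological_group_add, t2_space}"
  assumes Y: "generating_seminorms \<Delta>" and emb: "embedding_map \<tau> euclidean e" and \<tau>: "topspace \<tau> = UNIV"
    and e: "linear e" and p: "seminorm (*\<^sub>R) p" and op: "openin \<tau> {x. p x < 1}"
  shows "\<exists>q\<in>\<Delta>. \<exists>C\<ge>0. \<forall>x. p x \<le> C * q (e x)"
proof -
  interpret Y: generating_seminorms \<Delta> by (rule Y)
  have hom: "homeomorphic_map \<tau> (top_of_set (range e)) e"
    using emb by (simp add: embedding_map_def \<tau>)
  then have inj: "inj e" by (simp add: homeomorphic_map_def \<tau> homeomorphic_eq_everything_map)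
  have "openin (top_of_set (range e)) (e ` {x. p x < 1})"
    using hom op by (simp add: homeomorphic_eq_everything_map open_map_def)
  then obtain W where W: "open W" "e ` {x. p x < 1} = range e \<inter> W"
    by (auto simp: openin_open)
  have "e 0 \<in> e ` {x. p x < 1}" using seminorm_zero[OF p] by simp
  then have "0 \<in> W" using W(2) by (auto simp: linear_0[OF e])
  then obtain q \<epsilon> where q: "q \<in> \<Delta>" "\<epsilon> > 0" "\<And>y. q y < \<epsilon> \<Longrightarrow> y \<in> W"
    using Y.basis[OF W(1)] by blast
  have "p x \<le> 1" if "q (e x) < \<epsilon>" for x
  proof -
    have "e x \<in> e ` {x. p x < 1}" using W(2) q(3)[OF that] by blast
    then show ?thesis using inj by (auto simp: inj_image_mem_iff)
  qed
  then have "p x \<le> 1 / \<epsilon> * q (e x)" for x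
    using seminorm_le_of_unit[OF seminorm_linear_compose[OF e Y.seminorm[OF q(1)]] p q(2)] by blast
  then show ?thesis using q(1,2) by (intro bexI[of _ q] exI[of _ "1 / \<epsilon>"]) auto
qed

lemma openin_seminorm_topology_ball:
  "f \<in> S \<Longrightarrow> p \<in> \<Gamma> \<Longrightarrow> 0 < e \<Longrightarrow> openin (seminorm_topology S \<Gamma>) {g \<in> S. p (g - f) < e}"
  unfolding seminorm_topology_def by (rule topology_generated_by_Basis) blast

text \<open>Induction over the generation of open sets; the triangle inequality recentres a
  generating ball at \<open>f\<close>. It is requested only on \<open>S\<close>, since a supremum
  over [0,r] is meaningful only for functions with bounded seminorm values.\<close>

lemma openin_seminorm_topologyD:
  assumes W: "openin (seminorm_topology S \<Gamma>) W" and f: "f \<in> W"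
    and tri: "\<And>p f g h. p \<in> \<Gamma> \<Longrightarrow> f \<in> S \<Longrightarrow> g \<in> S \<Longrightarrow> h \<in> S \<Longrightarrow> p (f - h) \<le> p (f - g) + p (g - h)"
  shows "\<exists>F \<epsilon>. finite F \<and> F \<subseteq> \<Gamma> \<and> \<epsilon> > (0::real) \<and> (\<forall>g\<in>S. (\<forall>p\<in>F. p (g - f) < \<epsilon>) \<longrightarrow> g \<in> W)"
proof -
  have "generate_topology_on {{g \<in> S. p (g - f) < e} | f p e. f \<in> S \<and> p \<in> \<Gamma> \<and> 0 < e} W"
    using W unfolding seminorm_topology_def by (rule openin_topology_generated_by)
  then show ?thesis using f
  proof (induction arbitrary: f)
    case Empty
    then show ?case by simp
  next
    case (Int a b)
    obtain F \<epsilon> where F: "finite F" "F \<subseteq> \<Gamma>" "\<epsilon> > 0" "\<forall>g\<in>S. (\<forall>p\<in>F. p (g - f) < \<epsilon>) \<longrightarrow> g \<in> a"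
      using Int.IH(1)[of f] Int.prems by auto
    obtain F' \<epsilon>' where F': "finite F'" "F' \<subseteq> \<Gamma>" "\<epsilon>' > 0" "\<forall>g\<in>S. (\<forall>p\<in>F'. p (g - f) < \<epsilon>') \<longrightarrow> g \<in> b"
      using Int.IH(2)[of f] Int.prems by auto
    show ?case
      using F F' by (intro exI[of _ "F \<union> F'"] exI[of _ "min \<epsilon> \<epsilon>'"]) auto
  next
    case (UN K)
    then obtain k where "k \<in> K" "f \<in> k" by blast
    from UN.IH[OF this] show ?case using \<open>k \<in> K\<close> by (meson Union_iff)
  next
    case (Basis s)
    then obtain c p e where s: "s = {g \<in> S. p (g - c) < e}" "c \<in> S" "p \<in> \<Gamma>" "0 < e" by blast
    then have f: "f \<in> S" "p (f - c) < e" using Basis by auto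
    have "g \<in> s" if g: "g \<in> S" "p (g - f) < e - p (f - c)" for g
      using tri[OF s(3) g(1) f(1) s(2)] g s by auto
    then show ?case
      using f s(3) by (intro exI[of _ "{p}"] exI[of _ "e - p (f - c)"]) auto
  qed
qed

section \<open>Extension of maps from dense subspaces\<close>

lemma continuous_eq_on_dense:
  fixes f g :: "'a::topological_space \<Rightarrow> 'b::t2_space"
  assumes "continuous_on UNIV f" "continuous_on UNIV g" "closure (range e) = UNIV" "\<And>c. f (e c) = g (e c)"
  shows "f = g"
proof -
  have "closure (range e) \<subseteq> {x. f x = g x}"
    using assms(4) by (intro closure_minimal closed_Collect_eq assms(1,2)) auto
  then show ?thesis using assms(3) by auto
qed

lemma tendsto_filtercomap_nhds:
  assumes "(f \<longlongrightarrow> l) (filtercomap e (nhds y))" "((\<lambda>z. e (u z)) \<longlongrightarrow> y) F"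
  shows "((\<lambda>z. f (u z)) \<longlongrightarrow> l) F"
  by (rule filterlim_compose[OF assms(1)]) (use assms(2) in \<open>simp add: filterlim_filtercomap_iff comp_def\<close>)

text \<open>The domain \<open>'c\<close> has no topology of its own; closeness in it is measured
  through \<open>e\<close>. This allows X to serve once as a dense subspace via j and once as a
  parametrisation of the domain of A via R.\<close>

lemma dense_extension:
  fixes e :: "'c::real_vector \<Rightarrow> 'a::{real_vector, uniform_topological_group_add, t2_space}"
    and f :: "'c \<Rightarrow> 'b::{real_vector, uniform_topological_group_add, t2_space}"
  assumes X: "generating_seminorms \<Gamma>" and Y: "generating_seminorms \<Delta>"
    and complete: "complete (UNIV :: 'b set)"
    and e: "linear e" and dense: "closure (range e) = UNIV" and f: "linear f"
    and bound: "\<And>q. q \<in> \<Delta> \<Longrightarrow> \<exists>p\<in>\<Gamma>. \<exists>C\<ge>0. \<forall>c. q (f c) \<le> C * p (e c)"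
  obtains F where "linear F" "continuous_on UNIV F" "\<And>c. F (e c) = f c"
proof -
  interpret X: generating_seminorms \<Gamma> by (rule X)
  interpret Y: generating_seminorms \<Delta> by (rule Y)
  let ?N = "\<lambda>y. filtercomap e (nhds y)"
  have bot: "?N y \<noteq> bot" for y
  \<comment> \<open>The pullback of the neighbourhoods of \<open>y\<close> is a proper filter
    because the range of \<open>e\<close> is dense; \<open>F y\<close> becomes the limit of
    \<open>f\<close> along it.\<close>
  proof (rule filtercomap_neq_bot)
    fix P assume "eventually P (nhds y)"
    then obtain S where S: "open S" "y \<in> S" "\<And>x. x \<in> S \<Longrightarrow> P x" unfolding eventually_nhds by auto
    then have "S \<inter> range e \<noteq> {}" using dense open_Int_closure_eq_empty[OF S(1), of "range e"] by auto
    then show "\<exists>x. P (e x)" using S(3) by auto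
  qed
  have e_lim: "(e \<longlongrightarrow> y) (?N y)" for y by (rule filterlim_filtercomap)
  have "\<exists>l. (f \<longlongrightarrow> l) (?N y)" for y
  proof (rule Y.convergent_filter[OF complete bot])
    fix q and \<epsilon> :: real assume q: "q \<in> \<Delta>" and \<epsilon>: "\<epsilon> > 0"
    obtain p C where p: "p \<in> \<Gamma>" "C \<ge> 0" "\<And>c. q (f c) \<le> C * p (e c)" using bound[OF q] by blast
    define \<eta> where "\<eta> = \<epsilon> / (2 * C + 1)"
    have \<eta>: "\<eta> > 0" "\<eta> * (2 * C + 1) = \<epsilon>" using \<epsilon> p(2) by (simp_all add: \<eta>_def)
    have "eventually (\<lambda>c. p (e c - y) < \<eta>) (?N y)"
      using e_lim[of y] \<eta>(1) p(1) unfolding X.tendsto_iff by (auto intro: order_tendstoD)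
    moreover have "q (f c - f c') < \<epsilon>" if "p (e c - y) < \<eta>" "p (e c' - y) < \<eta>" for c c'
    proof -
      have "q (f c - f c') \<le> C * p (e c - e c')" using p(3)[of "c - c'"] by (simp add: linear_diff e f)
      also have "\<dots> \<le> C * (\<eta> + \<eta>)"
        using X.diff_triangle[OF p(1), of "e c" "e c'" y] X.diff_commute[OF p(1), of y "e c'"] that p(2)
        by (intro mult_left_mono) auto
      also have "\<dots> < \<epsilon>" using \<eta> by (simp add: algebra_simps)
      finally show ?thesis .
    qed
    ultimately show "\<exists>P. eventually P (?N y) \<and> (\<forall>x y. P x \<longrightarrow> P y \<longrightarrow> q (f x - f y) < \<epsilon>)" by blast
  qed
  then obtain F where F: "\<And>y. (f \<longlongrightarrow> F y) (?N y)" by metis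
  note F_lim = tendsto_filtercomap_nhds[OF F]
  have F_e: "F (e c) = f c" for c
    using F_lim[where u = "\<lambda>_. c" and F = sequentially] by (simp add: tendsto_const_iff)
  have F_bound: "\<exists>p\<in>\<Gamma>. \<exists>C\<ge>0. \<forall>y. q (F y) \<le> C * p y" if q: "q \<in> \<Delta>" for q
  proof -
    obtain p C where p: "p \<in> \<Gamma>" "C \<ge> 0" "\<And>c. q (f c) \<le> C * p (e c)" using bound[OF q] by blast
    have "q (F y) \<le> C * p y" for y
    proof (rule tendsto_le)
      show "?N y \<noteq> bot" by (rule bot)
      show "((\<lambda>c. q (f c)) \<longlongrightarrow> q (F y)) (?N y)"
        by (rule continuous_on_tendsto_compose[OF Y.continuous[OF q] F]) auto
      show "((\<lambda>c. C * p (e c)) \<longlongrightarrow> C * p y) (?N y)"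
        by (intro tendsto_intros continuous_on_tendsto_compose[OF X.continuous[OF p(1)] e_lim]) auto
    qed (simp add: p)
    then show ?thesis using p(1,2) by blast
  qed
  have lin: "linear F"
  proof (rule linearI)
    fix x y
    \<comment> \<open>Two independent approximations, of x and of y, are run simultaneously along
      the product filter.\<close>
    let ?H = "?N x \<times>\<^sub>F ?N y"
    have e1: "((\<lambda>z. e (fst z)) \<longlongrightarrow> x) ?H" "((\<lambda>z. e (snd z)) \<longlongrightarrow> y) ?H"
      by (rule filterlim_compose[OF e_lim filterlim_fst], rule filterlim_compose[OF e_lim filterlim_snd])
    then have "((\<lambda>z. e (fst z + snd z)) \<longlongrightarrow> x + y) ?H"
      by (simp add: linear_add[OF e] tendsto_add)
    from F_lim[OF this] have "((\<lambda>z. f (fst z) + f (snd z)) \<longlongrightarrow> F (x + y)) ?H"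
      by (simp add: linear_add[OF f])
    moreover have "((\<lambda>z. f (fst z) + f (snd z)) \<longlongrightarrow> F x + F y) ?H"
      by (intro tendsto_add F_lim e1)
    moreover have "?H \<noteq> bot" using bot by (simp add: prod_filter_eq_bot)
    ultimately show "F (x + y) = F x + F y" by (metis tendsto_unique)
  next
    fix a x
    have "((\<lambda>c. e (a *\<^sub>R c)) \<longlongrightarrow> a *\<^sub>R x) (?N x)"
      using X.tendsto_scaleR_const[OF e_lim] by (simp add: linear_scale[OF e])
    from F_lim[OF this] have "((\<lambda>c. a *\<^sub>R f c) \<longlongrightarrow> F (a *\<^sub>R x)) (?N x)"
      by (simp add: linear_scale[OF f])
    from tendsto_unique[OF bot this Y.tendsto_scaleR_const[OF F]] show "F (a *\<^sub>R x) = a *\<^sub>R F x" .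
  qed
  show ?thesis
    by (rule that[OF lin linear_bounded_continuous[OF X Y lin F_bound] F_e])
qed

section \<open>Scalar fields\<close>

lemma linear_real:
  assumes X: "locally_convex_space scaleX" and Y: "locally_convex_space scaleY"
    and F: "Vector_Spaces.linear scaleX scaleY F"
  shows "linear F"
proof -
  interpret X: locally_convex_space scaleX by (rule X)
  interpret Y: locally_convex_space scaleY by (rule Y)
  interpret F: Vector_Spaces.linear scaleX scaleY F by (rule F)
  show ?thesis
  proof (rule linearI)
    show "F (x + y) = F x + F y" for x y by (rule F.add)
    show "F (a *\<^sub>R x) = a *\<^sub>R F x" for a x
      using F.scale[of "of_real a" x] by (simp add: X.scale_of_real Y.scale_of_real)
  qed
qed

lemma continuous_on_scale:
  fixes scale :: "'k::real_normed_field \<Rightarrow>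
    'x::{real_vector, uniform_topological_group_add, t2_space} \<Rightarrow> 'x"
  assumes "locally_convex_space scale"
  shows "continuous_on UNIV (scale c)"
proof -
  interpret locally_convex_space scale by (rule assms)
  have "continuous_on UNIV (\<lambda>x. (\<lambda>(c, x). scale c x) (c, x))"
    by (rule continuous_on_compose2[OF continuous_scale]) (auto intro!: continuous_intros)
  then show ?thesis by simp
qed

text \<open>Extensions are built as real linear maps. Compatibility with scalars of
  \<open>'k\<close> holds on the dense range and extends by continuity of both scalar
  multiplications.\<close>

lemma continuous_linear_dense:
  fixes F :: "'a::{real_vector, uniform_topological_group_add, t2_space} \<Rightarrow>
    'b::{real_vector, uniform_topological_group_add, t2_space}"
  assumes X: "locally_convex_space scaleX" and Y: "locally_convex_space scaleY"
    and F: "linear F" "continuous_on UNIV F"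
    and dense: "closure (range e) = UNIV" and scale: "\<And>c k. F (scaleX k (e c)) = scaleY k (F (e c))"
  shows "continuous_linear scaleX scaleY F"
proof -
  interpret X: locally_convex_space scaleX by (rule X)
  interpret Y: locally_convex_space scaleY by (rule Y)
  have "(\<lambda>x. F (scaleX k x)) = (\<lambda>x. scaleY k (F x))" for k
    by (rule continuous_eq_on_dense[OF _ _ dense])
      (auto intro!: continuous_on_compose2[OF F(2)] continuous_on_compose2[OF continuous_on_scale[OF Y]]
        continuous_on_scale[OF X] F(2) scale)
  then have "Vector_Spaces.linear scaleX scaleY F"
    using linear_add[OF F(1)]
    by (simp add: Vector_Spaces.linear_iff X.vector_space_axioms Y.vector_space_axioms fun_eq_iff)
  then show ?thesis using F(2) by (simp add: continuous_linear_def)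
qed

section \<open>The inverse of the generator\<close>

text \<open>At 0 the resolvent is the inverse of -A, so the inverse of A at \<open>y\<close> is its
  value at \<open>- y\<close>.\<close>

lemma generator_inverse:
  assumes X: "locally_convex_space scaleX" and \<rho>: "0 \<in> resolvent_set scaleX (generator_domain T) (generator T)"
  defines "R \<equiv> the_inv_into (generator_domain T) (generator T)"
  shows "continuous_linear scaleX scaleX R" "range R = generator_domain T" "generator T (R x) = x"
proof -
  interpret X: locally_convex_space scaleX by (rule X)
  let ?S = "generator_domain T" and ?A = "generator T"
  have bij: "bij_betw (\<lambda>x. - ?A x) ?S UNIV"
    and lin: "continuous_linear scaleX scaleX (the_inv_into ?S (\<lambda>x. - ?A x))"
    using \<rho> by (simp_all add: resolvent_set_def)
  let ?I = "the_inv_into ?S (\<lambda>x. - ?A x)"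
  have A_I: "?I y \<in> ?S" "?A (?I (- y)) = y" for y
    using bij_betw_the_inv_into[OF bij] f_the_inv_into_f_bij_betw[OF bij, of "- y"]
    by (auto simp: bij_betw_def)
  have inj: "inj_on ?A ?S" using bij by (auto simp: bij_betw_def inj_on_def)
  have R: "R y = ?I (- y)" for y
    unfolding R_def by (rule the_inv_into_f_eq[OF inj A_I(2) A_I(1)])
  show "?A (R x) = x" by (simp add: R A_I)
  have I: "Vector_Spaces.linear scaleX scaleX ?I" "continuous_on UNIV ?I"
    using lin by (auto simp: continuous_linear_def)
  interpret I: Vector_Spaces.linear scaleX scaleX ?I by (rule I)
  have "Vector_Spaces.linear scaleX scaleX R"
    unfolding Vector_Spaces.linear_iff
    by (simp add: X.vector_space_axioms R I.add I.scale I.neg X.scale_minus_right del: minus_add_distrib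
        flip: X.scale_minus_right)
  moreover have "continuous_on UNIV R"
    unfolding R[abs_def] by (intro continuous_on_compose2[OF I(2)] continuous_intros) auto
  ultimately show "continuous_linear scaleX scaleX R" by (simp add: continuous_linear_def)
  have "x \<in> range R" if "x \<in> ?S" for x
    using the_inv_into_f_f[OF inj that] unfolding R_def by (metis rangeI)
  then show "range R = ?S" using A_I(1) R by auto
qed

lemma quasi_equicontinuous_locally:
  assumes \<Gamma>: "\<And>p. p \<in> \<Gamma> \<Longrightarrow> seminorm (*\<^sub>R) p" and T: "quasi_equicontinuous \<Gamma> T" and q: "q \<in> \<Gamma>"
  shows "\<exists>p\<in>\<Gamma>. \<exists>C\<ge>0. \<forall>t\<in>{0..\<tau>}. \<forall>x. q (T t x) \<le> C * p x"
proof -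
  obtain \<omega> where "\<forall>q\<in>\<Gamma>. \<exists>p\<in>\<Gamma>. \<exists>C\<ge>0. \<forall>t\<ge>0. \<forall>x. q (exp (- \<omega> * t) *\<^sub>R T t x) \<le> C * p x"
    using T unfolding quasi_equicontinuous_def by blast
  then obtain p C where p: "p \<in> \<Gamma>" "C \<ge> 0" "\<And>t x. t \<ge> 0 \<Longrightarrow> q (exp (- \<omega> * t) *\<^sub>R T t x) \<le> C * p x"
    using q by meson
  have "q (T t x) \<le> exp (\<bar>\<omega>\<bar> * \<tau>) * C * p x" if t: "t \<in> {0..\<tau>}" for t x
  proof -
    have "q (T t x) = exp (\<omega> * t) * q (exp (- \<omega> * t) *\<^sub>R T t x)"
      by (simp add: seminorm_scaleR[OF \<Gamma>[OF q]] mult.assoc[symmetric] flip: exp_add)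
    also have "\<dots> \<le> exp (\<omega> * t) * (C * p x)" using p(3) t by (intro mult_left_mono) auto
    also have "\<dots> \<le> exp (\<bar>\<omega>\<bar> * \<tau>) * (C * p x)"
    proof (rule mult_right_mono)
      have "\<omega> * t \<le> \<bar>\<omega>\<bar> * \<tau>" using t by (intro mult_mono) auto
      then show "exp (\<omega> * t) \<le> exp (\<bar>\<omega>\<bar> * \<tau>)" by simp
      show "0 \<le> C * p x" using p(2) seminorm_nonneg[OF \<Gamma>[OF p(1)]] by simp
    qed
    finally show ?thesis by (simp add: mult.assoc)
  qed
  then show ?thesis using p(1,2) by (intro bexI[of _ p] exI[of _ "exp (\<bar>\<omega>\<bar> * \<tau>) * C"]) auto
qed

lemma inverted_semigroup_generator:
  fixes scaleX :: "'k::real_normed_field \<Rightarrow>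
      'x::{real_vector, uniform_topological_group_add, t2_space} \<Rightarrow> 'x"
  assumes X: "locally_convex_space scaleX" and \<Gamma>: "fundamental_system scaleX \<Gamma>"
    and complete: "complete (UNIV :: 'x set)"
    and T: "operator_semigroup scaleX T" and T_cont: "strongly_continuous T"
    and T_quasi: "quasi_equicontinuous \<Gamma> T"
    and \<rho>: "0 \<in> resolvent_set scaleX (generator_domain T) (generator T)"
  shows "inverted_semigroup \<Gamma> T (the_inv_into (generator_domain T) (generator T))"
proof -
  define R where "R = the_inv_into (generator_domain T) (generator T)"
  interpret generating_seminorms \<Gamma> by (rule generating_seminorms[OF X \<Gamma>])
  note R = generator_inverse[OF X \<rho>, folded R_def]
  have Tt: "linear (T t)" "continuous_on UNIV (T t)" if "t \<ge> 0" for t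
    using T that linear_real[OF X X] by (auto simp: operator_semigroup_def continuous_linear_def)
  have T_add: "T (t + s) x = T t (T s x)" if "t \<ge> 0" "s \<ge> 0" for t s x
    using T that by (simp add: operator_semigroup_def)
  have T_bounded: "\<exists>p\<in>\<Gamma>. \<exists>C\<ge>0. \<forall>t\<in>{0..\<tau>}. \<forall>x. q (T t x) \<le> C * p x" if "q \<in> \<Gamma>" for q \<tau>
    by (rule quasi_equicontinuous_locally[OF seminorm T_quasi that])
  have deriv: "((\<lambda>t. (T t (R x) - R x) /\<^sub>R t) \<longlongrightarrow> x) (at_right 0)" for x
  proof -
    have "R x \<in> generator_domain T" using R(2) by auto
    then obtain y where y: "((\<lambda>t. (T t (R x) - R x) /\<^sub>R t) \<longlongrightarrow> y) (at_right 0)"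
      unfolding generator_domain_def by blast
    then have "generator T (R x) = y" unfolding generator_def by (intro tendsto_Lim) simp
    with y R(3) show ?thesis by simp
  qed
  \<comment> \<open>T(t) can be moved inside the difference quotients at \<open>R x\<close>, so
    \<open>T t (R x)\<close> lies in the domain and A maps it to \<open>T t x\<close>. Its
    representation as \<open>R y\<close> then identifies y.\<close>
  have R_T: "R (T t x) = T t (R x)" if t: "t \<ge> 0" for t x
  proof -
    have "((\<lambda>h. T t ((T h (R x) - R x) /\<^sub>R h)) \<longlongrightarrow> T t x) (at_right 0)"
      by (rule continuous_on_tendsto_compose[OF Tt(2)[OF t] deriv]) auto
    moreover have "eventually (\<lambda>h. T t ((T h (R x) - R x) /\<^sub>R h) = (T h (T t (R x)) - T t (R x)) /\<^sub>R h) (at_right 0)"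
      unfolding eventually_at_right_field
    proof (intro exI[of _ 1] conjI allI impI)
      fix h :: real assume h: "0 < h" "h < 1"
      have "T t (T h (R x)) = T h (T t (R x))"
        using T_add[of t h] T_add[of h t] t h by (simp add: add.commute)
      then show "T t ((T h (R x) - R x) /\<^sub>R h) = (T h (T t (R x)) - T t (R x)) /\<^sub>R h"
        by (simp add: linear_diff linear_scale Tt(1) t)
    qed simp
    ultimately have lim: "((\<lambda>h. (T h (T t (R x)) - T t (R x)) /\<^sub>R h) \<longlongrightarrow> T t x) (at_right 0)"
      by (rule Lim_transform_eventually)
    then have "T t (R x) \<in> generator_domain T" unfolding generator_domain_def by blast
    then obtain y where y: "T t (R x) = R y" using R(2) by auto
    have "generator T (T t (R x)) = T t x"
      unfolding generator_def by (rule tendsto_Lim[OF _ lim]) simp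
    then show ?thesis using y R(3) by simp
  qed
  have R_real: "linear R" "continuous_on UNIV R"
    using R(1) linear_real[OF X X] by (auto simp: continuous_linear_def)
  show ?thesis
    unfolding R_def[symmetric]
  proof (rule inverted_semigroup.intro[OF generating_seminorms_axioms], rule inverted_semigroup_axioms.intro)
    show "T 0 x = x" for x using T by (simp add: operator_semigroup_def)
    show "continuous_on {0..} (\<lambda>t. T t x)" for x using T_cont by (simp add: strongly_continuous_def)
  qed (fact complete Tt(1) T_add T_bounded R_real R_T deriv)+
qed

section \<open>The extrapolation space\<close>

text \<open>Since R commutes with the semigroup, the difference quotients at \<open>R x\<close> stay
  in its range, and they converge to \<open>x\<close>.\<close>

lemma (in inverted_semigroup) R_dense: "closure (range R) = UNIV"
proof -
  have "x \<in> closure (range R)" for x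
  proof (rule Lim_in_closed_set)
    show "((\<lambda>t. (T t (R x) - R x) /\<^sub>R t) \<longlongrightarrow> x) (at_right 0)" by (rule R_derivative)
    have "(T t (R x) - R x) /\<^sub>R t \<in> closure (range R)" if "t > 0" for t
    proof -
      have "(T t (R x) - R x) /\<^sub>R t = R ((T t x - x) /\<^sub>R t)"
        using that by (simp add: linear_scale[OF R_linear] linear_diff[OF R_linear] R_T)
      then show ?thesis by (metis closure_subset rangeI subsetD)
    qed
    then show "eventually (\<lambda>t. (T t (R x) - R x) /\<^sub>R t \<in> closure (range R)) (at_right 0)"
      by (simp add: eventually_at_filter)
  qed auto
  then show ?thesis by blast
qed

text \<open>The isomorphism between \<open>X\<close> and \<open>X\<^sub>-\<^sub>1\<close> is built in both directions by extension from dense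
  subspaces: \<open>L\<close> extends \<open>A\<close>-inverse from \<open>X\<close> to \<open>X\<^sub>-\<^sub>1\<close> and \<open>G\<close> extends \<open>A\<close> from its domain to \<open>X\<close>.\<close>

lemma extrapolation_isomorphism:
  fixes scaleX :: "'k::real_normed_field \<Rightarrow>
      'x::{real_vector, uniform_topological_group_add, t2_space} \<Rightarrow> 'x"
    and scaleZ :: "'k \<Rightarrow> 'z::{real_vector, uniform_topological_group_add, t2_space} \<Rightarrow> 'z"
  assumes X: "locally_convex_space scaleX"
    and sg: "inverted_semigroup \<Gamma> T R" and R: "R = the_inv_into (generator_domain T) (generator T)"
    and R_lin: "continuous_linear scaleX scaleX R"
    and Z: "extrapolation_space scaleX \<Gamma> T scaleZ j"
  obtains L G where "continuous_linear scaleZ scaleX L" "continuous_linear scaleX scaleZ G"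
    "\<And>x. L (j x) = R x" "\<And>x. G (R x) = j x" "\<And>x. L (G x) = x" "\<And>z. G (L z) = z"
proof -
  interpret inverted_semigroup \<Gamma> T R by (rule sg)
  define \<Gamma>' where "\<Gamma>' = (\<lambda>p x. p (R x)) ` \<Gamma>"
  have lZ: "locally_convex_space scaleZ" and cZ: "complete (UNIV :: 'z set)"
    and j_lin: "Vector_Spaces.linear scaleX scaleZ j" and j_dense: "closure (range j) = UNIV"
    and emb: "embedding_map (seminorm_topology UNIV \<Gamma>') euclidean j"
    using Z unfolding extrapolation_space_def R[symmetric] \<Gamma>'_def by auto
  define \<Delta> where "\<Delta> = {q. seminorm scaleZ q \<and> continuous_on UNIV q}"
  have gZ: "generating_seminorms \<Delta>"
    unfolding \<Delta>_def by (rule generating_seminorms[OF lZ fundamental_system_continuous_seminorms])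
  interpret Z: generating_seminorms \<Delta> by (rule gZ)
  have j: "linear j" by (rule linear_real[OF X lZ j_lin])
  have seminorm': "seminorm (*\<^sub>R) (\<lambda>x. p (R x))" if "p \<in> \<Gamma>" for p
    by (rule seminorm_linear_compose[OF R_linear seminorm[OF that]])
  have ball: "openin (seminorm_topology UNIV \<Gamma>') {x. p (R x) < 1}" if "p \<in> \<Gamma>" for p
    using openin_seminorm_topology_ball[of 0 UNIV "\<lambda>x. p (R x)" \<Gamma>' 1] that by (simp add: \<Gamma>'_def)
  obtain p0 where p0: "p0 \<in> \<Gamma>" using nonempty by blast
  have top: "topspace (seminorm_topology UNIV \<Gamma>') = UNIV"
  proof -
    have "x \<in> topspace (seminorm_topology UNIV \<Gamma>')" for x
      using openin_seminorm_topology_ball[of x UNIV "\<lambda>x. p0 (R x)" \<Gamma>' 1] p0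
      by (auto simp: \<Gamma>'_def linear_0[OF R_linear] zero dest!: openin_subset)
    then show ?thesis by blast
  qed
  \<comment> \<open>Openness of j onto its range gives this bound, which makes R extend along j;
    continuity of j gives the reverse bound, which makes j extend along R.\<close>
  have R_le: "\<exists>q\<in>\<Delta>. \<exists>C\<ge>0. \<forall>x. p (R x) \<le> C * q (j x)" if "p \<in> \<Gamma>" for p
    by (rule embedding_seminorm_bound[OF gZ emb top j seminorm'[OF that] ball[OF that]])
  \<comment> \<open>A neighbourhood in the coarse topology restricts finitely many seminorms p (R
    x). They are dominated by one member of \<open>\<Gamma>\<close> before composing with R, because
    the dominating family lives on X.\<close>
  have j_le: "\<exists>p\<in>\<Gamma>. \<exists>C\<ge>0. \<forall>x. q (j x) \<le> C * p (R x)" if q: "q \<in> \<Delta>" for q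
  proof -
    have "continuous_map (seminorm_topology UNIV \<Gamma>') euclidean j"
      using emb by (simp add: embedding_map_def homeomorphic_eq_everything_map continuous_map_in_subtopology)
    moreover have "openin euclidean (q -` {..<1})"
      unfolding open_openin[symmetric] by (rule open_vimage[OF _ Z.continuous[OF q]]) simp
    ultimately have "openin (seminorm_topology UNIV \<Gamma>')
        {x \<in> topspace (seminorm_topology UNIV \<Gamma>'). j x \<in> q -` {..<1}}"
      by (rule openin_continuous_map_preimage)
    then have op: "openin (seminorm_topology UNIV \<Gamma>') {x. q (j x) < 1}" by (simp add: top)
    have "\<exists>F \<epsilon>. finite F \<and> F \<subseteq> \<Gamma>' \<and> \<epsilon> > (0::real) \<and>
        (\<forall>g\<in>UNIV. (\<forall>p\<in>F. p (g - 0) < \<epsilon>) \<longrightarrow> g \<in> {x. q (j x) < 1})"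
    proof (rule openin_seminorm_topologyD[OF op])
      show "0 \<in> {x. q (j x) < 1}" by (simp add: linear_0[OF j] Z.zero q)
      show "p (f - h) \<le> p (f - g) + p (g - h)" if "p \<in> \<Gamma>'" for p f g h
        using that seminorm_diff_triangle[OF seminorm'] by (auto simp: \<Gamma>'_def)
    qed
    then obtain F \<epsilon> where F: "finite F" "F \<subseteq> \<Gamma>'" "\<epsilon> > 0" "\<And>x. (\<And>p. p \<in> F \<Longrightarrow> p x < \<epsilon>) \<Longrightarrow> q (j x) < 1"
      by auto
    obtain F0 where F0: "F0 \<subseteq> \<Gamma>" "finite F0" "F = (\<lambda>p x. p (R x)) ` F0"
      using finite_subset_image[OF F(1) F(2)[unfolded \<Gamma>'_def]] by blast
    obtain p C where p: "p \<in> \<Gamma>" "C > 0" "\<And>q x. q \<in> F0 \<Longrightarrow> q x \<le> C * p x"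
      using finite_dominated[OF F0(2,1) nonempty] by blast
    have "q (j x) \<le> 1" if x: "p (R x) < \<epsilon> / C" for x
    proof -
      have "p' x < \<epsilon>" if "p' \<in> F" for p'
      proof -
        obtain p'' where p'': "p'' \<in> F0" "p' = (\<lambda>x. p'' (R x))" using \<open>p' \<in> F\<close> F0(3) by blast
        have "p'' (R x) \<le> C * p (R x)" by (rule p(3)[OF p''(1)])
        also have "\<dots> < \<epsilon>" using x p(2) by (simp add: field_simps)
        finally show ?thesis by (simp add: p'')
      qed
      then show ?thesis using F(4) by force
    qed
    then have "q (j x) \<le> 1 / (\<epsilon> / C) * p (R x)" for x
      using F(3) p(2)
      by (intro seminorm_le_of_unit[OF seminorm'[OF p(1)] seminorm_linear_compose[OF j Z.seminorm[OF q]]]) auto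
    then show ?thesis using p(1,2) F(3) by (intro bexI[of _ p] exI[of _ "1 / (\<epsilon> / C)"]) auto
  qed
  obtain L where L: "linear L" "continuous_on UNIV L" "\<And>x. L (j x) = R x"
    using dense_extension[OF gZ generating_seminorms_axioms complete j j_dense R_linear R_le] by blast
  obtain G where G: "linear G" "continuous_on UNIV G" "\<And>x. G (R x) = j x"
    using dense_extension[OF generating_seminorms_axioms gZ cZ R_linear R_dense j j_le] by blast
  have "(\<lambda>x. L (G x)) = (\<lambda>x. x)"
    by (rule continuous_eq_on_dense[OF _ _ R_dense])
      (auto intro!: continuous_on_compose2[OF L(2)] G(2) continuous_intros simp: L G)
  then have LG: "L (G x) = x" for x by meson
  have "(\<lambda>z. G (L z)) = (\<lambda>z. z)"
    by (rule continuous_eq_on_dense[OF _ _ j_dense])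
      (auto intro!: continuous_on_compose2[OF G(2)] L(2) continuous_intros simp: L G)
  then have GL: "G (L z) = z" for z by meson
  have scale: "R (scaleX k x) = scaleX k (R x)" "j (scaleX k x) = scaleZ k (j x)" for k x
    using R_lin j_lin by (auto simp: continuous_linear_def Vector_Spaces.linear_iff)
  have "continuous_linear scaleZ scaleX L"
    by (rule continuous_linear_dense[OF lZ X L(1,2) j_dense]) (simp add: L scale flip: scale(2))
  moreover have "continuous_linear scaleX scaleZ G"
    by (rule continuous_linear_dense[OF X lZ G(1,2) R_dense]) (simp add: G scale flip: scale(1))
  ultimately show ?thesis using that L(3) G(3) LG GL by blast
qed

text \<open>\<open>G\<close> is the isomorphism A_{-1} from X onto the extrapolation space and
  \<open>L\<close> is its inverse.\<close>

locale extrapolated_semigroup = inverted_semigroup \<Gamma> T R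
  for \<Gamma> :: "('x::{real_vector, uniform_topological_group_add, t2_space} \<Rightarrow> real) set"
    and T R +
  fixes scaleX :: "'k::real_normed_field \<Rightarrow> 'x \<Rightarrow> 'x"
    and scaleZ :: "'k \<Rightarrow> 'z::{real_vector, uniform_topological_group_add, t2_space} \<Rightarrow> 'z"
    and j :: "'x \<Rightarrow> 'z" and L :: "'z \<Rightarrow> 'x" and G :: "'x \<Rightarrow> 'z"
  assumes lcs_X: "locally_convex_space scaleX" and lcs_Z: "locally_convex_space scaleZ"
    and T_scale: "t \<ge> 0 \<Longrightarrow> continuous_linear scaleX scaleX (T t)"
    and range_R: "range R = generator_domain T"
    and j_dense: "closure (range j) = UNIV"
    and L: "continuous_linear scaleZ scaleX L" and G: "continuous_linear scaleX scaleZ G"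
    and L_j: "L (j x) = R x" and G_R: "G (R x) = j x" and L_G: "L (G x) = x" and G_L: "G (L z) = z"
begin

abbreviation "S \<equiv> extrapolation_semigroup scaleZ j T"

lemma L_real: "linear L" "continuous_on UNIV L"
  using L linear_real[OF lcs_Z lcs_X] by (auto simp: continuous_linear_def)

lemma G_real: "linear G" "continuous_on UNIV G"
  using G linear_real[OF lcs_X lcs_Z] by (auto simp: continuous_linear_def)

lemma continuous_linear_compose:
  assumes "continuous_linear s1 s2 f" "continuous_linear s2 s3 g"
  shows "continuous_linear s1 s3 (\<lambda>x. g (f x))"
  using assms continuous_on_compose2[of UNIV g UNIV f]
  unfolding continuous_linear_def Vector_Spaces.linear_iff by auto

text \<open>The conjugate of T(t) by \<open>G\<close> has the defining properties, and a continuous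
  map is determined on the dense range of \<open>j\<close>; this settles the
  \<open>THE\<close>.\<close>

lemma extrapolation_semigroup_eq:
  assumes t: "t \<ge> 0"
  shows "S t = (\<lambda>z. G (T t (L z)))"
  unfolding extrapolation_semigroup_def
proof (rule the_equality)
  have "continuous_linear scaleZ scaleZ (\<lambda>z. G (T t (L z)))"
    by (rule continuous_linear_compose[OF continuous_linear_compose[OF L T_scale[OF t]] G])
  moreover have "G (T t (L (j x))) = j (T t x)" for x
    by (metis L_j R_T[OF t] G_R)
  ultimately show *: "continuous_linear scaleZ scaleZ (\<lambda>z. G (T t (L z))) \<and> (\<forall>x. G (T t (L (j x))) = j (T t x))"
    by blast
  show "F = (\<lambda>z. G (T t (L z)))"
    if "continuous_linear scaleZ scaleZ F \<and> (\<forall>x. F (j x) = j (T t x))" for F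
    using that * by (intro continuous_eq_on_dense[OF _ _ j_dense]) (auto simp: continuous_linear_def)
qed

lemma extrapolation_derivative:
  "((\<lambda>t. (S t (j x) - j x) /\<^sub>R t) \<longlongrightarrow> G x) (at_right 0)"
proof -
  have "((\<lambda>t. G ((T t (R x) - R x) /\<^sub>R t)) \<longlongrightarrow> G x) (at_right 0)"
    by (rule continuous_on_tendsto_compose[OF G_real(2) R_derivative]) auto
  moreover have "eventually (\<lambda>t. G ((T t (R x) - R x) /\<^sub>R t) = (S t (j x) - j x) /\<^sub>R t) (at_right 0)"
    by (auto simp: eventually_at_filter extrapolation_semigroup_eq L_j G_R linear_scale[OF G_real(1)]
        linear_diff[OF G_real(1)])
  ultimately show ?thesis by (rule Lim_transform_eventually)
qed

text \<open>Every \<open>j x\<close> lies in the domain of the extrapolated generator with value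
  \<open>G x\<close>, so the description reduces to solving \<open>G x = z\<close>.\<close>

lemma extrapolation_inverse_eq: "extrapolation_inverse scaleZ j T z = L z"
proof -
  have "j x \<in> generator_domain S" "generator S (j x) = G x" for x
    unfolding generator_domain_def generator_def
    using extrapolation_derivative[of x] by (auto intro: tendsto_Lim)
  then have "extrapolation_inverse scaleZ j T z = (THE x. G x = z)"
    unfolding extrapolation_inverse_def by simp
  also have "\<dots> = L z"
    by (rule the_equality) (auto simp: G_L L_G)
  finally show ?thesis .
qed

text \<open>The integral in the extrapolation space is the image under \<open>G\<close> of one in X,
  since continuous linear maps preserve Riemann sums and their limits.\<close>

lemma extrapolation_convolution:
  assumes r: "r \<ge> 0" and f: "continuous_on {0..r} (\<lambda>s. L (g s))"
  shows "convolution S g r = G (convolution T (\<lambda>s. L (g s)) r)"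
proof -
  interpret Z: generating_seminorms "{q. seminorm scaleZ q \<and> continuous_on UNIV q}"
    by (rule generating_seminorms[OF lcs_Z fundamental_system_continuous_seminorms])
  have "has_riemann_integral (\<lambda>s. G (T (r - s) (L (g s)))) (G (convolution T (\<lambda>s. L (g s)) r)) 0 r"
    by (rule has_riemann_integral_linear[OF G_real convolution_has_integral[OF r f]])
  then have "has_riemann_integral (\<lambda>s. S (r - s) (g s)) (G (convolution T (\<lambda>s. L (g s)) r)) 0 r"
    by (rule has_riemann_integral_cong) (simp add: extrapolation_semigroup_eq)
  then show ?thesis
    unfolding convolution_def by (rule Z.riemann_integral_eq[OF r])
qed

text \<open>\<open>G\<close> maps the domain of A, which is the range of R, onto the range of j and
  is injective; so membership is preserved in both directions.\<close>

lemma C_admissible_iff: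
  assumes r: "r \<ge> 0" and B: "continuous_on UNIV B"
  shows "C_admissible scaleZ j T B r \<longleftrightarrow>
    (\<forall>f\<in>C_space r. convolution T (L \<circ> B \<circ> f) r \<in> generator_domain T)"
proof -
  have "convolution S (B \<circ> f) r \<in> range j \<longleftrightarrow> convolution T (L \<circ> B \<circ> f) r \<in> generator_domain T"
    if f: "f \<in> C_space r" for f
  proof -
    have "continuous_on {0..r} (\<lambda>s. L ((B \<circ> f) s))"
      using f continuous_on_compose2[OF B, of "{0..r}" f]
      by (intro continuous_on_compose2[OF L_real(2)]) (auto simp: C_space_def comp_def)
    then have "convolution S (B \<circ> f) r = G (convolution T (L \<circ> B \<circ> f) r)"
      using extrapolation_convolution[OF r] by (simp add: comp_def)
    moreover have "G x \<in> range j \<longleftrightarrow> x \<in> range R" for x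
      by (metis G_R L_G rangeE rangeI)
    ultimately show ?thesis by (simp add: range_R)
  qed
  then show ?thesis by (simp add: C_admissible_def)
qed

end

section \<open>Admissibility and maximal regularity\<close>

context input_operator
begin

lemma C_space_continuous: "f \<in> C_space r \<Longrightarrow> continuous_on {0..r} f"
  by (simp add: C_space_def)

text \<open>Continuity at the zero function gives a neighbourhood described by finitely many
  sup-seminorms. One seminorm on U dominates them, and scaling turns the neighbourhood into the unit
  ball.\<close>

lemma three_C_space_bound:
  assumes range_R: "range R = generator_domain T" and C3: "three_C_space \<Delta> T D r" and q: "q \<in> \<Gamma>"
  shows "\<exists>p\<in>\<Delta>. \<exists>K. \<forall>f\<in>C_space r. (\<forall>s\<in>{0..r}. p (f s) \<le> 1) \<longrightarrow> q (response f r) \<le> K"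
proof -
  let ?n = "\<lambda>p f. SUP s\<in>{0..r}. p (f s)"
  have dom: "convolution T (D \<circ> f) r = R (response f r)" if "f \<in> C_space r" for f
    using C3 that unfolding three_C_space_def range_R[symmetric] response_def by (auto simp: generator_R)
  have cont: "continuous_map (C_topology \<Delta> r) euclidean (\<lambda>f. response f r)"
    using C3 unfolding three_C_space_def response_def by blast
  have bdd: "bdd_above ((\<lambda>s. p (f s)) ` {0..r})" if "p \<in> \<Delta>" "f \<in> C_space r" for p and f :: "real \<Rightarrow> 'u"
    using U.bounded_on_interval[OF C_space_continuous[OF that(2)] that(1)] by (auto intro: bdd_aboveI2)
  have diff_C: "(\<lambda>s. f s - g s) \<in> C_space r" if "f \<in> C_space r" "g \<in> C_space r" for f g :: "real \<Rightarrow> 'u"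
    using that by (auto simp: C_space_def intro!: continuous_on_diff)
  have "openin (C_topology \<Delta> r) {f \<in> topspace (C_topology \<Delta> r). response f r \<in> q -` {..<1}}"
  proof (rule openin_continuous_map_preimage[OF cont])
    show "openin euclidean (q -` {..<1})"
      unfolding open_openin[symmetric] by (rule open_vimage[OF _ continuous[OF q]]) simp
  qed
  moreover have top: "topspace (C_topology \<Delta> r) = C_space r"
  proof (rule equalityI)
    have "openin (C_topology \<Delta> r) W \<Longrightarrow> W \<subseteq> C_space r" for W
      unfolding C_topology_def seminorm_topology_def openin_topology_generated_by_iff
      by (induction rule: generate_topology_on.induct) auto
    then show "topspace (C_topology \<Delta> r) \<subseteq> C_space r" by (simp add: topspace_def Sup_le_iff)
    obtain p where p: "p \<in> \<Delta>" using U.nonempty by blast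
    have "f \<in> topspace (C_topology \<Delta> r)" if f: "f \<in> C_space r" for f
    proof -
      have "openin (C_topology \<Delta> r) {g \<in> C_space r. ?n p (g - f) < 1}"
        unfolding C_topology_def using f p by (intro openin_seminorm_topology_ball) auto
      moreover have "f \<in> {g \<in> C_space r. ?n p (g - f) < 1}" using f r_pos by (simp add: U.zero p)
      ultimately show ?thesis using openin_subset by blast
    qed
    then show "C_space r \<subseteq> topspace (C_topology \<Delta> r)" by blast
  qed
  ultimately have op: "openin (seminorm_topology (C_space r) (?n ` \<Delta>)) {f \<in> C_space r. q (response f r) < 1}"
    by (simp add: C_topology_def)
  have zero_C: "(\<lambda>_. 0) \<in> C_space r" by (simp add: C_space_def)
  have "response (\<lambda>_. 0) r = 0" using r_pos by (simp add: response_const linear_0[OF D_linear] T_null)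
  then have mem: "(\<lambda>_. 0) \<in> {f \<in> C_space r. q (response f r) < 1}" using zero_C by (simp add: zero q)
  have "\<exists>F \<epsilon>. finite F \<and> F \<subseteq> ?n ` \<Delta> \<and> \<epsilon> > (0::real) \<and>
      (\<forall>g\<in>C_space r. (\<forall>P\<in>F. P (g - (\<lambda>_. 0)) < \<epsilon>) \<longrightarrow> g \<in> {f \<in> C_space r. q (response f r) < 1})"
  proof (rule openin_seminorm_topologyD[OF op mem])
    fix P and f g h :: "real \<Rightarrow> 'u"
    assume "P \<in> ?n ` \<Delta>" and C: "f \<in> C_space r" "g \<in> C_space r" "h \<in> C_space r"
    then obtain p where p: "p \<in> \<Delta>" "P = ?n p" by blast
    have "p (f s - h s) \<le> ?n p (\<lambda>s. f s - g s) + ?n p (\<lambda>s. g s - h s)" if s: "s \<in> {0..r}" for s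
    proof -
      have "p (f s - h s) \<le> p (f s - g s) + p (g s - h s)" by (rule U.diff_triangle[OF p(1)])
      also have "\<dots> \<le> ?n p (\<lambda>s. f s - g s) + ?n p (\<lambda>s. g s - h s)"
        using s C by (intro add_mono cSUP_upper bdd p diff_C)
      finally show ?thesis .
    qed
    then show "P (f - h) \<le> P (f - g) + P (g - h)"
      unfolding p(2) fun_diff_def using r_pos by (intro cSUP_least) auto
  qed
  then obtain F \<epsilon> where F: "finite F" "F \<subseteq> ?n ` \<Delta>" "\<epsilon> > 0"
    "\<And>g. g \<in> C_space r \<Longrightarrow> (\<And>P. P \<in> F \<Longrightarrow> P g < \<epsilon>) \<Longrightarrow> q (response g r) < 1"
    by (auto simp: fun_diff_def)
  obtain F0 where F0: "F0 \<subseteq> \<Delta>" "finite F0" "F = ?n ` F0"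
    using finite_subset_image[OF F(1,2)] by blast
  obtain p C where p: "p \<in> \<Delta>" "C > 0" "\<And>q x. q \<in> F0 \<Longrightarrow> q x \<le> C * p x"
    using U.finite_dominated[OF F0(2,1) U.nonempty] by blast
  \<comment> \<open>Half of the critical value: the supremum of the scaled function is only known to
    be at most \<open>C * c\<close>, while the neighbourhood asks for strict inequality.\<close>
  define c where "c = \<epsilon> / (2 * C)"
  have c: "c > 0" "C * c < \<epsilon>" using F(3) p(2) by (simp_all add: c_def)
  have "q (response f r) \<le> 1 / c" if f: "f \<in> C_space r" "\<And>s. s \<in> {0..r} \<Longrightarrow> p (f s) \<le> 1" for f
  proof -
    let ?g = "\<lambda>s. c *\<^sub>R f s"
    have g: "?g \<in> C_space r"
      using f(1) by (auto simp: C_space_def continuous_on_def intro: U.tendsto_scaleR_const)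
    have "q (response ?g r) < 1"
    proof (rule F(4)[OF g])
      fix P assume "P \<in> F"
      then obtain p' where p': "p' \<in> F0" "P = ?n p'" using F0(3) by blast
      have "P ?g \<le> C * c"
        unfolding p'(2)
      proof (rule cSUP_least)
        fix s assume s: "s \<in> {0..r}"
        have "p' (c *\<^sub>R f s) \<le> C * p (c *\<^sub>R f s)" by (rule p(3)[OF p'(1)])
        also have "\<dots> \<le> C * c"
          using c f(2)[OF s] p by (intro mult_left_mono) (simp_all add: U.homogeneous)
        finally show "p' (c *\<^sub>R f s) \<le> C * c" .
      qed (use r_pos in auto)
      then show "P ?g < \<epsilon>" using c by simp
    qed
    \<comment> \<open>Homogeneity is derived from injectivity in the form
      \<open>response_eqI\<close> and the known membership in the domain at time r; bounded
      semivariation is still to be proved at this stage.\<close>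
    moreover have "response ?g r = c *\<^sub>R response f r"
    proof (rule response_eqI)
      have "convolution T (D \<circ> ?g) r = convolution T (\<lambda>s. c *\<^sub>R (D \<circ> f) s) r"
        by (simp add: comp_def linear_scale[OF D_linear])
      also have "\<dots> = c *\<^sub>R convolution T (D \<circ> f) r"
        using r_pos by (intro convolution_scaleR D_compose C_space_continuous f(1)) simp
      also have "\<dots> = R (c *\<^sub>R response f r)"
        by (simp add: dom[OF f(1)] linear_scale[OF R_linear])
      finally show "convolution T (D \<circ> ?g) r = R (c *\<^sub>R response f r)" .
    qed
    ultimately show ?thesis using c by (simp add: homogeneous q field_simps)
  qed
  then show ?thesis using p(1) by blast
qed

text \<open>\<open>S\<close> is the semigroup restricted to U, written through the inclusion. As U
  has the subspace topology, its seminorms are dominated by seminorms of X, so continuity of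
  \<open>S h\<close> along f and closeness to the identity are inherited from T on the curve
  \<open>i (f s)\<close>.\<close>

lemma response_continuous_invariant_subspace:
  assumes V: "bounded_semivariation \<Gamma> \<Delta> 0 r (\<lambda>t u. T t (D u))" and f: "continuous_on {0..r} f"
    and i: "linear i" "embedding_map euclidean euclidean i"
    and inv: "\<And>t. t \<ge> 0 \<Longrightarrow> T t ` range i \<subseteq> range i" and comm: "commuting T i D"
  shows "continuous_on {0..r} (response f)"
proof -
  define S where "S h u = inv i (T h (i u))" for h u
  have i_S: "i (S h u) = T h (i u)" if "h \<ge> 0" for h u
    unfolding S_def using inv[OF that] by (intro f_inv_into_f) blast
  have i_cont: "continuous_on UNIV i"
    using i(2) by (simp add: embedding_map_def homeomorphic_eq_everything_map continuous_map_in_subtopology)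
  have i_le: "\<exists>q\<in>\<Gamma>. \<exists>C\<ge>0. \<forall>u. p u \<le> C * q (i u)" if p: "p \<in> \<Delta>" for p
  proof (rule embedding_seminorm_bound[OF generating_seminorms_axioms i(2) _ i(1) U.seminorm[OF p]])
    have "open (p -` {..<1})" by (rule open_vimage[OF _ U.continuous[OF p]]) simp
    then show "openin euclidean {x. p x < 1}" by (simp add: vimage_def)
  qed simp
  have fi: "continuous_on {0..r} (\<lambda>s. i (f s))"
    by (rule continuous_on_compose2[OF i_cont f]) auto
  show ?thesis
  proof (rule response_continuous_commuting[OF V f])
    show "T h (D u) = D (S h u)" if "h \<ge> 0" for h u
      using comm that by (simp add: commuting_def S_def)
    show "continuous_on {0..r} (\<lambda>s. S h (f s))" if h: "h \<ge> 0" for h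
      unfolding continuous_on_def U.tendsto_iff
    proof (intro ballI)
      fix s p assume s: "s \<in> {0..r}" and p: "p \<in> \<Delta>"
      obtain q C where q: "q \<in> \<Gamma>" "C \<ge> 0" "\<And>u. p u \<le> C * q (i u)" using i_le[OF p] by blast
      have "continuous_on {0..r} (\<lambda>s. T h (i (f s)))"
        by (rule continuous_on_compose2[OF T_continuous_UNIV[OF h] fi]) auto
      then have "((\<lambda>x. C * q (T h (i (f x)) - T h (i (f s)))) \<longlongrightarrow> C * 0) (at s within {0..r})"
        using s q(1) unfolding continuous_on_def tendsto_iff by (intro tendsto_intros) blast
      from real_tendsto_sandwich[OF _ _ tendsto_const this[simplified]]
      show "((\<lambda>x. p (S h (f x) - S h (f s))) \<longlongrightarrow> 0) (at s within {0..r})"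
        using q(3)[of "S h (f _) - S h (f s)"] h
        by (simp add: U.nonneg p linear_diff[OF i(1)] i_S)
    qed
    fix p and e :: real assume p: "p \<in> \<Delta>" and e: "e > 0"
    obtain q C where q: "q \<in> \<Gamma>" "C \<ge> 0" "\<And>u. p u \<le> C * q (i u)" using i_le[OF p] by blast
    define e' where "e' = e / (C + 1)"
    have e': "e' > 0" "C * e' \<le> e" using e q(2) by (simp_all add: e'_def field_simps)
    obtain \<delta> where \<delta>: "\<delta> > 0" "\<And>h s. h \<in> {0..<\<delta>} \<Longrightarrow> s \<in> {0..r} \<Longrightarrow> q (T h (i (f s)) - i (f s)) \<le> e'"
      using T_near_identity[OF fi q(1) e'(1)] by metis
    have "p (S h (f s) - f s) \<le> e" if "h \<in> {0..<\<delta>}" "s \<in> {0..r}" for h s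
    proof -
      have "p (S h (f s) - f s) \<le> C * q (T h (i (f s)) - i (f s))"
        using q(3)[of "S h (f s) - f s"] that by (simp add: linear_diff[OF i(1)] i_S)
      also have "\<dots> \<le> C * e'" using \<delta>(2)[OF that] q(2) by (rule mult_left_mono)
      finally show ?thesis using e'(2) by simp
    qed
    then show "\<exists>\<delta>>0. \<forall>h\<in>{0..<\<delta>}. \<forall>s\<in>{0..r}. p (S h (f s) - f s) \<le> e" using \<delta>(1) by blast
  qed
qed

end

lemma continuous_on_imp_right_continuous:
  assumes "continuous_on {a..b} g"
  shows "right_continuous_on a b g"
  unfolding right_continuous_on_def
proof
  fix t assume t: "t \<in> {a..<b}"
  then have "(g \<longlongrightarrow> g t) (at t within {a..b})" using assms by (simp add: continuous_on_def)
  then have "(g \<longlongrightarrow> g t) (at t within {t..b})" by (rule tendsto_within_subset) (use t in auto)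
  then show "(g \<longlongrightarrow> g t) (at_right t)" using t by (simp add: at_within_Icc_at_right)
qed

theorem corollary5p4:
  fixes r :: real
    and scaleX :: "'k::real_normed_field \<Rightarrow>
      'x::{real_vector, uniform_topological_group_add, t2_space} \<Rightarrow> 'x"
    and scaleU :: "'k \<Rightarrow> 'u::{real_vector, uniform_topological_group_add, t2_space} \<Rightarrow> 'u"
    and scaleZ :: "'k \<Rightarrow> 'z::{real_vector, uniform_topological_group_add, t2_space} \<Rightarrow> 'z"
    and \<Gamma>\<^sub>X :: "('x \<Rightarrow> real) set"
    and \<Gamma>\<^sub>U :: "('u \<Rightarrow> real) set"
    and T :: "real \<Rightarrow> 'x \<Rightarrow> 'x"
    and j :: "'x \<Rightarrow> 'z"
    and B :: "'u \<Rightarrow> 'z"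
  assumes "0 < r"
    and "locally_convex_space scaleX" and "fundamental_system scaleX \<Gamma>\<^sub>X"
    and "complete (UNIV :: 'x set)"
    and "operator_semigroup scaleX T" and "strongly_continuous T"
    and "quasi_equicontinuous \<Gamma>\<^sub>X T"
    and "0 \<in> resolvent_set scaleX (generator_domain T) (generator T)"
    and "extrapolation_space scaleX \<Gamma>\<^sub>X T scaleZ j"
    and "locally_convex_space scaleU" and "fundamental_system scaleU \<Gamma>\<^sub>U"
    and "continuous_linear scaleU scaleZ B"
  shows
    "let D = extrapolation_inverse scaleZ j T \<circ> B;
         a = C_maximal_regularity T D r;
         b = (\<forall>f \<in> C_space r.
           (\<forall>t\<in>{0..r}. convolution T (D \<circ> f) t \<in> generator_domain T) \<and>
           right_continuous_on 0 r (\<lambda>t. generator T (convolution T (D \<circ> f) t)));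
         c = C_admissible scaleZ j T B r;
         d = bounded_semivariation \<Gamma>\<^sub>X \<Gamma>\<^sub>U 0 r (\<lambda>t u. T t (D u))
     in (a \<longrightarrow> b) \<and> (d \<longrightarrow> b) \<and> (b \<longrightarrow> c) \<and>
        (three_C_space \<Gamma>\<^sub>U T D r \<longrightarrow> c \<longrightarrow> d) \<and>
        ((\<exists>i. invariant_subspace scaleU scaleX T i \<and> commuting T i D) \<or>
           generalised_schwartz \<Gamma>\<^sub>X \<longrightarrow> d \<longrightarrow> a)"
proof -
  define R where "R = the_inv_into (generator_domain T) (generator T)"
  note R = generator_inverse[OF assms(2,8), folded R_def]
  have sg: "inverted_semigroup \<Gamma>\<^sub>X T R"
    unfolding R_def by (rule inverted_semigroup_generator[OF assms(2-8)])
  obtain L G where LG: "continuous_linear scaleZ scaleX L" "continuous_linear scaleX scaleZ G"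
    "\<And>x. L (j x) = R x" "\<And>x. G (R x) = j x" "\<And>x. L (G x) = x" "\<And>z. G (L z) = z"
    by (rule extrapolation_isomorphism[OF assms(2) sg R_def R(1) assms(9)]) blast
  have lZ: "locally_convex_space scaleZ" and j_dense: "closure (range j) = UNIV"
    using assms(9) by (auto simp: extrapolation_space_def)
  interpret E: extrapolated_semigroup \<Gamma>\<^sub>X T R scaleX scaleZ j L G
    using sg assms(2,5) lZ R(2) j_dense LG
    by (auto simp: extrapolated_semigroup_def extrapolated_semigroup_axioms_def operator_semigroup_def)
  define D where "D = extrapolation_inverse scaleZ j T \<circ> B"
  have D: "D = L \<circ> B" by (simp add: D_def fun_eq_iff E.extrapolation_inverse_eq)
  have B: "linear B" "continuous_on UNIV B"
    using assms(12) linear_real[OF assms(10) lZ] by (auto simp: continuous_linear_def)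
  have gU: "generating_seminorms \<Gamma>\<^sub>U" by (rule generating_seminorms[OF assms(10,11)])
  interpret I: input_operator \<Gamma>\<^sub>X T R \<Gamma>\<^sub>U D r
  proof (intro input_operator.intro sg gU input_operator_axioms.intro assms(1))
    show "linear D" unfolding D by (rule linear_compose[OF B(1) E.L_real(1)])
    show "continuous_on UNIV D"
      unfolding D comp_def by (rule continuous_on_compose2[OF E.L_real(2) B(2)]) auto
  qed
  define a where "a = C_maximal_regularity T D r"
  define b where "b = (\<forall>f \<in> C_space r.
           (\<forall>t\<in>{0..r}. convolution T (D \<circ> f) t \<in> generator_domain T) \<and>
           right_continuous_on 0 r (\<lambda>t. generator T (convolution T (D \<circ> f) t)))"
  define c where "c = C_admissible scaleZ j T B r"
  define d where "d = bounded_semivariation \<Gamma>\<^sub>X \<Gamma>\<^sub>U 0 r (\<lambda>t u. T t (D u))"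
  have response: "(\<lambda>t. generator T (convolution T (D \<circ> f) t)) = I.response f" for f
    by (simp add: I.response_def fun_eq_iff)
  have dom: "convolution T (D \<circ> f) t \<in> generator_domain T" if d "f \<in> C_space r" "t \<in> {0..r}" for f t
  proof -
    have "continuous_on {0..t} f"
      using that(3) by (intro continuous_on_subset[OF I.C_space_continuous[OF that(2)]]) auto
    then show ?thesis
      using I.response_convergence(2)[OF that(1)[unfolded d_def] that(3)] E.generator_domain_R by simp
  qed
  have ab: "a \<longrightarrow> b"
    unfolding a_def b_def C_maximal_regularity_def by (blast intro: continuous_on_imp_right_continuous)
  have db: "d \<longrightarrow> b"
    unfolding b_def response
    using dom by (auto simp: d_def intro!: I.response_right_continuous I.C_space_continuous)
  have c_iff: "c \<longleftrightarrow> (\<forall>f\<in>C_space r. convolution T (D \<circ> f) r \<in> generator_domain T)"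
    unfolding c_def D using assms(1) B(2) by (intro E.C_admissible_iff) auto
  \<comment> \<open>In this form \<open>c\<close> is the domain clause of \<open>b\<close> read at
    \<open>t = r\<close>.\<close>
  then have bc: "b \<longrightarrow> c" unfolding b_def using assms(1) by auto
  have cd: "d" if C3: "three_C_space \<Gamma>\<^sub>U T D r" and c
    unfolding d_def
  proof (rule I.bounded_semivariation_if_response_continuous)
    show "convolution T (D \<circ> f) r = R (I.response f r)" if "f \<in> C_space r" for f
    proof -
      have "convolution T (D \<circ> f) r \<in> range R" using \<open>c\<close> that unfolding c_iff R(2) by simp
      then obtain w where "convolution T (D \<circ> f) r = R w" by (rule imageE)
      then show ?thesis by (simp add: I.response_eqI)
    qed
  qed (rule I.three_C_space_bound[OF R(2) C3])
  have da: "a" if cases: "(\<exists>i. invariant_subspace scaleU scaleX T i \<and> commuting T i D) \<or>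
      generalised_schwartz \<Gamma>\<^sub>X" and d
    unfolding a_def C_maximal_regularity_def response
  proof (intro ballI conjI)
    fix f :: "real \<Rightarrow> 'u" assume f: "f \<in> C_space r"
    note V = \<open>d\<close>[unfolded d_def] and f' = I.C_space_continuous[OF f]
    show "convolution T (D \<circ> f) t \<in> generator_domain T" if "t \<in> {0..r}" for t
      by (rule dom[OF \<open>d\<close> f that])
    from cases show "continuous_on {0..r} (I.response f)"
    proof (elim disjE exE conjE)
      fix i assume i: "invariant_subspace scaleU scaleX T i" and comm: "commuting T i D"
      have "linear i"
        using i linear_real[OF assms(10,2)] by (simp add: invariant_subspace_def)
      then show ?thesis
        using i comm by (intro I.response_continuous_invariant_subspace[OF V f'])
          (auto simp: invariant_subspace_def)
    next
      assume "generalised_schwartz \<Gamma>\<^sub>X"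
      then show ?thesis by (rule I.response_continuous_schwartz[OF V f'])
    qed
  qed
  show ?thesis
    unfolding Let_def D_def[symmetric] a_def[symmetric] b_def[symmetric] c_def[symmetric] d_def[symmetric]
    by (intro conjI impI ab db bc) (erule (1) cd, erule (1) da)
qed

end
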